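(* Under the standing assumption, Primal Problem I and Primal Problem II (defined in the context) both have unique optimal solutions, denoted $(\tilde S^*_{\mathcal P_I},F^*_{\mathcal P_I},\bar F^*_{\mathcal P_I})$ and $(\tilde{\mathfrak X}^*_{\mathcal P_{II}},F^*_{\mathcal P_{II}},\bar F^*_{\mathcal P_{II}})$ respectively. Furthermore both are equivalent to Problem 1 (minimize $\hat J(F,\bar F)=\sum_{l=1}^rJ(z_l;F,\bar F)$ over $(F,\bar F)\in\mathcal F$), whose optimal gains are denoted $(F^*,\bar F^* )$, in the sense that $$J_{\mathcal P_I}=J_{\mathcal P_{II}}=\hat J(F^*,\bar F^* ),\qquad F^*_{\mathcal P_I}=F^*_{\mathcal P_{II}}=F^*,\qquad \bar F^*_{\mathcal P_I}=\bar F^*_{\mathcal P_{II}}=\bar F^*.$$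
   Context: Notation: $'$ is transpose; $\mathcal S_k$ is the set of real symmetric $k\times k$ matrices; $>0$ / $\ge 0$ denote positive (semi)definiteness; $\mathrm{diag}$ is block diagonal. System. $A_1,\bar A_1,A_2,\bar A_2\in\mathbb R^{n\times n}$, $B_1,\bar B_1,B_2,\bar B_2\in\mathbb R^{n\times m}$, $Q,\bar Q\in\mathcal S_n$, $R,\bar R\in\mathcal S_m$. Put $\hat A_i=A_i+\bar A_i$, $\hat B_i=B_i+\bar B_i$ ($i=1,2$), $\hat Q=Q+\bar Q$, $\hat R=R+\bar R$, $\Lambda=\mathrm{diag}(Q,R)$, $\bar\Lambda=\mathrm{diag}(\bar Q,\bar R)$. The mean-field stochastic system is $$x_{k+1}=(A_1x_k+\bar A_1\mathbb Ex_k+B_1u_k+\bar B_1\mathbb Eu_k)+(A_2x_k+\bar A_2\mathbb Ex_k+B_2u_k+\bar B_2\mathbb Eu_k)w_k,\quad x_0=z,\ k\ge0,$$ with $w_k$ independent scalar random variables of mean $0$ and variance $1$, and $z$ a square-integrable random vector in $\mathbb R^n$ independent of the noise. Controls are $u_k=Fx_k+\bar F\mathbb Ex_k$, $F,\bar F\in\mathbb R^{m\times n}$. The cost $J(z;F,\bar F)$ is $$\sum_{k=0}^\infty\mathbb E\Big\{\begin{bmatrix}x_k\\ u_k\end{bmatrix}'\Lambda\begin{bmatrix}x_k\\ u_k\end{bmatrix}+\begin{bmatrix}\mathbb Ex_k\\ \mathbb Eu_k\end{bmatrix}'\bar\Lambda\begin{bmatrix}\mathbb Ex_k\\ \mathbb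 Eu_k\end{bmatrix}\Big\}$$ under this control. A system is asymptotically mean-square stable (ASMS) if $\mathbb E\|x_k\|^2\to0$ for every initial state; the controlled system is stabilizable if some such feedback makes the closed loop ASMS. Stabilizing gains. With $\mathcal A_1^{F,\bar F}=\begin{bmatrix}\hat A_1+\hat B_1(F+\bar F)&0\\ 0&A_1+B_1F\end{bmatrix}$, $\mathcal A_2^{F}=\begin{bmatrix}0&0\\ 0&A_2+B_2F\end{bmatrix}$, $\mathcal A_3^{F,\bar F}=\begin{bmatrix}0&0\\ \hat A_2+\hat B_2(F+\bar F)&0\end{bmatrix}$, $\mathcal F$ is the set of pairs $(F,\bar F)$ such that the spectrum of the linear operator $\mathcal X\mapsto(\mathcal A_1^{F,\bar F})'\mathcal X\mathcal A_1^{F,\bar F}+(\mathcal A_2^F)'\mathcal X\mathcal A_2^F+(\mathcal A_3^{F,\bar F})'\mathcal X\mathcal A_3^{F,\bar F}$ on $\mathcal S_{2n}$ lies in the open unit disc. Augmented matrices (each displayed inner block is $(n+m)\times(n+m)$): $\mathbf A_1^{F,\bar F}=\mathrm{diag}\Big(\begin{bmatrix}\hat A_1&\hat B_1\\ (F+\bar F)\hat A_1&(F+\bar F)\hat B_1\end{bmatrix},\begin{bmatrix}A_1&B_1\\ F A_1&F B_1\end{bmatrix}\Big)$, $\mathbf A_2^F=\mathrm{diag}\Big(0,\begin{bmatrix}A_2&B_2\\ F A_2&F B_2\end{bmatrix}\Big)$, and $\mathbf A_3^F$ is the $2\times2$ block matrix whose only nonzero block is the lower-left one, $\begin{bmatrix}\hat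 A_2&\hat B_2\\ F\hat A_2&F\hat B_2\end{bmatrix}$. Also $\mathbb F_1=[I_n\ \ (F+\bar F)'\ \ 0\ \ 0]'$, $\mathbb F_2=[0\ \ 0\ \ I_n\ \ F']'$ (both $(2n+2m)\times n$). Initial data. Random initial states $z_1,\dots,z_r$ (square-integrable, independent of the noise) are given with $\sum_l\mathbb Ez_l(\mathbb Ez_l)'=Z_2>0$ and $\sum_l\mathbb E[z_lz_l']=Z_1>Z_2$. Primal Problem I: $J_{\mathcal P_I}$ is the infimum of $\mathrm{Tr}(\mathrm{diag}(\Lambda+\bar\Lambda,\Lambda)\tilde S)$ over $\tilde S\in\mathcal S_{2n+2m}$ and $(F,\bar F)\in\mathcal F$ subject to $\mathbf A_1^{F,\bar F}\tilde S(\mathbf A_1^{F,\bar F})'+\mathbf A_2^F\tilde S(\mathbf A_2^F)'+\mathbf A_3^F\tilde S(\mathbf A_3^F)'+\mathbb F_1Z_2\mathbb F_1'+\mathbb F_2(Z_1-Z_2)\mathbb F_2'=\tilde S$. Primal Problem II: $J_{\mathcal P_{II}}$ is the infimum of $\mathrm{Tr}\big((\mathbb F_1Z_2\mathbb F_1'+\mathbb F_2(Z_1-Z_2)\mathbb F_2')\tilde{\mathfrak X}\big)$ over $\tilde{\mathfrak X}\in\mathcal S_{2n+2m}$ and $(F,\bar F)\in\mathcal F$ subject to $(\mathbf A_1^{F,\bar F})'\tilde{\mathfrak X}\mathbf A_1^{F,\bar F}+(\mathbf A_2^F)'\tilde{\mathfrak X}\mathbf A_2^F+(\mathbf A_3^F)'\tilde{\mathfrak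 X}\mathbf A_3^F+\mathrm{diag}(\Lambda+\bar\Lambda,\Lambda)=\tilde{\mathfrak X}$. Standing assumption. (i) $Q\ge0$, $Q+\bar Q\ge0$, $R>0$, $R+\bar R>0$; (ii) the system is stabilizable; (iii) the uncontrolled system ($u\equiv0$) with output $y_k=\mathcal Q^{1/2}\begin{bmatrix}\mathbb Ex_k\\ x_k-\mathbb Ex_k\end{bmatrix}$, $\mathcal Q=\mathrm{diag}(\hat Q,Q)$, is exactly observable (there is $T\in\mathbb N$ such that $y_k=0$ a.s. for $k=0,\dots,T$ implies $x_0=0$) or exactly detectable ($y_k=0$ a.s. for all $k$ implies $\mathbb E\|x_k\|^2\to0$). Under this assumption the optimal gains of Problem 1 are $F^*=-(\Upsilon^{P})^{-1}M^{P}$ and $\bar F^*=-\{(\Upsilon^{P,\bar P})^{-1}M^{P,\bar P}-(\Upsilon^P)^{-1}M^P\}$, where $\Upsilon^P=R+B_1'PB_1+B_2'PB_2$, $M^P=B_1'PA_1+B_2'PA_2$, $\Upsilon^{P,\bar P}=\hat R+\hat B_1'\bar P\hat B_1+\hat B_2'P\hat B_2$, $M^{P,\bar P}=\hat B_1'\bar P\hat A_1+\hat B_2'P\hat A_2$, and $(P,\bar P)$ is the unique pair with $P\ge0,\bar P\ge0$ solving $P=Q+A_1'PA_1+A_2'PA_2-(M^P)'(\Upsilon^P)^{-1}M^P$ and $\bar P=\hat Q+\hat A_1'\bar P\hat A_1+\hat A_2'P\hat A_2-(M^{P,\bar P})'(\Upsilon^{P,\bar P})^{-1}M^{P,\bar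 P}$. *)

theory Defs
  imports "HOL-Probability.Probability"
begin

section \<open>Matrices\<close>

text \<open>A \<open>p \<times> q\<close> matrix has type \<open>real ^ 'q ^ 'p\<close>; block matrices are indexed by sum types.\<close>

definition sym_mat :: "real ^ 'k ^ 'k \<Rightarrow> bool" where
  "sym_mat X \<longleftrightarrow> transpose X = X"

definition psd :: "real ^ 'k ^ 'k \<Rightarrow> bool" where
  "psd X \<longleftrightarrow> sym_mat X \<and> (\<forall>v. 0 \<le> v \<bullet> (X *v v))"

definition posdef :: "real ^ 'k ^ 'k \<Rightarrow> bool" where
  "posdef X \<longleftrightarrow> sym_mat X \<and> (\<forall>v. v \<noteq> 0 \<longrightarrow> 0 < v \<bullet> (X *v v))"

definition psd_sqrt :: "real ^ 'k ^ 'k \<Rightarrow> real ^ 'k ^ 'k" where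
  "psd_sqrt X = (THE Y. psd Y \<and> Y ** Y = X)"

definition outer :: "real ^ 'p \<Rightarrow> real ^ 'q \<Rightarrow> real ^ 'q ^ 'p" where
  "outer x y = (\<chi> i j. x $ i * y $ j)"

definition vstack :: "'e ^ 'p \<Rightarrow> 'e ^ 'q \<Rightarrow> 'e ^ ('p + 'q)" where
  "vstack x y = (\<chi> i. case i of Inl a \<Rightarrow> x $ a | Inr b \<Rightarrow> y $ b)"

text \<open>\<open>vstack\<close> applied to two matrices stacks their rows, since a matrix is a vector of rows.\<close>

definition hstack :: "real ^ 'c ^ 'p \<Rightarrow> real ^ 'd ^ 'p \<Rightarrow> real ^ ('c + 'd) ^ 'p" where
  "hstack X Y = (\<chi> i. vstack (X $ i) (Y $ i))"

definition blk ::
  "real ^ 'c ^ 'p \<Rightarrow> real ^ 'd ^ 'p \<Rightarrow> real ^ 'c ^ 'q \<Rightarrow> real ^ 'd ^ 'q \<Rightarrow> real ^ ('c + 'd) ^ ('p + 'q)" where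
  "blk X11 X12 X21 X22 = vstack (hstack X11 X12) (hstack X21 X22)"

definition bdiag :: "real ^ 'c ^ 'p \<Rightarrow> real ^ 'd ^ 'q \<Rightarrow> real ^ ('c + 'd) ^ ('p + 'q)" where
  "bdiag X Y = blk X 0 0 Y"

text \<open>Spectrum of a real-linear operator \<open>T\<close> on a finite-dimensional real space \<open>V\<close>, i.e. the set of
  complex eigenvalues of its complexification; \<open>(X, Y)\<close> stands for the eigenvector \<open>X + i Y\<close>.\<close>

definition op_spectrum :: "'v::real_vector set \<Rightarrow> ('v \<Rightarrow> 'v) \<Rightarrow> complex set" where
  "op_spectrum V T =
    {c. \<exists>X\<in>V. \<exists>Y\<in>V. (X, Y) \<noteq> (0, 0) \<and>
          T X = Re c *\<^sub>R X - Im c *\<^sub>R Y \<and> T Y = Im c *\<^sub>R X + Re c *\<^sub>R Y}"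

section \<open>The mean-field system\<close>

text \<open>The suffix \<open>b\<close> marks the barred coefficients (those multiplying expectations).\<close>

record ('n, 'm) mf_system =
  mfA1 :: "real ^ 'n ^ 'n"
  mfA1b :: "real ^ 'n ^ 'n"
  mfA2 :: "real ^ 'n ^ 'n"
  mfA2b :: "real ^ 'n ^ 'n"
  mfB1 :: "real ^ 'm ^ 'n"
  mfB1b :: "real ^ 'm ^ 'n"
  mfB2 :: "real ^ 'm ^ 'n"
  mfB2b :: "real ^ 'm ^ 'n"
  mfQ :: "real ^ 'n ^ 'n"
  mfQb :: "real ^ 'n ^ 'n"
  mfR :: "real ^ 'm ^ 'm"
  mfRb :: "real ^ 'm ^ 'm"

definition hatA1 :: "('n::finite, 'm::finite) mf_system \<Rightarrow> real ^ 'n ^ 'n" where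
  "hatA1 s = mfA1 s + mfA1b s"
definition hatA2 :: "('n::finite, 'm::finite) mf_system \<Rightarrow> real ^ 'n ^ 'n" where
  "hatA2 s = mfA2 s + mfA2b s"
definition hatB1 :: "('n::finite, 'm::finite) mf_system \<Rightarrow> real ^ 'm ^ 'n" where
  "hatB1 s = mfB1 s + mfB1b s"
definition hatB2 :: "('n::finite, 'm::finite) mf_system \<Rightarrow> real ^ 'm ^ 'n" where
  "hatB2 s = mfB2 s + mfB2b s"
definition hatQ :: "('n::finite, 'm::finite) mf_system \<Rightarrow> real ^ 'n ^ 'n" where
  "hatQ s = mfQ s + mfQb s"
definition hatR :: "('n::finite, 'm::finite) mf_system \<Rightarrow> real ^ 'm ^ 'm" where
  "hatR s = mfR s + mfRb s"

definition Lam :: "('n::finite, 'm::finite) mf_system \<Rightarrow> real ^ ('n + 'm) ^ ('n + 'm)" where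
  "Lam s = bdiag (mfQ s) (mfR s)"
definition Lamb :: "('n::finite, 'm::finite) mf_system \<Rightarrow> real ^ ('n + 'm) ^ ('n + 'm)" where
  "Lamb s = bdiag (mfQb s) (mfRb s)"

definition noise :: "'a measure \<Rightarrow> (nat \<Rightarrow> 'a \<Rightarrow> real) \<Rightarrow> bool" where
  "noise M w \<longleftrightarrow>
    prob_space.indep_vars M (\<lambda>_. borel) w UNIV \<and>
    (\<forall>k. integrable M (w k) \<and> integrable M (\<lambda>\<omega>. (w k \<omega>)\<^sup>2) \<and>
         prob_space.expectation M (w k) = 0 \<and> prob_space.variance M (w k) = 1)"

text \<open>Independence of an initial state from the noise means independence from the sigma-algebra
  generated by the whole sequence. "For every initial state" always ranges over the random vectors on
  the given probability space.\<close>

definition initial_states ::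
  "'a measure \<Rightarrow> (nat \<Rightarrow> 'a \<Rightarrow> real) \<Rightarrow> ('a \<Rightarrow> real ^ 'n) set" where
  "initial_states M w =
    {z. z \<in> borel_measurable M \<and> integrable M (\<lambda>\<omega>. (norm (z \<omega>))\<^sup>2) \<and>
        prob_space.indep_set M
          {z -` S \<inter> space M | S. S \<in> sets borel}
          {(\<lambda>\<omega> k. w k \<omega>) -` S \<inter> space M | S. S \<in> sets (Pi\<^sub>M UNIV (\<lambda>_. borel))}}"

definition feedback ::
  "'a measure \<Rightarrow> real ^ 'n ^ 'm \<Rightarrow> real ^ 'n ^ 'm \<Rightarrow> ('a \<Rightarrow> real ^ 'n) \<Rightarrow> 'a \<Rightarrow> real ^ 'm" where
  "feedback M F Fb x = (\<lambda>\<omega>. F *v x \<omega> + Fb *v prob_space.expectation M x)"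

definition mf_step ::
  "'a measure \<Rightarrow> ('n::finite, 'm::finite) mf_system \<Rightarrow> ('a \<Rightarrow> real) \<Rightarrow>
    ('a \<Rightarrow> real ^ 'n) \<Rightarrow> ('a \<Rightarrow> real ^ 'm) \<Rightarrow> 'a \<Rightarrow> real ^ 'n" where
  "mf_step M s v x u =
    (let Ex = prob_space.expectation M x; Eu = prob_space.expectation M u in
     (\<lambda>\<omega>. (mfA1 s *v x \<omega> + mfA1b s *v Ex + mfB1 s *v u \<omega> + mfB1b s *v Eu)
        + v \<omega> *\<^sub>R (mfA2 s *v x \<omega> + mfA2b s *v Ex + mfB2 s *v u \<omega> + mfB2b s *v Eu)))"

primrec closed_loop ::
  "'a measure \<Rightarrow> ('n::finite, 'm::finite) mf_system \<Rightarrow> (nat \<Rightarrow> 'a \<Rightarrow> real) \<Rightarrow> real ^ 'n ^ 'm \<Rightarrow> real ^ 'n ^ 'm \<Rightarrow>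
    ('a \<Rightarrow> real ^ 'n) \<Rightarrow> nat \<Rightarrow> 'a \<Rightarrow> real ^ 'n" where
  "closed_loop M s w F Fb z 0 = z"
| "closed_loop M s w F Fb z (Suc k) =
    mf_step M s (w k) (closed_loop M s w F Fb z k) (feedback M F Fb (closed_loop M s w F Fb z k))"

primrec uncontrolled ::
  "'a measure \<Rightarrow> ('n::finite, 'm::finite) mf_system \<Rightarrow> (nat \<Rightarrow> 'a \<Rightarrow> real) \<Rightarrow>
    ('a \<Rightarrow> real ^ 'n) \<Rightarrow> nat \<Rightarrow> 'a \<Rightarrow> real ^ 'n" where
  "uncontrolled M s w z 0 = z"
| "uncontrolled M s w z (Suc k) = mf_step M s (w k) (uncontrolled M s w z k) (\<lambda>_. 0)"

definition ms_vanishing :: "'a measure \<Rightarrow> (nat \<Rightarrow> 'a \<Rightarrow> real ^ 'n) \<Rightarrow> bool" where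
  "ms_vanishing M x \<longleftrightarrow> (\<lambda>k. prob_space.expectation M (\<lambda>\<omega>. (norm (x k \<omega>))\<^sup>2)) \<longlonglongrightarrow> 0"

definition stabilizable ::
  "'a measure \<Rightarrow> ('n::finite, 'm::finite) mf_system \<Rightarrow> (nat \<Rightarrow> 'a \<Rightarrow> real) \<Rightarrow> bool" where
  "stabilizable M s w \<longleftrightarrow>
    (\<exists>F Fb. \<forall>z\<in>initial_states M w. ms_vanishing M (closed_loop M s w F Fb z))"

definition mf_output ::
  "'a measure \<Rightarrow> ('n::finite, 'm::finite) mf_system \<Rightarrow> (nat \<Rightarrow> 'a \<Rightarrow> real) \<Rightarrow>
    ('a \<Rightarrow> real ^ 'n) \<Rightarrow> nat \<Rightarrow> 'a \<Rightarrow> real ^ ('n + 'n)" where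
  "mf_output M s w z k =
    (let x = uncontrolled M s w z k; Ex = prob_space.expectation M x in
     (\<lambda>\<omega>. psd_sqrt (bdiag (hatQ s) (mfQ s)) *v vstack Ex (x \<omega> - Ex)))"

definition exactly_observable ::
  "'a measure \<Rightarrow> ('n::finite, 'm::finite) mf_system \<Rightarrow> (nat \<Rightarrow> 'a \<Rightarrow> real) \<Rightarrow> bool" where
  "exactly_observable M s w \<longleftrightarrow>
    (\<exists>T::nat. \<forall>z\<in>initial_states M w.
       (\<forall>k\<le>T. AE \<omega> in M. mf_output M s w z k \<omega> = 0) \<longrightarrow> (AE \<omega> in M. z \<omega> = 0))"

definition exactly_detectable ::
  "'a measure \<Rightarrow> ('n::finite, 'm::finite) mf_system \<Rightarrow> (nat \<Rightarrow> 'a \<Rightarrow> real) \<Rightarrow> bool" where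
  "exactly_detectable M s w \<longleftrightarrow>
    (\<forall>z\<in>initial_states M w.
       (\<forall>k. AE \<omega> in M. mf_output M s w z k \<omega> = 0) \<longrightarrow> ms_vanishing M (uncontrolled M s w z))"

definition standing_assumption ::
  "'a measure \<Rightarrow> ('n::finite, 'm::finite) mf_system \<Rightarrow> (nat \<Rightarrow> 'a \<Rightarrow> real) \<Rightarrow> bool" where
  "standing_assumption M s w \<longleftrightarrow>
    psd (mfQ s) \<and> psd (mfQ s + mfQb s) \<and> posdef (mfR s) \<and> posdef (mfR s + mfRb s) \<and>
    stabilizable M s w \<and>
    (exactly_observable M s w \<or> exactly_detectable M s w)"

section \<open>The cost\<close>

definition stage_cost ::
  "'a measure \<Rightarrow> ('n::finite, 'm::finite) mf_system \<Rightarrow> ('a \<Rightarrow> real ^ 'n) \<Rightarrow> ('a \<Rightarrow> real ^ 'm) \<Rightarrow> real" where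
  "stage_cost M s x u =
    (let Ex = prob_space.expectation M x; Eu = prob_space.expectation M u in
     prob_space.expectation M (\<lambda>\<omega>.
       vstack (x \<omega>) (u \<omega>) \<bullet> (Lam s *v vstack (x \<omega>) (u \<omega>)) +
       vstack Ex Eu \<bullet> (Lamb s *v vstack Ex Eu)))"

text \<open>Costs are extended reals, so that a divergent cost is infinite.\<close>

definition cost_J ::
  "'a measure \<Rightarrow> ('n::finite, 'm::finite) mf_system \<Rightarrow> (nat \<Rightarrow> 'a \<Rightarrow> real) \<Rightarrow> ('a \<Rightarrow> real ^ 'n) \<Rightarrow>
    real ^ 'n ^ 'm \<Rightarrow> real ^ 'n ^ 'm \<Rightarrow> ereal" where
  "cost_J M s w z F Fb =
    (\<Sum>k. ereal (stage_cost M s (closed_loop M s w F Fb z k)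
                  (feedback M F Fb (closed_loop M s w F Fb z k))))"

definition total_cost ::
  "'a measure \<Rightarrow> ('n::finite, 'm::finite) mf_system \<Rightarrow> (nat \<Rightarrow> 'a \<Rightarrow> real) \<Rightarrow> nat \<Rightarrow> (nat \<Rightarrow> 'a \<Rightarrow> real ^ 'n) \<Rightarrow>
    real ^ 'n ^ 'm \<Rightarrow> real ^ 'n ^ 'm \<Rightarrow> ereal" where
  "total_cost M s w r z F Fb = (\<Sum>l=1..r. cost_J M s w (z l) F Fb)"

section \<open>Stabilizing gains\<close>

definition calA1 ::
  "('n::finite, 'm::finite) mf_system \<Rightarrow> real ^ 'n ^ 'm \<Rightarrow> real ^ 'n ^ 'm \<Rightarrow> real ^ ('n + 'n) ^ ('n + 'n)" where
  "calA1 s F Fb = blk (hatA1 s + hatB1 s ** (F + Fb)) 0 0 (mfA1 s + mfB1 s ** F)"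

definition calA2 :: "('n::finite, 'm::finite) mf_system \<Rightarrow> real ^ 'n ^ 'm \<Rightarrow> real ^ ('n + 'n) ^ ('n + 'n)" where
  "calA2 s F = blk 0 0 0 (mfA2 s + mfB2 s ** F)"

definition calA3 ::
  "('n::finite, 'm::finite) mf_system \<Rightarrow> real ^ 'n ^ 'm \<Rightarrow> real ^ 'n ^ 'm \<Rightarrow> real ^ ('n + 'n) ^ ('n + 'n)" where
  "calA3 s F Fb = blk 0 0 (hatA2 s + hatB2 s ** (F + Fb)) 0"

definition stab_gains :: "('n::finite, 'm::finite) mf_system \<Rightarrow> ((real ^ 'n ^ 'm) \<times> (real ^ 'n ^ 'm)) set" where
  "stab_gains s =
    {(F, Fb). \<forall>c \<in> op_spectrum {X. sym_mat X}
        (\<lambda>X. transpose (calA1 s F Fb) ** X ** calA1 s F Fb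
           + transpose (calA2 s F) ** X ** calA2 s F
           + transpose (calA3 s F Fb) ** X ** calA3 s F Fb). cmod c < 1}"

section \<open>The two primal problems\<close>

definition augA1 ::
  "('n::finite, 'm::finite) mf_system \<Rightarrow> real ^ 'n ^ 'm \<Rightarrow> real ^ 'n ^ 'm \<Rightarrow>
    real ^ (('n + 'm) + ('n + 'm)) ^ (('n + 'm) + ('n + 'm))" where
  "augA1 s F Fb = bdiag
     (blk (hatA1 s) (hatB1 s) ((F + Fb) ** hatA1 s) ((F + Fb) ** hatB1 s))
     (blk (mfA1 s) (mfB1 s) (F ** mfA1 s) (F ** mfB1 s))"

definition augA2 ::
  "('n::finite, 'm::finite) mf_system \<Rightarrow> real ^ 'n ^ 'm \<Rightarrow>
    real ^ (('n + 'm) + ('n + 'm)) ^ (('n + 'm) + ('n + 'm))" where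
  "augA2 s F = bdiag 0 (blk (mfA2 s) (mfB2 s) (F ** mfA2 s) (F ** mfB2 s))"

definition augA3 ::
  "('n::finite, 'm::finite) mf_system \<Rightarrow> real ^ 'n ^ 'm \<Rightarrow>
    real ^ (('n + 'm) + ('n + 'm)) ^ (('n + 'm) + ('n + 'm))" where
  "augA3 s F = blk 0 0 (blk (hatA2 s) (hatB2 s) (F ** hatA2 s) (F ** hatB2 s)) 0"

definition augF1 :: "real ^ 'n ^ 'm \<Rightarrow> real ^ 'n ^ 'm \<Rightarrow> real ^ 'n ^ (('n + 'm) + ('n + 'm))" where
  "augF1 F Fb = vstack (vstack (mat 1) (F + Fb)) 0"

definition augF2 :: "real ^ 'n ^ 'm \<Rightarrow> real ^ 'n ^ (('n + 'm) + ('n + 'm))" where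
  "augF2 F = vstack 0 (vstack (mat 1) F)"

definition init_term ::
  "real ^ 'n ^ 'n \<Rightarrow> real ^ 'n ^ 'n \<Rightarrow> real ^ 'n ^ 'm \<Rightarrow> real ^ 'n ^ 'm \<Rightarrow>
    real ^ (('n + 'm) + ('n + 'm)) ^ (('n + 'm) + ('n + 'm))" where
  "init_term Z1 Z2 F Fb =
     augF1 F Fb ** Z2 ** transpose (augF1 F Fb) + augF2 F ** (Z1 - Z2) ** transpose (augF2 F)"

definition weight :: "('n::finite, 'm::finite) mf_system \<Rightarrow> real ^ (('n + 'm) + ('n + 'm)) ^ (('n + 'm) + ('n + 'm))" where
  "weight s = bdiag (Lam s + Lamb s) (Lam s)"

type_synonym ('n, 'm) primal_var =
  "(real ^ (('n + 'm) + ('n + 'm)) ^ (('n + 'm) + ('n + 'm))) \<times> (real ^ 'n ^ 'm) \<times> (real ^ 'n ^ 'm)"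

definition feasible_I ::
  "('n::finite, 'm::finite) mf_system \<Rightarrow> real ^ 'n ^ 'n \<Rightarrow> real ^ 'n ^ 'n \<Rightarrow> ('n, 'm) primal_var \<Rightarrow> bool" where
  "feasible_I s Z1 Z2 = (\<lambda>(S, F, Fb).
     sym_mat S \<and> (F, Fb) \<in> stab_gains s \<and>
     augA1 s F Fb ** S ** transpose (augA1 s F Fb)
     + augA2 s F ** S ** transpose (augA2 s F)
     + augA3 s F ** S ** transpose (augA3 s F)
     + init_term Z1 Z2 F Fb = S)"

definition objective_I :: "('n::finite, 'm::finite) mf_system \<Rightarrow> ('n, 'm) primal_var \<Rightarrow> real" where
  "objective_I s = (\<lambda>(S, F, Fb). trace (weight s ** S))"

definition J_I :: "('n::finite, 'm::finite) mf_system \<Rightarrow> real ^ 'n ^ 'n \<Rightarrow> real ^ 'n ^ 'n \<Rightarrow> ereal" where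
  "J_I s Z1 Z2 = (INF p \<in> Collect (feasible_I s Z1 Z2). ereal (objective_I s p))"

definition feasible_II :: "('n::finite, 'm::finite) mf_system \<Rightarrow> ('n, 'm) primal_var \<Rightarrow> bool" where
  "feasible_II s = (\<lambda>(X, F, Fb).
     sym_mat X \<and> (F, Fb) \<in> stab_gains s \<and>
     transpose (augA1 s F Fb) ** X ** augA1 s F Fb
     + transpose (augA2 s F) ** X ** augA2 s F
     + transpose (augA3 s F) ** X ** augA3 s F
     + weight s = X)"

definition objective_II ::
  "real ^ 'n ^ 'n \<Rightarrow> real ^ 'n ^ 'n \<Rightarrow> ('n::finite, 'm::finite) primal_var \<Rightarrow> real" where
  "objective_II Z1 Z2 = (\<lambda>(X, F, Fb). trace (init_term Z1 Z2 F Fb ** X))"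

definition J_II :: "('n::finite, 'm::finite) mf_system \<Rightarrow> real ^ 'n ^ 'n \<Rightarrow> real ^ 'n ^ 'n \<Rightarrow> ereal" where
  "J_II s Z1 Z2 = (INF p \<in> Collect (feasible_II s). ereal (objective_II Z1 Z2 p))"

section \<open>Riccati equations and the optimal gains\<close>

definition Ups :: "('n::finite, 'm::finite) mf_system \<Rightarrow> real ^ 'n ^ 'n \<Rightarrow> real ^ 'm ^ 'm" where
  "Ups s P = mfR s + transpose (mfB1 s) ** P ** mfB1 s + transpose (mfB2 s) ** P ** mfB2 s"

definition Mgain :: "('n::finite, 'm::finite) mf_system \<Rightarrow> real ^ 'n ^ 'n \<Rightarrow> real ^ 'n ^ 'm" where
  "Mgain s P = transpose (mfB1 s) ** P ** mfA1 s + transpose (mfB2 s) ** P ** mfA2 s"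

definition Upsb :: "('n::finite, 'm::finite) mf_system \<Rightarrow> real ^ 'n ^ 'n \<Rightarrow> real ^ 'n ^ 'n \<Rightarrow> real ^ 'm ^ 'm" where
  "Upsb s P Pb = hatR s + transpose (hatB1 s) ** Pb ** hatB1 s + transpose (hatB2 s) ** P ** hatB2 s"

definition Mgainb :: "('n::finite, 'm::finite) mf_system \<Rightarrow> real ^ 'n ^ 'n \<Rightarrow> real ^ 'n ^ 'n \<Rightarrow> real ^ 'n ^ 'm" where
  "Mgainb s P Pb = transpose (hatB1 s) ** Pb ** hatA1 s + transpose (hatB2 s) ** P ** hatA2 s"

definition riccati_solution ::
  "('n::finite, 'm::finite) mf_system \<Rightarrow> real ^ 'n ^ 'n \<Rightarrow> real ^ 'n ^ 'n \<Rightarrow> bool" where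
  "riccati_solution s P Pb \<longleftrightarrow> psd P \<and> psd Pb \<and>
     P = mfQ s + transpose (mfA1 s) ** P ** mfA1 s + transpose (mfA2 s) ** P ** mfA2 s
         - transpose (Mgain s P) ** matrix_inv (Ups s P) ** Mgain s P \<and>
     Pb = hatQ s + transpose (hatA1 s) ** Pb ** hatA1 s + transpose (hatA2 s) ** P ** hatA2 s
         - transpose (Mgainb s P Pb) ** matrix_inv (Upsb s P Pb) ** Mgainb s P Pb"

definition riccati_pair :: "('n::finite, 'm::finite) mf_system \<Rightarrow> (real ^ 'n ^ 'n) \<times> (real ^ 'n ^ 'n)" where
  "riccati_pair s = (THE (P, Pb). riccati_solution s P Pb)"

definition F_star :: "('n::finite, 'm::finite) mf_system \<Rightarrow> real ^ 'n ^ 'm" where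
  "F_star s = (case riccati_pair s of (P, Pb) \<Rightarrow> - (matrix_inv (Ups s P) ** Mgain s P))"

definition Fb_star :: "('n::finite, 'm::finite) mf_system \<Rightarrow> real ^ 'n ^ 'm" where
  "Fb_star s = (case riccati_pair s of (P, Pb) \<Rightarrow>
     - (matrix_inv (Upsb s P Pb) ** Mgainb s P Pb - matrix_inv (Ups s P) ** Mgain s P))"

end

theory Submission
  imports Defs
begin

text \<open>
  Lifting the state to its mean and its centred part turns the second moments of the closed loop into
  the orbit of a linear operator that preserves positive semidefiniteness. By a Perron-Frobenius
  alternative such an operator either has spectrum in the open unit disc, in which case its Lyapunov
  equations are uniquely solvable, or has a positive semidefinite eigenvector with eigenvalue at
  least one. The augmented matrices of the primal problems
  are the products \<open>G D\<^sub>i\<close> whose reversals \<open>D\<^sub>i G\<close> drive the closed loop, so both problems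
  collapse to the Lyapunov equation of the closed loop and its dual, and both objectives equal
  \<open>Tr (Z X)\<close>, where \<open>X\<close> is the cost matrix and \<open>Z = diag(Z\<^sub>2, Z\<^sub>1 - Z\<^sub>2)\<close>; telescoping shows
  that this is also the total cost. Completing the square with a solution of the Riccati equations
  (obtained by value iteration) bounds \<open>Tr (Z X)\<close> below, with equality only at the Riccati gains
  because \<open>Z > 0\<close>. Those gains stabilise: an eigenvector with eigenvalue at least one would have zero
  cost, hence be left unchanged by the feedback, and would contradict detectability.
\<close>

section \<open>Positive semidefinite matrices\<close>

text \<open>Initial states live on the given probability space, which may carry few random vectors
  independent of the noise, so consequences of stabilizability and detectability have to be drawn
  from the states at hand. Two facts permit this: the moments of \<open>z 1\<close>, ...,
  \<open>z r\<close> add up to the positive definite \<open>bdiag Z2 (Z1 - Z2)\<close>, and some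
  \<open>z l\<close> is not almost surely constant, so that its affine images realise any mean with
  any rank-one covariance. The operator in \<open>stab_gains\<close> propagates costs, its trace
  adjoint propagates moments; decay passes between them because their powers have equal traces at
  the identity. An eigenvector obstructing decay of the adjoint is positive semidefinite, so its
  block-diagonal part is a sum of moment matrices, the objects that detectability speaks about.
  Since \<open>riccati_pair\<close> is a definite description, uniqueness of the Riccati solution
  must be known before the optimal gains can be named. It comes from viewing each solution as the
  cost matrix of its own stabilising gains.\<close>

lemma matrix_add_rdistrib: "(A + B) ** C = A ** C + B ** (C :: real ^ 'c ^ 'b)"
  by (vector matrix_matrix_mult_def distrib_right sum.distrib)

lemma matrix_sub_rdistrib: "(A - B) ** C = A ** C - B ** (C :: real ^ 'c ^ 'b)"
  by (vector matrix_matrix_mult_def left_diff_distrib sum_subtractf)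

lemma matrix_sub_ldistrib: "(C :: real ^ 'b ^ 'c) ** (A - B) = C ** A - C ** B"
  by (vector matrix_matrix_mult_def right_diff_distrib sum_subtractf)

lemma matrix_minus_left: "(- A) ** C = - (A ** (C :: real ^ 'c ^ 'b))"
  by (vector matrix_matrix_mult_def sum_negf)

lemma matrix_minus_right: "(C :: real ^ 'b ^ 'c) ** (- A) = - (C ** A)"
  by (vector matrix_matrix_mult_def sum_negf)

lemma matrix_zero_left [simp]: "0 ** C = (0 :: real ^ 'c ^ 'a)"
  by (vector matrix_matrix_mult_def)

lemma matrix_zero_right [simp]: "C ** 0 = (0 :: real ^ 'c ^ 'a)"
  by (vector matrix_matrix_mult_def)

lemma matrix_scaleR_left: "(c *\<^sub>R A) ** B = c *\<^sub>R (A ** (B :: real ^ 'c ^ 'b))"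
  by (vector matrix_matrix_mult_def sum_distrib_left mult_ac)

lemma matrix_scaleR_right: "(A :: real ^ 'b ^ 'a) ** (c *\<^sub>R B) = c *\<^sub>R (A ** B)"
  by (vector matrix_matrix_mult_def sum_distrib_left mult_ac)

lemma transpose_add: "transpose (A + B) = transpose A + transpose (B :: real ^ 'b ^ 'a)"
  by (vector transpose_def)

lemma transpose_diff: "transpose (A - B) = transpose A - transpose (B :: real ^ 'b ^ 'a)"
  by (vector transpose_def)

lemma transpose_minus: "transpose (- A) = - transpose (A :: real ^ 'b ^ 'a)"
  by (vector transpose_def)

lemma transpose_zero [simp]: "transpose 0 = (0 :: real ^ 'b ^ 'a)"
  by (vector transpose_def)

lemmas matrix_algebra = matrix_add_ldistrib matrix_add_rdistrib matrix_sub_rdistrib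
  matrix_sub_ldistrib matrix_minus_left matrix_minus_right matrix_scaleR_left
  matrix_scaleR_right matrix_mul_assoc transpose_add transpose_diff transpose_minus
  transpose_scalar matrix_transpose_mul

lemma inner_matrix_transpose:
  "x \<bullet> (A *v y) = (transpose A *v x) \<bullet> (y :: real ^ 'b)"
  by (simp add: dot_lmul_matrix)

lemma inner_congruence:
  "v \<bullet> ((transpose A ** X ** A) *v w) = (A *v v) \<bullet> (X *v (A *v w))"
  for A :: "real ^ 'b ^ 'a"
  by (simp add: matrix_vector_mul_assoc[symmetric] inner_matrix_transpose[of v "transpose A"]
      del: transpose_matrix_vector)

lemma sym_mat_zero [simp]: "sym_mat 0"
  and sym_mat_one [simp]: "sym_mat (mat 1)"
  and sym_mat_add: "sym_mat X \<Longrightarrow> sym_mat Y \<Longrightarrow> sym_mat (X + Y)"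
  and sym_mat_diff: "sym_mat X \<Longrightarrow> sym_mat Y \<Longrightarrow> sym_mat (X - Y)"
  and sym_mat_scaleR: "sym_mat X \<Longrightarrow> sym_mat (c *\<^sub>R X)"
  by (simp_all add: sym_mat_def transpose_add transpose_diff transpose_scalar)

lemma sym_mat_congruence: "sym_mat X \<Longrightarrow> sym_mat (transpose A ** X ** A)"
  by (simp add: sym_mat_def matrix_algebra)

lemma sym_mat_inner: "sym_mat X \<Longrightarrow> x \<bullet> (X *v y) = (X *v x) \<bullet> y"
  by (simp add: inner_matrix_transpose sym_mat_def del: transpose_matrix_vector)

lemma psd_sym: "psd X \<Longrightarrow> sym_mat X"
  and psd_quad: "psd X \<Longrightarrow> 0 \<le> v \<bullet> (X *v v)"
  and posdef_sym: "posdef X \<Longrightarrow> sym_mat X"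
  and posdef_quad: "posdef X \<Longrightarrow> v \<noteq> 0 \<Longrightarrow> 0 < v \<bullet> (X *v v)"
  by (simp_all add: psd_def posdef_def)

lemma posdef_imp_psd: "posdef X \<Longrightarrow> psd X"
  unfolding psd_def posdef_def by (metis inner_zero_left less_eq_real_def)

lemma psd_zero [simp]: "psd 0"
  and psd_one [simp]: "psd (mat 1)"
  by (simp_all add: psd_def)

lemma psd_add: "psd X \<Longrightarrow> psd Y \<Longrightarrow> psd (X + Y)"
  by (simp add: psd_def sym_mat_add matrix_vector_mult_add_rdistrib inner_add_right)

lemma posdef_add: "posdef X \<Longrightarrow> psd Y \<Longrightarrow> posdef (X + Y)"
  by (simp add: psd_def posdef_def sym_mat_add matrix_vector_mult_add_rdistrib inner_add_right
      add_pos_nonneg)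

lemma psd_scaleR: "psd X \<Longrightarrow> 0 \<le> c \<Longrightarrow> psd (c *\<^sub>R X)"
  by (simp add: psd_def sym_mat_scaleR scaleR_matrix_vector_assoc[symmetric])

lemma psd_congruence: "psd X \<Longrightarrow> psd (transpose A ** X ** A)"
  by (simp add: psd_def sym_mat_congruence inner_congruence)

lemma psd_congruence': "psd X \<Longrightarrow> psd (A ** X ** transpose A)"
  using psd_congruence[of X "transpose A"] by simp

lemma psd_trans: "psd (X - Y) \<Longrightarrow> psd (Y - Z) \<Longrightarrow> psd (X - Z)"
  using psd_add[of "X - Y" "Y - Z"] by simp

lemma psd_diff_iff:
  "sym_mat X \<Longrightarrow> sym_mat Y \<Longrightarrow> psd (X - Y) \<longleftrightarrow> (\<forall>v. v \<bullet> (Y *v v) \<le> v \<bullet> (X *v v))"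
  by (simp add: psd_def sym_mat_diff matrix_vector_mult_diff_rdistrib inner_diff_right)

section \<open>The trace as a norm on the positive semidefinite cone\<close>

lemma trace_scaleR: "trace (c *\<^sub>R A) = c * trace (A :: real ^ 'k ^ 'k)"
  by (simp add: trace_def sum_distrib_left)

lemma trace_zero [simp]: "trace (0 :: real ^ 'k ^ 'k) = 0"
  by (simp add: trace_def)

lemma matrix_entry: "axis i 1 \<bullet> (X *v axis j 1) = (X :: real ^ 'n ^ 'm) $ i $ j"
  by (simp add: matrix_vector_mult_basis inner_axis' column_def)

lemma trace_eq_sum_quad: "trace X = (\<Sum>i\<in>UNIV. axis i 1 \<bullet> (X *v axis i 1))"
  for X :: "real ^ 'k ^ 'k"
  by (simp add: trace_def matrix_entry)

lemma trace_psd_nonneg: "psd X \<Longrightarrow> 0 \<le> trace X"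
  unfolding trace_eq_sum_quad by (intro sum_nonneg psd_quad)

lemma sym_mat_entry: "sym_mat X \<Longrightarrow> X $ j $ i = X $ i $ j"
proof -
  assume "sym_mat X"
  moreover have "transpose X $ j $ i = X $ i $ j" by (simp add: transpose_def)
  ultimately show ?thesis by (simp add: sym_mat_def)
qed

text \<open>The form at \<open>axis i 1 + axis j 1\<close> and at \<open>axis i 1 - axis j 1\<close>
  bounds the entry by the mean of two diagonal entries, each at most the trace. Convergence and
  vanishing of positive semidefinite matrices thus become statements about one real number.\<close>

lemma psd_entry_bound:
  assumes "psd (X :: real ^ 'k ^ 'k)"
  shows "\<bar>X $ i $ j\<bar> \<le> trace X"
proof -
  have symij: "X $ j $ i = X $ i $ j"
    by (rule sym_mat_entry[OF psd_sym[OF assms]])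
  have q: "0 \<le> X $ k $ k" for k
    using psd_quad[OF assms, of "axis k 1"] by (simp add: matrix_entry)
  have le: "X $ k $ k \<le> trace X" for k
    unfolding trace_def by (rule member_le_sum) (auto intro: q)
  have "0 \<le> (axis i 1 + axis j 1) \<bullet> (X *v (axis i 1 + axis j 1))"
       "0 \<le> (axis i 1 - axis j 1) \<bullet> (X *v (axis i 1 - axis j 1))"
    by (intro psd_quad assms)+
  then have "\<bar>2 * X $ i $ j\<bar> \<le> X $ i $ i + X $ j $ j"
    by (simp add: algebra_simps inner_diff_left matrix_entry symij inner_add_left abs_le_iff)
  then show ?thesis
    using le[of i] le[of j] by linarith
qed

lemma norm_matrix_le_entries: "norm (X :: real ^ 'b ^ 'a) \<le> (\<Sum>i\<in>UNIV. \<Sum>j\<in>UNIV. \<bar>X $ i $ j\<bar>)"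
proof -
  have "norm X \<le> (\<Sum>i\<in>UNIV. norm (X $ i))"
    unfolding norm_vec_def by (rule L2_set_le_sum) simp
  also have "\<dots> \<le> (\<Sum>i\<in>UNIV. \<Sum>j\<in>UNIV. \<bar>X $ i $ j\<bar>)"
    by (intro sum_mono norm_le_l1_cart)
  finally show ?thesis .
qed

lemma psd_norm_le_trace:
  assumes "psd (X :: real ^ 'k ^ 'k)"
  shows "norm X \<le> real CARD('k) * real CARD('k) * trace X"
proof -
  have "norm X \<le> (\<Sum>i\<in>(UNIV::'k set). \<Sum>j\<in>(UNIV::'k set). trace X)"
    by (rule order_trans[OF norm_matrix_le_entries]) (intro sum_mono psd_entry_bound assms)
  then show ?thesis by simp
qed

lemma psd_trace_zero: "psd X \<Longrightarrow> trace X = 0 \<Longrightarrow> X = 0"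
  using psd_norm_le_trace[of X] by simp

lemma matrix_eq_entries: "(\<And>i j. X $ i $ j = Y $ i $ j) \<Longrightarrow> X = Y"
  by (simp add: vec_eq_iff)

lemma psd_antisym: "psd (X - Y) \<Longrightarrow> psd (Y - X) \<Longrightarrow> X = Y"
proof -
  assume a: "psd (X - Y)" "psd (Y - X)"
  have "trace (X - Y) = 0"
    using trace_psd_nonneg[OF a(1)] trace_psd_nonneg[OF a(2)] by (simp add: trace_sub)
  then show ?thesis using psd_trace_zero[OF a(1)] by simp
qed

section \<open>Limits of matrices\<close>

lemma tendsto_matrix_vector_mult:
  "(X \<longlongrightarrow> (L :: real ^ 'b ^ 'a)) F \<Longrightarrow> ((\<lambda>k. X k *v v) \<longlongrightarrow> L *v v) F"
  unfolding matrix_vector_mult_def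
  by (intro vec_tendstoI) (auto intro!: tendsto_sum tendsto_mult tendsto_vec_nth)

lemma tendsto_matrix_mult:
  fixes X :: "'x \<Rightarrow> real ^ 'b ^ 'a" and Y :: "'x \<Rightarrow> real ^ 'c ^ 'b"
  shows "(X \<longlongrightarrow> L) F \<Longrightarrow> (Y \<longlongrightarrow> K) F \<Longrightarrow> ((\<lambda>k. X k ** Y k) \<longlongrightarrow> L ** K) F"
  unfolding matrix_matrix_mult_def
  by (intro vec_tendstoI) (auto intro!: tendsto_sum tendsto_mult tendsto_vec_nth)

lemma tendsto_transpose: "(X \<longlongrightarrow> (L :: real ^ 'b ^ 'a)) F \<Longrightarrow> ((\<lambda>k. transpose (X k)) \<longlongrightarrow> transpose L) F"
  unfolding transpose_def
  by (intro vec_tendstoI) (auto intro!: tendsto_vec_nth)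

lemma tendsto_trace: "(X \<longlongrightarrow> (L :: real ^ 'a ^ 'a)) F \<Longrightarrow> ((\<lambda>k. trace (X k)) \<longlongrightarrow> trace L) F"
  unfolding trace_def by (auto intro!: tendsto_sum tendsto_vec_nth)

lemma psd_limit:
  assumes "X \<longlonglongrightarrow> L" "\<And>k. psd (X k)"
  shows "psd L"
proof -
  have "(\<lambda>k. transpose (X k)) \<longlonglongrightarrow> transpose L"
    using assms(1) by (rule tendsto_transpose)
  moreover have "transpose (X k) = X k" for k
    using assms(2) by (simp add: psd_def sym_mat_def)
  ultimately have "sym_mat L"
    unfolding sym_mat_def using assms(1) by (simp add: LIMSEQ_unique)
  moreover have "0 \<le> v \<bullet> (L *v v)" for v
  proof (rule LIMSEQ_le_const)
    show "(\<lambda>k. v \<bullet> (X k *v v)) \<longlonglongrightarrow> v \<bullet> (L *v v)"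
      by (intro tendsto_intros tendsto_matrix_vector_mult assms(1))
  qed (use assms(2) in \<open>auto simp: psd_def\<close>)
  ultimately show ?thesis by (simp add: psd_def)
qed

text \<open>The traces form a bounded increasing real sequence, and the norm of a difference of two
  members is at most a constant times the difference of their traces, so the matrices are Cauchy as
  well.\<close>

lemma psd_monotone_convergence:
  fixes X :: "nat \<Rightarrow> real ^ 'k ^ 'k"
  assumes inc: "\<And>k. psd (X (Suc k) - X k)" and bound: "\<And>k. psd (B - X k)"
  obtains L where "X \<longlonglongrightarrow> L" "\<And>k. psd (L - X k)" "psd (B - L)"
proof -
  define c where "c = real CARD('k) * real CARD('k)"
  have mono: "psd (X n - X m)" if "m \<le> n" for m n
    using that
  proof (induction n)
    case (Suc n)
    then show ?case using inc psd_trans[of "X (Suc n)" "X n" "X m"] by (cases "m = Suc n") auto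
  qed simp
  have "incseq (\<lambda>k. trace (X k))"
    using inc[THEN trace_psd_nonneg] by (intro incseq_SucI) (simp add: trace_sub)
  moreover have "trace (X k) \<le> trace B" for k
    using trace_psd_nonneg[OF bound[of k]] by (simp add: trace_sub)
  ultimately obtain t where "(\<lambda>k. trace (X k)) \<longlonglongrightarrow> t"
    by (metis incseq_convergent)
  then have C: "Cauchy (\<lambda>k. trace (X k))"
    using LIMSEQ_imp_Cauchy by blast
  have c: "c > 0" by (simp add: c_def)
  have le: "norm (X m - X n) \<le> c * \<bar>trace (X m) - trace (X n)\<bar>" for m n
  proof (induction m n rule: linorder_wlog)
    case (le m n)
    have "norm (X n - X m) \<le> c * trace (X n - X m)"
      unfolding c_def by (rule psd_norm_le_trace[OF mono[OF le]])
    also have "\<dots> \<le> c * \<bar>trace (X m) - trace (X n)\<bar>"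
      using c by (intro mult_left_mono) (auto simp: trace_sub)
    finally show ?case by (simp add: norm_minus_commute)
  qed (simp add: norm_minus_commute abs_minus_commute)
  have "Cauchy X"
  proof (rule metric_CauchyI)
    fix e :: real assume "0 < e"
    then obtain N where N: "\<And>m n. m \<ge> N \<Longrightarrow> n \<ge> N \<Longrightarrow> dist (trace (X m)) (trace (X n)) < e / c"
      using C c metric_CauchyD[of _ "e / c"] by (metis divide_pos_pos)
    have "dist (X m) (X n) < e" if "m \<ge> N" "n \<ge> N" for m n
    proof -
      have "c * \<bar>trace (X m) - trace (X n)\<bar> < e"
        using N[OF that] c by (simp add: dist_norm field_simps)
      then show ?thesis using le[of m n] by (simp add: dist_norm)
    qed
    then show "\<exists>N. \<forall>m\<ge>N. \<forall>n\<ge>N. dist (X m) (X n) < e" by blast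
  qed
  then obtain L where L: "X \<longlonglongrightarrow> L"
    using Cauchy_convergent_iff convergent_def by blast
  have "psd (L - X k)" for k
  proof (rule psd_limit)
    show "(\<lambda>n. X (n + k) - X k) \<longlonglongrightarrow> L - X k"
      by (intro tendsto_intros LIMSEQ_ignore_initial_segment L)
  qed (auto intro: mono)
  moreover have "psd (B - L)"
    by (rule psd_limit[of "\<lambda>k. B - X k"]) (intro tendsto_intros L bound)+
  ultimately show thesis using that L by blast
qed

section \<open>Rank-one matrices\<close>

lemma outer_mult_vec: "outer x y *v u = (y \<bullet> u) *\<^sub>R (x :: real ^ 'p)"
  by (vector outer_def matrix_vector_mult_def inner_vec_def sum_distrib_left mult_ac)

lemma transpose_outer: "transpose (outer x y) = outer y x"
  by (vector outer_def transpose_def mult.commute)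

lemma psd_outer: "psd (outer x x)"
  by (simp add: psd_def sym_mat_def transpose_outer outer_mult_vec inner_commute)

lemma trace_outer_mult: "trace (X ** outer x y) = y \<bullet> (X *v x)"
proof -
  have "trace (X ** outer x y) = (\<Sum>i\<in>UNIV. \<Sum>k\<in>UNIV. y $ i * (X $ i $ k * x $ k))"
    by (simp add: trace_def matrix_matrix_mult_def outer_def mult_ac)
  also have "\<dots> = y \<bullet> (X *v x)"
    by (simp add: inner_vec_def matrix_vector_mult_def sum_distrib_left)
  finally show ?thesis .
qed

lemma trace_outer: "trace (outer x x) = (norm x)\<^sup>2"
  using trace_outer_mult[of "mat 1" x x] by (simp add: power2_norm_eq_inner)

lemma congruence_outer: "A ** outer x y ** transpose B = outer (A *v x) (B *v y)"
proof (rule matrix_eq[THEN iffD2], rule allI)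
  fix u
  have "(A ** outer x y ** transpose B) *v u = A *v (outer x y *v (transpose B *v u))"
    by (simp only: matrix_vector_mul_assoc matrix_mul_assoc)
  also have "\<dots> = (y \<bullet> (transpose B *v u)) *\<^sub>R (A *v x)"
    by (simp only: outer_mult_vec matrix_vector_mult_scaleR)
  also have "\<dots> = outer (A *v x) (B *v y) *v u"
    by (simp add: outer_mult_vec inner_matrix_transpose[of y "transpose B"]
        del: transpose_matrix_vector)
  finally show "(A ** outer x y ** transpose B) *v u = outer (A *v x) (B *v y) *v u" .
qed

lemma matrix_sum_vec: "(\<Sum>b\<in>B. X b) *v u = (\<Sum>b\<in>B. X b *v (u :: real ^ 'b))"
  by (induction B rule: infinite_finite_induct)
    (simp_all add: matrix_vector_mult_add_rdistrib)

subsection \<open>The spectral theorem and square roots\<close>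

text \<open>If \<open>u = X *v b\<close> were nonzero, the form would be negative at
  \<open>b - e *\<^sub>R u\<close> for small positive \<open>e\<close>, where the first-order term
  dominates. Invariance of \<open>S\<close> keeps this point in the region where the form is
  nonnegative.\<close>

lemma psd_on_subspace_kernel:
  fixes X :: "real ^ 'k ^ 'k"
  assumes "sym_mat X" "subspace S" and pos: "\<And>u. u \<in> S \<Longrightarrow> 0 \<le> u \<bullet> (X *v u)"
    and inv: "\<And>u. u \<in> S \<Longrightarrow> X *v u \<in> S" and "b \<in> S" "b \<bullet> (X *v b) = 0"
  shows "X *v b = 0"
proof -
  define u where "u = X *v b"
  have u: "u \<in> S" using inv assms by (simp add: u_def)
  have "0 \<le> 2 * t * (u \<bullet> u) + t\<^sup>2 * (u \<bullet> (X *v u))" for t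
  proof -
    have "b + t *\<^sub>R u \<in> S" using assms u by (simp add: subspace_add subspace_scale)
    from pos[OF this] have "0 \<le> (b + t *\<^sub>R u) \<bullet> (X *v (b + t *\<^sub>R u))" .
    also have "\<dots> = 2 * t * (u \<bullet> u) + t\<^sup>2 * (u \<bullet> (X *v u))"
      using assms(6) sym_mat_inner[OF assms(1), of b u]
      by (simp add: algebra_simps inner_add_left inner_add_right power2_eq_square u_def)
    finally show ?thesis .
  qed
  note q = this
  define d where "d = \<bar>u \<bullet> (X *v u)\<bar> + 1"
  have d: "d > 0" "u \<bullet> (X *v u) < d" by (auto simp: d_def)
  have 1: "0 \<le> - 2 * e * (u \<bullet> u) + e\<^sup>2 * d" if "e > 0" for e
  proof -
    have "e\<^sup>2 * (u \<bullet> (X *v u)) \<le> e\<^sup>2 * d" using d by (intro mult_left_mono) auto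
    then show ?thesis using q[of "-e"] by simp
  qed
  have "u \<bullet> u \<le> 0"
  proof (rule ccontr)
    assume "\<not> u \<bullet> u \<le> 0"
    then have p: "u \<bullet> u > 0" by linarith
    \<comment> \<open>The quadratic term becomes \<open>e * (u \<bullet> u)\<close>, half of the
      linear one in absolute value, so the sum is negative.\<close>
    define e where "e = (u \<bullet> u) / d"
    have "e > 0" "e * d = u \<bullet> u" using p d by (auto simp: e_def)
    then have "e\<^sup>2 * d = e * (u \<bullet> u)" by (simp add: power2_eq_square)
    moreover have "e * (u \<bullet> u) > 0" using \<open>e > 0\<close> p by simp
    ultimately show False using 1[OF \<open>e > 0\<close>] by linarith
  qed
  then have "u = 0" using inner_gt_zero_iff[of u] by linarith
  then show ?thesis by (simp add: u_def)
qed

text \<open>Induction on the dimension requires an arbitrary invariant subspace. A maximiser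
  \<open>b\<close> of the form on the unit sphere of \<open>S\<close>, with value \<open>l\<close>,
  makes \<open>l *\<^sub>R mat 1 - X\<close> nonnegative on \<open>S\<close> and zero at
  \<open>b\<close>, so \<open>b\<close> is an eigenvector; by symmetry of \<open>X\<close> its
  orthogonal complement in \<open>S\<close> is again invariant.\<close>

lemma eigenvector_basis_subspace:
  fixes X :: "real ^ 'k ^ 'k"
  assumes "sym_mat X" "subspace S" "\<And>u. u \<in> S \<Longrightarrow> X *v u \<in> S"
  shows "\<exists>B. finite B \<and> pairwise orthogonal B \<and> span B = S \<and>
    (\<forall>b\<in>B. norm b = 1 \<and> (\<exists>l. X *v b = l *\<^sub>R b))"
  using assms(2,3)
proof (induction "dim S" arbitrary: S rule: less_induct)
  case less
  show ?case
  proof (cases "S = {0}")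
    case True
    then show ?thesis by (intro exI[of _ "{}"]) simp
  next
    case False
    define C where "C = S \<inter> sphere 0 1"
    have "compact C"
      unfolding C_def by (intro closed_Int_compact closed_subspace less compact_sphere)
    moreover have "C \<noteq> {}"
    proof -
      obtain x where "x \<in> S" "x \<noteq> 0" using False less(2) subspace_0 by fastforce
      then have "(1 / norm x) *\<^sub>R x \<in> C" using less(2) by (simp add: C_def subspace_scale)
      then show ?thesis by blast
    qed
    moreover have "continuous_on C (\<lambda>x. x \<bullet> (X *v x))"
      by (intro continuous_intros linear_continuous_on_compose[where f="\<lambda>x. x"]
           matrix_vector_mul_linear)
    ultimately obtain b where b: "b \<in> C" "\<And>y. y \<in> C \<Longrightarrow> y \<bullet> (X *v y) \<le> b \<bullet> (X *v b)"
      using continuous_attains_sup by metis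
    define l where "l = b \<bullet> (X *v b)"
    have nb: "norm b = 1" and bS: "b \<in> S" using b by (auto simp: C_def)
    have bb: "b \<bullet> b = 1" using nb by (simp add: norm_eq_1)
    define Y where "Y = l *\<^sub>R mat 1 - X"
    have Yv: "Y *v u = l *\<^sub>R u - X *v u" for u
      by (simp add: Y_def matrix_vector_mult_diff_rdistrib scaleR_matrix_vector_assoc[symmetric])
    have "Y *v b = 0"
    proof (rule psd_on_subspace_kernel[OF _ less(2)])
      show "sym_mat Y" unfolding Y_def by (intro sym_mat_diff sym_mat_scaleR assms sym_mat_one)
      show "Y *v u \<in> S" if "u \<in> S" for u
        using that less by (simp add: Yv subspace_diff subspace_scale)
      show "b \<bullet> (Y *v b) = 0" by (simp add: Yv inner_diff_right bb l_def)
      show "0 \<le> u \<bullet> (Y *v u)" if u: "u \<in> S" for u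
      proof (cases "u = 0")
        case False
        define y where "y = (1 / norm u) *\<^sub>R u"
        have "y \<in> C" using u False less(2) by (simp add: C_def y_def subspace_scale)
        then have "y \<bullet> (X *v y) \<le> l" using b by (simp add: l_def)
        moreover have "u = norm u *\<^sub>R y" using False by (simp add: y_def)
        then have "u \<bullet> (X *v u) = (norm u)\<^sup>2 * (y \<bullet> (X *v y))"
          by (metis (no_types, lifting) inner_scaleR_left inner_scaleR_right
              matrix_vector_mult_scaleR mult.assoc power2_eq_square)
        ultimately have "u \<bullet> (X *v u) \<le> (norm u)\<^sup>2 * l" by (simp add: mult_left_mono)
        then show ?thesis by (simp add: Yv inner_diff_right power2_norm_eq_inner mult.commute)
      qed simp
    qed (fact bS)
    then have eig: "X *v b = l *\<^sub>R b" by (simp add: Yv)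
    define S' where "S' = {x \<in> S. orthogonal b x}"
    have sub': "subspace S'"
      using less(2) by (auto simp: S'_def subspace_def orthogonal_def inner_add_right)
    have "b \<notin> S'" using bb by (simp add: S'_def orthogonal_def)
    moreover have "S' \<subseteq> S" by (auto simp: S'_def)
    ultimately have "S' \<subset> S" using bS by blast
    then have "dim S' < dim S" using sub' less(2) by (metis dim_psubset span_eq_iff)
    moreover have "X *v u \<in> S'" if "u \<in> S'" for u
      using that less(3) sym_mat_inner[OF assms(1), of b u]
      by (auto simp: S'_def orthogonal_def eig)
    ultimately obtain B where B: "finite B" "pairwise orthogonal B" "span B = S'"
      "\<forall>b\<in>B. norm b = 1 \<and> (\<exists>l. X *v b = l *\<^sub>R b)"
      using less(1)[OF _ sub'] by blast
    have BS: "B \<subseteq> S'" using B(3) span_superset by blast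
    show ?thesis
    proof (intro exI[of _ "insert b B"] conjI)
      show "pairwise orthogonal (insert b B)"
        using B(2) BS by (auto simp: pairwise_insert S'_def orthogonal_commute)
      show "span (insert b B) = S"
      proof
        show "span (insert b B) \<subseteq> S"
          using bS BS less(2) by (intro span_minimal) (auto simp: S'_def)
        show "S \<subseteq> span (insert b B)"
        proof
          fix x assume x: "x \<in> S"
          have "x - (b \<bullet> x) *\<^sub>R b \<in> S'"
            using x bS less(2) bb
            by (auto simp: S'_def orthogonal_def inner_diff_right subspace_diff subspace_scale)
          then show "x \<in> span (insert b B)" unfolding span_insert B(3) by blast
        qed
      qed
    qed (use B nb eig in auto)
  qed
qed

lemma eigenvector_basis:
  fixes X :: "real ^ 'k ^ 'k"
  assumes "sym_mat X"
  obtains B where "finite B" "pairwise orthogonal B" "span B = UNIV"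
    "\<And>b. b \<in> B \<Longrightarrow> norm b = 1" "\<And>b. b \<in> B \<Longrightarrow> X *v b = (b \<bullet> (X *v b)) *\<^sub>R b"
proof -
  obtain B where B: "finite B" "pairwise orthogonal B" "span B = UNIV"
    "\<forall>b\<in>B. norm b = 1 \<and> (\<exists>l. X *v b = l *\<^sub>R b)"
    using eigenvector_basis_subspace[OF assms, of UNIV] by auto
  have "X *v b = (b \<bullet> (X *v b)) *\<^sub>R b" if b: "b \<in> B" for b
  proof -
    obtain l where "X *v b = l *\<^sub>R b" using B b by blast
    moreover have "b \<bullet> b = 1" using B b by (simp add: norm_eq_1)
    ultimately show ?thesis by simp
  qed
  then show thesis using that B by blast
qed

lemma matrix_eq_on_span:
  assumes "span B = (UNIV :: (real ^ 'b) set)" "\<And>b. b \<in> B \<Longrightarrow> X *v b = Y *v b"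
  shows "X = (Y :: real ^ 'b ^ 'a)"
proof -
  have "X *v u = Y *v u" for u
    by (rule linear_eq_on_span[of "(*v) X" "(*v) Y" B]) (use assms in auto)
  then show ?thesis by (simp add: matrix_eq)
qed

lemma psd_root_exists:
  fixes X :: "real ^ 'k ^ 'k"
  assumes "psd X"
  shows "\<exists>Y. psd Y \<and> Y ** Y = X"
proof -
  obtain B where B: "finite B" "pairwise orthogonal B" "span B = UNIV"
    "\<And>b. b \<in> B \<Longrightarrow> norm b = 1" and eig: "\<And>b. b \<in> B \<Longrightarrow> X *v b = (b \<bullet> (X *v b)) *\<^sub>R b"
    using eigenvector_basis[OF psd_sym[OF assms]] by blast
  define Y where "Y = (\<Sum>b\<in>B. sqrt (b \<bullet> (X *v b)) *\<^sub>R outer b b)"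
  have "psd (\<Sum>b\<in>C. sqrt (b \<bullet> (X *v b)) *\<^sub>R outer b b)" for C
    by (induction C rule: infinite_finite_induct)
      (simp_all add: psd_add psd_scaleR psd_outer psd_quad[OF assms])
  then have "psd Y" by (simp add: Y_def)
  have Yb: "Y *v b = sqrt (b \<bullet> (X *v b)) *\<^sub>R b" if b: "b \<in> B" for b
  proof -
    have "Y *v b = (\<Sum>c\<in>B. (sqrt (c \<bullet> (X *v c)) * (c \<bullet> b)) *\<^sub>R c)"
      by (simp add: Y_def matrix_sum_vec scaleR_matrix_vector_assoc[symmetric] outer_mult_vec)
    also have "\<dots> = (\<Sum>c\<in>B. if c = b then sqrt (b \<bullet> (X *v b)) *\<^sub>R b else 0)"
      using B b by (intro sum.cong) (auto simp: pairwise_def orthogonal_def norm_eq_1)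
    finally show ?thesis using B b by simp
  qed
  have "Y ** Y = X"
  proof (rule matrix_eq_on_span[OF B(3)])
    fix b assume b: "b \<in> B"
    have "(Y ** Y) *v b = Y *v (Y *v b)" by (simp only: matrix_vector_mul_assoc)
    also have "\<dots> = (b \<bullet> (X *v b)) *\<^sub>R b"
      using psd_quad[OF assms, of b] by (simp add: Yb[OF b] matrix_vector_mult_scaleR)
    finally show "(Y ** Y) *v b = X *v b" using eig[OF b] by simp
  qed
  with \<open>psd Y\<close> show ?thesis by blast
qed

text \<open>The defect \<open>c\<close> satisfies \<open>Y *v c = - sqrt l *\<^sub>R c\<close>, and
  a positive semidefinite matrix has no negative eigenvalue; for \<open>l = 0\<close> the norm of
  \<open>Y *v b\<close> is computed directly. A root is therefore determined on an eigenbasis of its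
  square, which gives the uniqueness that \<open>psd_sqrt\<close> as a definite description
  requires.\<close>

lemma psd_root_eigenvector:
  fixes Y :: "real ^ 'k ^ 'k"
  assumes "psd Y" "(Y ** Y) *v b = l *\<^sub>R b" "0 \<le> l"
  shows "Y *v b = sqrt l *\<^sub>R b"
proof -
  define c where "c = Y *v b - sqrt l *\<^sub>R b"
  have "Y *v (Y *v b) = l *\<^sub>R b" using assms(2) by (simp only: matrix_vector_mul_assoc)
  then have c: "Y *v c = - sqrt l *\<^sub>R c"
    using assms(3) by (simp add: c_def algebra_simps)
  then have "c \<bullet> (Y *v c) = - sqrt l * (c \<bullet> c)" by simp
  with psd_quad[OF assms(1), of c] have "sqrt l * (c \<bullet> c) \<le> 0" by simp
  moreover have "c = 0" if "l = 0"
  proof -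
    have "c \<bullet> c = (Y *v b) \<bullet> (Y *v b)" using that by (simp add: c_def)
    also have "\<dots> = b \<bullet> (Y *v (Y *v b))" using sym_mat_inner[OF psd_sym[OF assms(1)]] by metis
    also have "\<dots> = 0" using that \<open>Y *v (Y *v b) = l *\<^sub>R b\<close> by simp
    finally show ?thesis by simp
  qed
  ultimately have "c = 0"
    using assms(3) by (metis inner_gt_zero_iff less_eq_real_def not_less real_sqrt_gt_zero
        zero_less_mult_iff)
  then show ?thesis by (simp add: c_def)
qed

lemma psd_root_unique:
  fixes X :: "real ^ 'k ^ 'k"
  assumes "psd X" "psd Y" "Y ** Y = X" "psd Z" "Z ** Z = X"
  shows "Y = Z"
proof -
  obtain B where B: "span B = UNIV" and eig: "\<And>b. b \<in> B \<Longrightarrow> X *v b = (b \<bullet> (X *v b)) *\<^sub>R b"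
    using eigenvector_basis[OF psd_sym[OF assms(1)]] by metis
  show ?thesis
    by (rule matrix_eq_on_span[OF B]) (metis assms eig psd_root_eigenvector psd_quad)
qed

lemma psd_sqrt:
  assumes "psd X"
  shows "psd (psd_sqrt X)" "psd_sqrt X ** psd_sqrt X = X"
proof -
  have "\<exists>!Y. psd Y \<and> Y ** Y = X"
    using psd_root_exists[OF assms] psd_root_unique[OF assms] by blast
  from theI'[OF this] show "psd (psd_sqrt X)" "psd_sqrt X ** psd_sqrt X = X"
    by (simp_all add: psd_sqrt_def)
qed

lemma psd_sqrt_gram: "psd X \<Longrightarrow> transpose (psd_sqrt X) ** psd_sqrt X = X"
  using psd_sqrt[of X] by (simp add: psd_def sym_mat_def)

lemma norm_psd_sqrt: "psd X \<Longrightarrow> (norm (psd_sqrt X *v v))\<^sup>2 = v \<bullet> (X *v v)"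
  using inner_congruence[of v "psd_sqrt X" "mat 1" v] psd_sqrt_gram[of X]
  by (simp add: power2_norm_eq_inner)

section \<open>Traces of products of positive semidefinite matrices\<close>

lemma trace_mult_gram:
  "trace (X ** (R ** transpose R)) = (\<Sum>i\<in>UNIV. column i R \<bullet> (X *v column i R))"
  for X :: "real ^ 'k ^ 'k" and R :: "real ^ 'l ^ 'k"
proof -
  have "trace (X ** (R ** transpose R)) = trace (transpose R ** X ** R)"
    by (metis matrix_mul_assoc trace_mul_sym)
  then show ?thesis
    unfolding trace_eq_sum_quad inner_congruence by (simp add: matrix_vector_mult_basis)
qed

lemma psd_gram_root:
  assumes "psd (Y :: real ^ 'k ^ 'k)"
  obtains R :: "real ^ 'k ^ 'k" where "Y = R ** transpose R"
proof -
  have "Y = psd_sqrt Y ** transpose (psd_sqrt Y)"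
    using psd_sqrt[OF assms] by (simp add: psd_def sym_mat_def)
  then show thesis by (rule that)
qed

lemma trace_mult_psd_nonneg:
  fixes X Y :: "real ^ 'k ^ 'k"
  assumes "psd X" "psd Y"
  shows "0 \<le> trace (X ** Y)"
proof -
  obtain R :: "real ^ 'k ^ 'k" where "Y = R ** transpose R" by (rule psd_gram_root[OF assms(2)])
  then show ?thesis
    by (auto simp: trace_mult_gram intro!: sum_nonneg psd_quad assms)
qed

lemma matrix_zero_columns: "(\<And>i. column i R = 0) \<Longrightarrow> R = (0 :: real ^ 'l ^ 'k)"
  by (simp add: column_def vec_eq_iff)

text \<open>A Gram root of \<open>Y\<close> makes the trace a sum of values of the form
  \<open>X\<close> at its columns, all of which must vanish. This is the strictness behind
  uniqueness of the optimal gains, with the initial data as \<open>X\<close> and the completed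
  square as \<open>Y\<close>.\<close>

lemma trace_mult_posdef_zero:
  fixes X Y :: "real ^ 'k ^ 'k"
  assumes "posdef X" "psd Y" "trace (X ** Y) = 0"
  shows "Y = 0"
proof -
  obtain R :: "real ^ 'k ^ 'k" where R: "Y = R ** transpose R" by (rule psd_gram_root[OF assms(2)])
  have "(\<Sum>i\<in>UNIV. column i R \<bullet> (X *v column i R)) = 0"
    using assms(3) by (simp add: R trace_mult_gram)
  then have "column i R \<bullet> (X *v column i R) = 0" for i
    by (subst (asm) sum_nonneg_eq_0_iff) (auto intro: psd_quad posdef_imp_psd assms)
  then have "column i R = 0" for i
    using posdef_quad[OF assms(1), of "column i R"] by fastforce
  then have "R = 0" by (rule matrix_zero_columns)
  then show ?thesis by (simp add: R)
qed

lemma gram_zero: "trace (R ** transpose R) = 0 \<Longrightarrow> R = (0 :: real ^ 'l ^ 'k)"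
proof -
  assume "trace (R ** transpose R) = 0"
  then have "(\<Sum>i\<in>UNIV. column i R \<bullet> column i R) = 0"
    using trace_mult_gram[of "mat 1" R] by simp
  then have "column i R \<bullet> column i R = 0" for i
    by (subst (asm) sum_nonneg_eq_0_iff) auto
  then show "R = 0" by (intro matrix_zero_columns) simp
qed

text \<open>The constant is the minimum of the form on the unit sphere, attained by
  compactness.\<close>

lemma posdef_bounds_identity:
  fixes X :: "real ^ 'k ^ 'k"
  assumes "posdef X"
  obtains e where "e > 0" "psd (X - e *\<^sub>R mat 1)"
proof -
  have "continuous_on (sphere 0 1) (\<lambda>x. x \<bullet> (X *v x))"
    by (intro continuous_intros linear_continuous_on_compose[where f="\<lambda>x. x"]
         matrix_vector_mul_linear)
  moreover have "axis undefined 1 \<in> sphere (0 :: real ^ 'k) 1" by simp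
  then have "sphere (0 :: real ^ 'k) 1 \<noteq> {}" by blast
  ultimately obtain b where b: "b \<in> sphere 0 1"
    "\<And>y. y \<in> sphere 0 1 \<Longrightarrow> b \<bullet> (X *v b) \<le> y \<bullet> (X *v y)"
    using continuous_attains_inf[OF compact_sphere] by blast
  define e where "e = b \<bullet> (X *v b)"
  have "b \<noteq> 0" using b by auto
  then have "e > 0" using posdef_quad[OF assms] by (simp add: e_def)
  moreover have "e * (u \<bullet> u) \<le> u \<bullet> (X *v u)" for u
  proof (cases "u = 0")
    case False
    define y where "y = (1 / norm u) *\<^sub>R u"
    have "y \<in> sphere 0 1" using False by (simp add: y_def)
    then have "e \<le> y \<bullet> (X *v y)" using b by (simp add: e_def)
    moreover have "u = norm u *\<^sub>R y" using False by (simp add: y_def)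
    then have "u \<bullet> (X *v u) = (norm u)\<^sup>2 * (y \<bullet> (X *v y))"
      by (metis (no_types, lifting) inner_scaleR_left inner_scaleR_right
          matrix_vector_mult_scaleR mult.assoc power2_eq_square)
    ultimately show ?thesis
      using mult_left_mono[of e "y \<bullet> (X *v y)" "u \<bullet> u"]
      by (simp add: power2_norm_eq_inner mult.commute)
  qed simp
  then have "psd (X - e *\<^sub>R mat 1)"
    by (subst psd_diff_iff) (simp_all add: posdef_sym[OF assms] sym_mat_scaleR
        scaleR_matrix_vector_assoc[symmetric])
  ultimately show thesis by (rule that)
qed

section \<open>Positive operators on symmetric matrices\<close>

definition positive_op :: "(real ^ 'k ^ 'k \<Rightarrow> real ^ 'k ^ 'k) \<Rightarrow> bool" where
  "positive_op T \<longleftrightarrow> linear T \<and> (\<forall>X. psd X \<longrightarrow> psd (T X))"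

text \<open>Spectral radius below one, expressed by powers so that the arguments stay over the
  reals. Only symmetric matrices are tested because the spectrum in \<open>stab_gains\<close> is
  taken on that subspace.\<close>

definition decays :: "(real ^ 'k ^ 'k \<Rightarrow> real ^ 'k ^ 'k) \<Rightarrow> bool" where
  "decays T \<longleftrightarrow> (\<forall>X. sym_mat X \<longrightarrow> (\<lambda>k. (T ^^ k) X) \<longlonglongrightarrow> 0)"

text \<open>By Cauchy-Schwarz \<open>outer v v\<close> lies below \<open>v \<bullet> v\<close> times
  the identity, and the trace against \<open>X\<close> preserves this order. The identity thereby
  dominates the cone and represents it in all decay estimates.\<close>

lemma psd_le_trace:
  assumes "psd (X :: real ^ 'k ^ 'k)"
  shows "psd (trace X *\<^sub>R mat 1 - X)"
proof -
  have "v \<bullet> (X *v v) \<le> trace X * (v \<bullet> v)" for v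
  proof -
    have "psd ((v \<bullet> v) *\<^sub>R mat 1 - outer v v)"
      by (subst psd_diff_iff)
        (auto simp: sym_mat_scaleR psd_sym[OF psd_outer] outer_mult_vec
          scaleR_matrix_vector_assoc[symmetric] inner_commute
          mult.commute[of "v \<bullet> v"] Cauchy_Schwarz_ineq[unfolded power2_eq_square])
    from trace_mult_psd_nonneg[OF assms this] show ?thesis
      by (simp add: matrix_sub_ldistrib matrix_scaleR_right trace_sub trace_scaleR
          trace_outer_mult mult.commute)
  qed
  then show ?thesis
    by (subst psd_diff_iff)
      (simp_all add: psd_sym[OF assms] sym_mat_scaleR scaleR_matrix_vector_assoc[symmetric])
qed

text \<open>Exhibits a symmetric matrix as a difference of positive semidefinite ones, so that
  results on the cone extend by linearity.\<close>

lemma sym_mat_bounded: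
  assumes "sym_mat (X :: real ^ 'k ^ 'k)"
  obtains c where "0 \<le> c" "psd (c *\<^sub>R mat 1 + X)" "psd (c *\<^sub>R mat 1 - X)"
proof -
  obtain B where B: "\<And>v. norm (X *v v) \<le> B * norm v"
    using linear_bounded[of "(*v) X"] by auto
  define c where "c = \<bar>B\<bar>"
  have q: "\<bar>v \<bullet> (X *v v)\<bar> \<le> c * (v \<bullet> v)" for v
  proof -
    have "\<bar>v \<bullet> (X *v v)\<bar> \<le> norm v * norm (X *v v)" by (rule Cauchy_Schwarz_ineq2)
    also have "\<dots> \<le> norm v * (c * norm v)"
      using order_trans[OF B[of v] mult_right_mono[OF abs_ge_self[of B]]]
      by (intro mult_left_mono) (auto simp: c_def)
    finally show ?thesis by (simp add: dot_square_norm power2_eq_square mult_ac)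
  qed
  have "psd (c *\<^sub>R mat 1 + X)" "psd (c *\<^sub>R mat 1 - X)"
    using q by (auto simp: psd_def sym_mat_add sym_mat_diff sym_mat_scaleR assms
        matrix_vector_mult_diff_rdistrib matrix_vector_mult_add_rdistrib inner_add_right
        inner_diff_right scaleR_matrix_vector_assoc[symmetric] abs_le_iff)
      (smt (verit))+
  then show thesis by (intro that[of c]) (simp_all add: c_def)
qed

text \<open>The iteration \<open>T X + H\<close> started at zero increases and never passes the
  supersolution \<open>B\<close>; its limit is a solution because \<open>T\<close> is
  continuous.\<close>

lemma psd_solution_below:
  assumes T: "positive_op T" and H: "psd H" and B: "psd B" and super: "psd (B - (T B + H))"
  obtains X where "psd X" "X = T X + H" "psd (B - X)"
proof -
  have lin: "linear T" and psd_T: "\<And>X. psd X \<Longrightarrow> psd (T X)"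
    using T by (simp_all add: positive_op_def)
  define Y where "Y k = ((\<lambda>X. T X + H) ^^ k) 0" for k :: nat
  have YS: "Y (Suc k) = T (Y k) + H" for k by (simp add: Y_def)
  have Y0: "Y 0 = 0" by (simp add: Y_def)
  have "psd (Y (Suc k) - Y k)" for k
  proof (induction k)
    case 0 then show ?case using H by (simp add: YS Y0 linear_0[OF lin])
  next
    case (Suc k)
    from psd_T[OF this] show ?case by (simp add: YS[of k] YS[of "Suc k"] linear_diff[OF lin])
  qed
  moreover have "psd (B - Y k)" for k
  proof (induction k)
    case 0 then show ?case using B by (simp add: Y0)
  next
    case (Suc k)
    from psd_add[OF super psd_T[OF this]] show ?case by (simp add: YS linear_diff[OF lin] algebra_simps)
  qed
  ultimately obtain L where L: "Y \<longlonglongrightarrow> L" "\<And>k. psd (L - Y k)" "psd (B - L)"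
    using psd_monotone_convergence[of Y B] by blast
  have "(\<lambda>k. Y (Suc k)) \<longlonglongrightarrow> T L + H"
    unfolding YS
    by (intro tendsto_intros L bounded_linear.tendsto[OF linear_conv_bounded_linear[THEN iffD1, OF lin]])
  then have "L = T L + H"
    using L(1) LIMSEQ_Suc LIMSEQ_unique by blast
  moreover have "psd L" using L(2)[of 0] by (simp add: Y0)
  ultimately show thesis using that L by blast
qed

context
  fixes T :: "real ^ 'k ^ 'k \<Rightarrow> real ^ 'k ^ 'k"
  assumes pos: "positive_op T"
begin

private lemma lin: "linear T" and psd_T: "psd X \<Longrightarrow> psd (T X)"
  using pos by (simp_all add: positive_op_def)

private lemma T_add: "T (X + Y) = T X + T Y"
  and T_diff: "T (X - Y) = T X - T Y"
  and T_scaleR: "T (c *\<^sub>R X) = c *\<^sub>R T X"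
  and T_zero: "T 0 = 0"
  by (simp_all add: lin linear_add linear_diff linear_scale linear_0)

private lemma T_tendsto: "(X \<longlongrightarrow> L) F \<Longrightarrow> ((\<lambda>k. T (X k)) \<longlongrightarrow> T L) F"
  using lin linear_conv_bounded_linear bounded_linear.tendsto by blast

lemma positive_op_funpow: "positive_op (T ^^ k)"
proof -
  have "linear (T ^^ k)"
  proof (induction k)
    case (Suc k) then show ?case using linear_compose[of "T ^^ k" T] lin by (simp add: o_def)
  qed (simp add: linear_iff)
  moreover have "psd X \<Longrightarrow> psd ((T ^^ k) X)" for X
    by (induction k) (simp_all add: psd_T)
  ultimately show ?thesis by (simp add: positive_op_def)
qed

text \<open>Follow the solution of \<open>X = t T X + 1\<close> from \<open>t = 0\<close> to \<open>t = 1\<close>; the only obstruction is a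
  blow-up, whose normalised limit is a positive semidefinite eigenvector.\<close>

lemma perron_alternative:
  "(\<exists>X. psd X \<and> X = T X + mat 1) \<or> (\<exists>t Y. 0 < t \<and> t \<le> 1 \<and> psd Y \<and> Y \<noteq> 0 \<and> Y = t *\<^sub>R T Y)"
proof (rule disjCI)
  assume no: "\<not> (\<exists>t Y. 0 < t \<and> t \<le> 1 \<and> psd Y \<and> Y \<noteq> 0 \<and> Y = t *\<^sub>R T Y)"
  define A where "A = {(t, X). 0 \<le> t \<and> t \<le> 1 \<and> psd X \<and> X = t *\<^sub>R T X + mat 1}"
  \<comment> \<open>If the traces were unbounded along the path, the solutions scaled to trace one
    would stay in a compact set while the inhomogeneity scales to zero, and a subsequential limit
    would be the excluded eigenvector.\<close>
  have "\<exists>C. \<forall>(t, X) \<in> A. trace X \<le> C"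
  proof (rule ccontr)
    assume "\<not> ?thesis"
    then have "\<forall>n::nat. \<exists>p\<in>A. trace (snd p) > real n" by (force simp: not_le)
    then obtain p where p: "\<And>n. p n \<in> A" "\<And>n. trace (snd (p n)) > real n" by metis
    define t where "t n = fst (p n)" for n
    define X where "X n = snd (p n)" for n
    have tX: "0 \<le> t n" "t n \<le> 1" "psd (X n)" "X n = t n *\<^sub>R T (X n) + mat 1"
      and tr: "trace (X n) > real n" for n
      using p[of n] by (auto simp: A_def t_def X_def split_beta)
    define Y where "Y n = (1 / trace (X n)) *\<^sub>R X n" for n
    have trpos: "trace (X n) > 0" for n using tr[of n] by linarith
    have Y: "psd (Y n)" "trace (Y n) = 1" for n
      using tX trpos[of n] by (auto simp: Y_def psd_scaleR trace_scaleR)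
    have Yeq: "Y n = t n *\<^sub>R T (Y n) + (1 / trace (X n)) *\<^sub>R mat 1" for n
    proof -
      have "Y n = (1 / trace (X n)) *\<^sub>R (t n *\<^sub>R T (X n) + mat 1)" using tX(4)[of n] by (simp add: Y_def)
      also have "\<dots> = t n *\<^sub>R T (Y n) + (1 / trace (X n)) *\<^sub>R mat 1"
        by (simp add: Y_def T_scaleR scaleR_add_right mult.commute)
      finally show ?thesis .
    qed
    define K where "K = real CARD('k) * real CARD('k)"
    have "norm (Y n) \<le> K" for n using psd_norm_le_trace[OF Y(1)[of n]] by (simp add: Y K_def)
    then have "\<forall>n. (t n, Y n) \<in> {0..1} \<times> cball 0 K" using tX by auto
    moreover have "compact ({0..1::real} \<times> cball (0 :: real ^ 'k ^ 'k) K)"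
      by (intro compact_Times) auto
    ultimately obtain l r where lr: "strict_mono r" "((\<lambda>n. (t n, Y n)) \<circ> r) \<longlonglongrightarrow> l"
      and l: "l \<in> {0..1} \<times> cball 0 K"
      unfolding compact_def by meson
    have lt: "(\<lambda>n. t (r n)) \<longlonglongrightarrow> fst l" and lY: "(\<lambda>n. Y (r n)) \<longlonglongrightarrow> snd l"
      using tendsto_fst[OF lr(2)] tendsto_snd[OF lr(2)] by (simp_all add: o_def)
    have inv0: "(\<lambda>n. 1 / trace (X n)) \<longlonglongrightarrow> 0"
    proof (rule tendsto_sandwich[of "\<lambda>_. 0" _ _ "\<lambda>n. 1 / real n"])
      show "\<forall>\<^sub>F n in sequentially. 1 / trace (X n) \<le> 1 / real n"
        using tr by (intro eventually_sequentiallyI[of 1] divide_left_mono) (auto intro: less_imp_le mult_pos_pos trpos)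
      show "\<forall>\<^sub>F n in sequentially. 0 \<le> 1 / trace (X n)"
        using trpos by (auto intro!: always_eventually less_imp_le)
    qed (auto intro: lim_1_over_n)
    have "(\<lambda>n. Y (r n)) \<longlonglongrightarrow> fst l *\<^sub>R T (snd l) + 0 *\<^sub>R mat 1"
      by (subst Yeq) (intro tendsto_intros T_tendsto lt lY LIMSEQ_subseq_LIMSEQ[OF inv0 lr(1), unfolded o_def])
    then have eq: "snd l = fst l *\<^sub>R T (snd l)" using lY LIMSEQ_unique by fastforce
    have "trace (snd l) = 1"
      using tendsto_trace[OF lY] by (simp add: Y LIMSEQ_const_iff)
    then have "snd l \<noteq> 0" by auto
    then have "fst l \<noteq> 0" using eq by auto
    moreover have "psd (snd l)" using psd_limit[OF lY] Y by blast
    ultimately show False using no eq l \<open>snd l \<noteq> 0\<close> by (auto simp: mem_Times_iff order_less_le)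
  qed
  then obtain C where C: "\<And>t X. (t, X) \<in> A \<Longrightarrow> trace X \<le> C" by blast
  define d where "d = trace (T (mat 1))"
  have d: "psd (d *\<^sub>R mat 1 - T (mat 1))" "0 \<le> d"
    unfolding d_def by (auto intro!: psd_le_trace psd_T trace_psd_nonneg)
  \<comment> \<open>The step length makes \<open>2 *\<^sub>R X\<close> a supersolution for every
    parameter up to \<open>\<delta>\<close> beyond \<open>t\<close>: its surplus is
    \<open>mat 1 - (2 * e) *\<^sub>R T X\<close>, and \<open>T X\<close> is at most
    \<open>\<bar>C\<bar> * d\<close> times the identity. It does not depend on \<open>t\<close>, so
    finitely many steps reach 1; the \<open>+ 1\<close> keeps the denominator positive.\<close>
  define \<delta> where "\<delta> = 1 / (2 * \<bar>C\<bar> * d + 1)"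
  have \<delta>: "0 < \<delta>" "2 * \<delta> * (\<bar>C\<bar> * d) \<le> 1" proof -
    have "0 \<le> 2 * \<bar>C\<bar> * d" using d by simp
    then show "0 < \<delta>" "2 * \<delta> * (\<bar>C\<bar> * d) \<le> 1" by (auto simp: \<delta>_def field_simps)
  qed
  have step: "\<exists>X'. (t', X') \<in> A" if tA: "(t, X) \<in> A" and t': "t \<le> t'" "t' \<le> t + \<delta>" "t' \<le> 1" for t t' X
  proof -
    have X: "psd X" "X = t *\<^sub>R T X + mat 1" "0 \<le> t" using tA by (auto simp: A_def)
    have "psd (\<bar>C\<bar> *\<^sub>R mat 1 - X)"
      using psd_add[OF psd_le_trace[OF X(1)] psd_scaleR[OF psd_one, of "\<bar>C\<bar> - trace X"]] C[OF tA]
      by (simp add: algebra_simps)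
    then have "psd (\<bar>C\<bar> *\<^sub>R T (mat 1) - T X)" using psd_T T_diff T_scaleR by metis
    moreover have "psd (\<bar>C\<bar> *\<^sub>R (d *\<^sub>R mat 1 - T (mat 1)))" by (intro psd_scaleR d) simp
    ultimately have TX: "psd ((\<bar>C\<bar> * d) *\<^sub>R mat 1 - T X)"
      using psd_add by (fastforce simp: algebra_simps)
    define e where "e = t' - t"
    have e: "0 \<le> e" "e \<le> \<delta>" using t' by (auto simp: e_def)
    have pos': "positive_op (\<lambda>X. t' *\<^sub>R T X)"
      using X(3) t' by (auto simp: positive_op_def psd_T psd_scaleR intro!: linear_compose_scale_right lin)
    have "2 * e * (\<bar>C\<bar> * d) \<le> 2 * \<delta> * (\<bar>C\<bar> * d)"
      using e d by (intro mult_right_mono) auto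
    then have e1: "2 * e * (\<bar>C\<bar> * d) \<le> 1" using \<delta> by linarith
    have "psd ((2 * e) *\<^sub>R ((\<bar>C\<bar> * d) *\<^sub>R mat 1 - T X) + (1 - 2 * e * (\<bar>C\<bar> * d)) *\<^sub>R mat 1)"
      using e e1 by (intro psd_add psd_scaleR TX psd_one) auto
    moreover have "\<dots> = mat 1 - (2 * e) *\<^sub>R T X"
      by (simp add: algebra_simps)
    moreover have "2 *\<^sub>R X - (t' *\<^sub>R T (2 *\<^sub>R X) + mat 1) = mat 1 - (2 * e) *\<^sub>R T X"
    proof -
      have "X - t *\<^sub>R T X = mat 1" using X(2) by (metis add_diff_cancel_left')
      moreover have "2 *\<^sub>R X - (t' *\<^sub>R T (2 *\<^sub>R X) + mat 1)
          = 2 *\<^sub>R (X - t *\<^sub>R T X) - (2 * e) *\<^sub>R T X - mat 1"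
        unfolding e_def T_scaleR by (simp add: algebra_simps)
      ultimately show ?thesis by (simp add: scaleR_2)
    qed
    ultimately have "psd (2 *\<^sub>R X - (t' *\<^sub>R T (2 *\<^sub>R X) + mat 1))" by metis
    then obtain X' where "psd X'" "X' = t' *\<^sub>R T X' + mat 1"
      using psd_solution_below[OF pos' psd_one psd_scaleR[OF X(1), of 2]] by (metis zero_le_numeral)
    then show ?thesis using X t' by (auto simp: A_def)
  qed
  have "\<exists>X. (min 1 (real n * \<delta>), X) \<in> A" for n
  proof (induction n)
    case 0 then show ?case by (auto simp: A_def)
  next
    case (Suc n)
    then obtain X where "(min 1 (real n * \<delta>), X) \<in> A" by blast
    from step[OF this, of "min 1 (real (Suc n) * \<delta>)"] show ?case
      using \<delta>(1) by (auto simp: algebra_simps min_def)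
  qed
  moreover obtain n where "1 < real n * \<delta>" using reals_Archimedean3[OF \<delta>(1)] by blast
  ultimately obtain X where "(1, X) \<in> A" by (metis min.absorb1 less_imp_le)
  then show "\<exists>X. psd X \<and> X = T X + mat 1" by (auto simp: A_def)
qed

section \<open>Decay of powers, Lyapunov equations and the spectrum\<close>

private lemmas pow = positive_op_funpow

lemma psd_funpow: "psd X \<Longrightarrow> psd ((T ^^ k) X)"
  and linear_funpow: "linear (T ^^ k)"
  using pow[of k] by (simp_all add: positive_op_def)

text \<open>Powers of \<open>T\<close> preserve the order, so the orbit of a positive semidefinite
  \<open>X\<close> lies below \<open>trace X\<close> times the orbit of the identity, and on the
  cone the trace controls the norm.\<close>

lemma decaysI:
  assumes "(\<lambda>k. trace ((T ^^ k) (mat 1))) \<longlonglongrightarrow> 0"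
  shows "decays T"
proof -
  have *: "(\<lambda>k. (T ^^ k) X) \<longlonglongrightarrow> 0" if X: "psd X" for X
  proof -
    define c where "c = trace X"
    define K where "K = real CARD('k) * real CARD('k)"
    have le: "norm ((T ^^ k) X) \<le> K * (c * trace ((T ^^ k) (mat 1)))" for k
    proof -
      have "psd ((T ^^ k) (c *\<^sub>R mat 1 - X))"
        unfolding c_def by (intro psd_funpow psd_le_trace X)
      from trace_psd_nonneg[OF this] have "trace ((T ^^ k) X) \<le> c * trace ((T ^^ k) (mat 1))"
        by (simp add: linear_funpow linear_diff linear_scale trace_sub trace_scaleR)
      then have "K * trace ((T ^^ k) X) \<le> K * (c * trace ((T ^^ k) (mat 1)))"
        by (intro mult_left_mono) (auto simp: K_def)
      then show ?thesis using psd_norm_le_trace[OF psd_funpow[OF X, of k]] by (simp only: K_def)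
    qed
    have "(\<lambda>k. K * (c * trace ((T ^^ k) (mat 1)))) \<longlonglongrightarrow> 0"
      by (intro tendsto_mult_right_zero assms)
    with le show ?thesis
      by (rule Lim_null_comparison[OF always_eventually, OF allI])
  qed
  show ?thesis
    unfolding decays_def
  proof (intro allI impI)
    fix X :: "real ^ 'k ^ 'k" assume "sym_mat X"
    then obtain c where c: "0 \<le> c" "psd (c *\<^sub>R mat 1 + X)" by (rule sym_mat_bounded)
    have "(\<lambda>k. (T ^^ k) (c *\<^sub>R mat 1 + X) - (T ^^ k) (c *\<^sub>R mat 1)) \<longlonglongrightarrow> 0 - 0"
      by (intro tendsto_diff * c psd_scaleR psd_one)
    then show "(\<lambda>k. (T ^^ k) X) \<longlonglongrightarrow> 0"
      by (simp add: linear_funpow linear_add)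
  qed
qed

text \<open>Applying \<open>T ^^ k\<close> to the equation writes \<open>(T ^^ k) (mat 1)\<close> as
  a difference of consecutive members of the orbit of \<open>X\<close>. Their traces decrease and
  are nonnegative, so the differences tend to zero.\<close>

lemma decays_if_solution:
  assumes "psd X" "X = T X + mat 1"
  shows "decays T"
proof (rule decaysI)
  define a where "a k = trace ((T ^^ k) X)" for k
  have diff: "trace ((T ^^ k) (mat 1)) = a k - a (Suc k)" for k
  proof -
    have "(T ^^ k) X = (T ^^ k) (T X) + (T ^^ k) (mat 1)"
      using assms(2) linear_add[OF linear_funpow] by metis
    then have "a k = a (Suc k) + trace ((T ^^ k) (mat 1))"
      unfolding a_def by (metis trace_add funpow_swap1 funpow.simps(2) comp_apply)
    then show ?thesis by simp
  qed
  have "0 \<le> a k" for k unfolding a_def by (intro trace_psd_nonneg psd_funpow assms)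
  moreover have "decseq a"
    using trace_psd_nonneg[OF psd_funpow[OF psd_one]] diff by (intro decseq_SucI) (metis diff_ge_0_iff_ge)
  ultimately obtain l where "a \<longlonglongrightarrow> l" by (metis decseq_convergent)
  then have "(\<lambda>k. a k - a (Suc k)) \<longlonglongrightarrow> l - l" by (intro tendsto_diff LIMSEQ_Suc)
  then show "(\<lambda>k. trace ((T ^^ k) (mat 1))) \<longlonglongrightarrow> 0" by (simp add: diff)
qed

lemma decays_fixpoint_zero:
  assumes "decays T" "sym_mat D" "D = T D"
  shows "D = 0"
proof -
  have "(T ^^ k) D = D" for k by (induction k) (use assms in auto)
  moreover have "(\<lambda>k. (T ^^ k) D) \<longlonglongrightarrow> 0" using assms by (simp add: decays_def)
  ultimately show ?thesis by (simp add: LIMSEQ_const_iff)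
qed

lemma decays_no_eigenvector:
  assumes "decays T" "0 < t" "t \<le> 1" "sym_mat Y" "Y = t *\<^sub>R T Y"
  shows "Y = 0"
proof -
  have "t ^ k *\<^sub>R (T ^^ k) Y = Y" for k
  proof (induction k)
    case (Suc k)
    have "t ^ Suc k *\<^sub>R (T ^^ Suc k) Y = t *\<^sub>R T (t ^ k *\<^sub>R (T ^^ k) Y)" by (simp add: T_scaleR)
    then show ?case using Suc assms by simp
  qed simp
  moreover have "(\<lambda>k. t ^ k *\<^sub>R (T ^^ k) Y) \<longlonglongrightarrow> 0"
  proof (rule Lim_null_comparison[OF always_eventually])
    show "\<forall>k. norm (t ^ k *\<^sub>R (T ^^ k) Y) \<le> norm ((T ^^ k) Y)"
      using assms by (auto intro!: mult_left_le_one_le power_le_one)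
    show "(\<lambda>k. norm ((T ^^ k) Y)) \<longlonglongrightarrow> 0" using assms by (auto simp: decays_def intro: tendsto_norm_zero)
  qed
  ultimately show ?thesis by (simp add: LIMSEQ_const_iff)
qed

lemma decays_solution_one:
  assumes "decays T"
  obtains X where "psd X" "X = T X + mat 1"
  using perron_alternative decays_no_eigenvector[OF assms] psd_sym by metis

lemma lyapunov_unique:
  assumes "decays T" "sym_mat X" "sym_mat Y" "X = T X + H" "Y = T Y + H"
  shows "X = Y"
proof -
  have "X - Y = T (X - Y)" using assms(4,5) by (metis T_diff add_diff_cancel_right)
  from decays_fixpoint_zero[OF assms(1) sym_mat_diff[OF assms(2,3)] this] show ?thesis by simp
qed

text \<open>The solution for the identity, multiplied by \<open>trace H\<close>, is a supersolution
  for \<open>H\<close>.\<close>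

private lemma lyapunov_psd_exists:
  assumes "decays T" "psd H"
  obtains X where "psd X" "X = T X + H"
proof -
  obtain X0 where X0: "psd X0" "X0 = T X0 + mat 1" by (rule decays_solution_one[OF assms(1)])
  define c where "c = trace H"
  have "c *\<^sub>R X0 = T (c *\<^sub>R X0) + c *\<^sub>R mat 1" using X0(2) by (metis T_scaleR scaleR_add_right)
  then have "c *\<^sub>R X0 - (T (c *\<^sub>R X0) + H) = c *\<^sub>R mat 1 - H"
    by (metis add_diff_cancel_left)
  then have "psd (c *\<^sub>R X0 - (T (c *\<^sub>R X0) + H))" using psd_le_trace[OF assms(2)] c_def by metis
  from psd_solution_below[OF pos assms(2) psd_scaleR[OF X0(1)] this] show thesis
    using that trace_psd_nonneg[OF assms(2)] by (metis c_def)
qed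

lemma lyapunov_exists:
  assumes "decays T" "sym_mat H"
  obtains X where "sym_mat X" "X = T X + H"
proof -
  obtain c where c: "0 \<le> c" "psd (c *\<^sub>R mat 1 + H)" using assms(2) by (rule sym_mat_bounded)
  obtain X1 where X1: "psd X1" "X1 = T X1 + (c *\<^sub>R mat 1 + H)"
    using lyapunov_psd_exists[OF assms(1) c(2)] .
  obtain X2 where X2: "psd X2" "X2 = T X2 + c *\<^sub>R mat 1"
    using lyapunov_psd_exists[OF assms(1) psd_scaleR[OF psd_one c(1)]] .
  show thesis
  proof (rule that)
    show "sym_mat (X1 - X2)" using X1 X2 by (simp add: sym_mat_diff psd_sym)
    have "X1 - X2 = (T X1 + (c *\<^sub>R mat 1 + H)) - (T X2 + c *\<^sub>R mat 1)" using X1(2) X2(2) by metis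
    also have "\<dots> = T (X1 - X2) + H" by (simp add: T_diff)
    finally show "X1 - X2 = T (X1 - X2) + H" .
  qed
qed

text \<open>The second conclusion is positivity of \<open>T X\<close>. It later shows that a cost
  exceeds the Riccati solution by at least the completed square.\<close>

lemma lyapunov_psd:
  assumes "decays T" "psd H" "sym_mat X" "X = T X + H"
  shows "psd X" "psd (X - H)"
proof -
  obtain Y where Y: "psd Y" "Y = T Y + H" using lyapunov_psd_exists[OF assms(1,2)] .
  have "X = Y" by (rule lyapunov_unique[OF assms(1,3) psd_sym[OF Y(1)] assms(4) Y(2)])
  then show "psd X" using Y by simp
  from psd_T[OF this] show "psd (X - H)" using assms(4) by (metis add_diff_cancel_right')
qed

text \<open>Failure of decay already produces a real eigenvalue \<open>1 / t \<ge> 1\<close> by the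
  Perron alternative. Conversely \<open>T\<close> multiplies \<open>X + i Y\<close> by
  \<open>c\<close>, so an entry of the orbit is \<open>c ^ k\<close> times a nonzero number and
  tends to zero only if \<open>cmod c < 1\<close>.\<close>

lemma spectrum_in_disc_iff_decays:
  "(\<forall>c\<in>op_spectrum {X. sym_mat X} T. cmod c < 1) \<longleftrightarrow> decays T"
proof
  assume sp: "\<forall>c\<in>op_spectrum {X. sym_mat X} T. cmod c < 1"
  show "decays T"
    using perron_alternative
  proof
    assume "\<exists>X. psd X \<and> X = T X + mat 1"
    then show ?thesis using decays_if_solution by blast
  next
    assume "\<exists>t Y. 0 < t \<and> t \<le> 1 \<and> psd Y \<and> Y \<noteq> 0 \<and> Y = t *\<^sub>R T Y"
    then obtain t Y where Y: "0 < t" "t \<le> 1" "psd Y" "Y \<noteq> 0" "Y = t *\<^sub>R T Y" by blast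
    have "(1 / t) *\<^sub>R Y = (1 / t) *\<^sub>R t *\<^sub>R T Y" using Y(5) by metis
    then have "T Y = (1 / t) *\<^sub>R Y" using Y(1) by simp
    then have "complex_of_real (1 / t) \<in> op_spectrum {X. sym_mat X} T"
      unfolding op_spectrum_def using Y(4) psd_sym[OF Y(3)]
      by (intro CollectI bexI[of _ Y] bexI[of _ 0]) (simp_all add: T_zero)
    then have "cmod (complex_of_real (1 / t)) < 1" using sp by blast
    then show ?thesis using Y by (simp add: norm_divide)
  qed
next
  assume dec: "decays T"
  show "\<forall>c\<in>op_spectrum {X. sym_mat X} T. cmod c < 1"
  proof
    fix c assume "c \<in> op_spectrum {X. sym_mat X} T"
    then obtain X Y where XY: "sym_mat X" "sym_mat Y" "X \<noteq> 0 \<or> Y \<noteq> 0"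
      and T: "T X = Re c *\<^sub>R X - Im c *\<^sub>R Y" "T Y = Im c *\<^sub>R X + Re c *\<^sub>R Y"
      unfolding op_spectrum_def by auto
    have P: "(T ^^ k) X = Re (c ^ k) *\<^sub>R X - Im (c ^ k) *\<^sub>R Y \<and>
             (T ^^ k) Y = Im (c ^ k) *\<^sub>R X + Re (c ^ k) *\<^sub>R Y" for k
    proof (induction k)
      case (Suc k)
      then have "(T ^^ Suc k) X = T (Re (c ^ k) *\<^sub>R X - Im (c ^ k) *\<^sub>R Y)"
        "(T ^^ Suc k) Y = T (Im (c ^ k) *\<^sub>R X + Re (c ^ k) *\<^sub>R Y)" by simp_all
      then show ?case by (simp add: T T_add T_diff T_scaleR) (simp add: algebra_simps)
    qed simp
    obtain i j where ij: "X $ i $ j \<noteq> 0 \<or> Y $ i $ j \<noteq> 0"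
      using XY(3) by (auto simp: vec_eq_iff)
    define w where "w = Complex (X $ i $ j) (Y $ i $ j)"
    have "Complex ((T ^^ k) X $ i $ j) ((T ^^ k) Y $ i $ j) = c ^ k * w" for k
      using P[of k] by (simp add: w_def complex_eq_iff)
    moreover have "(\<lambda>k. Complex ((T ^^ k) X $ i $ j) ((T ^^ k) Y $ i $ j)) \<longlonglongrightarrow> Complex ((0 :: real ^ 'k ^ 'k) $ i $ j) ((0 :: real ^ 'k ^ 'k) $ i $ j)"
      using dec XY by (intro tendsto_Complex tendsto_vec_nth) (auto simp: decays_def)
    ultimately have lim: "(\<lambda>k. cmod (c ^ k * w)) \<longlonglongrightarrow> 0"
      by (simp add: tendsto_norm_zero zero_complex.code[symmetric] Complex_eq_0)
    show "cmod c < 1"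
    proof (rule ccontr)
      assume "\<not> cmod c < 1"
      then have "cmod w \<le> cmod (c ^ k * w)" for k
        by (simp add: norm_mult norm_power mult_le_cancel_right1 one_le_power)
      then have "cmod w \<le> 0" using lim by (intro LIMSEQ_le_const[OF lim]) auto
      then show False using ij by (simp add: w_def complex_eq_iff)
    qed
  qed
qed

end

text \<open>Rectangular factors are allowed because the same shape, with \<open>openD1\<close>,
  \<open>openD2\<close>, \<open>openD3\<close>, carries matrices on the lifted states to matrices on
  the lifted pairs of state and control.\<close>

definition congr3 ::
  "real ^ 'b ^ 'a \<Rightarrow> real ^ 'b ^ 'a \<Rightarrow> real ^ 'b ^ 'a \<Rightarrow> real ^ 'a ^ 'a \<Rightarrow> real ^ 'b ^ 'b" where
  "congr3 A B C X = transpose A ** X ** A + transpose B ** X ** B + transpose C ** X ** C"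

abbreviation "congr3_adj A B C \<equiv> congr3 (transpose A) (transpose B) (transpose C)"

lemma congr3_psd: "psd X \<Longrightarrow> psd (congr3 A B C X)"
  by (simp add: congr3_def psd_add psd_congruence)

lemma congr3_sym: "sym_mat X \<Longrightarrow> sym_mat (congr3 A B C X)"
  by (simp add: congr3_def sym_mat_add sym_mat_congruence)

lemma linear_congr3: "linear (congr3 A B C)"
  by (rule linearI) (simp_all add: congr3_def matrix_algebra scaleR_add_right)

lemma positive_congr3: "positive_op (congr3 A B C)"
  by (simp add: positive_op_def linear_congr3 congr3_psd)

text \<open>Cyclicity of the trace moves each factor across. This exchanges the propagation of costs
  for the propagation of moments.\<close>

lemma trace_congr3:
  fixes A B C :: "real ^ 'b ^ 'a"
  shows "trace (Y ** congr3 A B C X) = trace (congr3_adj A B C Y ** X)"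
proof -
  have *: "trace (Y ** (transpose D ** X ** D)) = trace (D ** Y ** transpose D ** X)"
    for D :: "real ^ 'b ^ 'a"
    by (metis matrix_mul_assoc trace_mul_sym)
  show ?thesis
    by (simp add: congr3_def matrix_add_ldistrib matrix_add_rdistrib trace_add *)
qed

lemma trace_congr3_funpow:
  fixes A B C :: "real ^ 'k ^ 'k"
  shows "trace (Y ** (congr3 A B C ^^ k) X) = trace ((congr3_adj A B C ^^ k) Y ** X)"
  by (induction k arbitrary: X) (simp_all add: trace_congr3 funpow_swap1)

text \<open>By adjointness the powers of both operators have the same trace at the identity, and
  that trace alone decides decay.\<close>

lemma decays_congr3_adj:
  fixes A B C :: "real ^ 'k ^ 'k"
  assumes "decays (congr3 A B C)"
  shows "decays (congr3_adj A B C)"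
proof (rule decaysI[OF positive_congr3])
  have "trace ((congr3_adj A B C ^^ k) (mat 1)) = trace ((congr3 A B C ^^ k) (mat 1))" for k
    using trace_congr3_funpow[of "mat 1" k A B C "mat 1"] by simp
  moreover have "(\<lambda>k. trace ((congr3 A B C ^^ k) (mat 1))) \<longlonglongrightarrow> trace (0 :: real ^ 'k ^ 'k)"
    using assms by (intro tendsto_trace) (simp add: decays_def)
  ultimately show "(\<lambda>k. trace ((congr3_adj A B C ^^ k) (mat 1))) \<longlonglongrightarrow> 0" by simp
qed

text \<open>Both sides equal \<open>trace (Y ** X)\<close> minus the pairing of \<open>Y\<close>
  with \<open>congr3 A B C X\<close>. This is why the two primal problems assign the same value to
  the same gains.\<close>

lemma lyapunov_duality:
  fixes A B C :: "real ^ 'k ^ 'k"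
  assumes "X = congr3 A B C X + H" "Y = congr3_adj A B C Y + S"
  shows "trace (H ** Y) = trace (S ** X)"
proof -
  have "trace (Y ** X) = trace (Y ** congr3 A B C X) + trace (Y ** H)"
    using assms(1) by (metis matrix_add_ldistrib trace_add)
  moreover have "trace (Y ** X) = trace (congr3_adj A B C Y ** X) + trace (S ** X)"
    using assms(2) by (metis matrix_add_rdistrib trace_add)
  ultimately show ?thesis by (simp add: trace_congr3 trace_mul_sym[of H])
qed

section \<open>Existence of Riccati solutions by value iteration\<close>

lemma posdef_invertible:
  assumes "posdef (U :: real ^ 'k ^ 'k)"
  shows "U ** matrix_inv U = mat 1" "matrix_inv U ** U = mat 1"
    "transpose (matrix_inv U) = matrix_inv U"
proof -
  have "x = 0" if "U *v x = 0" for x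
    using posdef_quad[OF assms, of x] that by force
  then obtain V where V: "V ** U = mat 1"
    using matrix_left_invertible_ker by blast
  then have "U ** V = mat 1" using matrix_left_right_inverse by blast
  with V have "invertible U" by (auto simp: invertible_def)
  then have "\<exists>V. U ** V = mat 1 \<and> V ** U = mat 1" by (simp add: invertible_def)
  from someI_ex[OF this] show inv: "U ** matrix_inv U = mat 1" "matrix_inv U ** U = mat 1"
    by (simp_all add: matrix_inv_def)
  have "transpose (matrix_inv U) ** transpose U = mat 1"
    using arg_cong[OF inv(1), of transpose] by (simp add: matrix_transpose_mul)
  then have "transpose (matrix_inv U) ** U = mat 1"
    using posdef_sym[OF assms] by (simp add: sym_mat_def)
  then show "transpose (matrix_inv U) = matrix_inv U"
    using inv by (metis matrix_mul_assoc matrix_mul_lid matrix_mul_rid)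
qed

lemma trace_transpose_mult: "trace (transpose D ** G) = D \<bullet> (G :: real ^ 'b ^ 'a)"
proof -
  have "trace (transpose D ** G) = (\<Sum>j\<in>UNIV. \<Sum>i\<in>UNIV. D $ i $ j * G $ i $ j)"
    by (simp add: trace_def matrix_matrix_mult_def transpose_def)
  also have "\<dots> = (\<Sum>i\<in>UNIV. \<Sum>j\<in>UNIV. D $ i $ j * G $ i $ j)" by (rule sum.swap)
  finally show ?thesis by (simp add: inner_vec_def)
qed

text \<open>The common form of the two Riccati equations of the mean-field problem: the second one is of
  this form once the solution of the first has been substituted into it.\<close>

locale riccati_data =
  fixes Q :: "real ^ 'n ^ 'n" and L :: "real ^ 'n ^ 'm" and R :: "real ^ 'm ^ 'm"
    and A1 A2 :: "real ^ 'n ^ 'n" and B1 B2 :: "real ^ 'm ^ 'n"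
  assumes Rpos: "posdef R"
    and cost_psd: "\<And>F. psd (Q + transpose F ** L + transpose L ** F + transpose F ** R ** F)"
begin

definition "U X = R + transpose B1 ** X ** B1 + transpose B2 ** X ** B2"
definition "N X = L + transpose B1 ** X ** A1 + transpose B2 ** X ** A2"
definition "ly F X = Q + transpose F ** L + transpose L ** F + transpose F ** R ** F
  + transpose (A1 + B1 ** F) ** X ** (A1 + B1 ** F)
  + transpose (A2 + B2 ** F) ** X ** (A2 + B2 ** F)"
definition "gain X = - (matrix_inv (U X) ** N X)"
definition "ric X = Q + transpose A1 ** X ** A1 + transpose A2 ** X ** A2
  - transpose (N X) ** matrix_inv (U X) ** N X"

lemma U_posdef: "psd X \<Longrightarrow> posdef (U X)"
  unfolding U_def by (intro posdef_add Rpos psd_congruence)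

lemma U_gain: "psd X \<Longrightarrow> U X ** gain X = - N X"
  by (simp add: gain_def matrix_minus_right matrix_mul_assoc posdef_invertible[OF U_posdef])

text \<open>Since \<open>U X\<close> is positive definite, the identity exhibits
  \<open>ric X\<close> as the least value of \<open>ly F X\<close> over all \<open>F\<close>,
  attained at \<open>gain X\<close>. Monotonicity of \<open>ric\<close>, comparison with Lyapunov
  supersolutions and uniqueness of the optimal gains rest on it.\<close>

lemma complete_square:
  assumes "psd X"
  shows "ly F X = ric X + transpose (F - gain X) ** U X ** (F - gain X)"
proof -
  define V where "V = matrix_inv (U X)"
  have V: "V ** U X = mat 1" "U X ** V = mat 1" "transpose V = V"
    using posdef_invertible[OF U_posdef[OF assms]] by (simp_all add: V_def)
  have VU: "Z ** V ** U X = Z" "Z ** U X ** V = Z" for Z :: "real ^ 'm ^ 'n"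
    by (simp_all add: V matrix_mul_assoc[symmetric])
  have Xt: "transpose X = X" using psd_sym[OF assms] by (simp add: sym_mat_def)
  have "transpose (F - gain X) ** U X ** (F - gain X)
      = transpose F ** U X ** F + transpose F ** N X + transpose (N X) ** F
        + transpose (N X) ** V ** N X"
    by (simp add: gain_def V_def[symmetric] matrix_algebra VU V)
  moreover have "ly F X = Q + transpose A1 ** X ** A1 + transpose A2 ** X ** A2
      + (transpose F ** U X ** F + transpose F ** N X + transpose (N X) ** F)"
    by (simp add: ly_def U_def N_def matrix_algebra Xt)
  ultimately show ?thesis by (simp add: ric_def V_def)
qed

lemma ly_gain: "psd X \<Longrightarrow> ly (gain X) X = ric X"
  using complete_square[of X "gain X"] by simp

lemma psd_ly: "psd X \<Longrightarrow> psd (ly F X)"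
  unfolding ly_def by (intro psd_add cost_psd psd_congruence)

lemma psd_ric: "psd X \<Longrightarrow> psd (ric X)"
  using psd_ly ly_gain by metis

lemma ly_diff: "ly F Y - ly F X = transpose (A1 + B1 ** F) ** (Y - X) ** (A1 + B1 ** F)
    + transpose (A2 + B2 ** F) ** (Y - X) ** (A2 + B2 ** F)"
  by (simp add: ly_def matrix_sub_ldistrib matrix_sub_rdistrib)

lemma ly_mono: "psd (Y - X) \<Longrightarrow> psd (ly F Y - ly F X)"
  unfolding ly_diff by (intro psd_add psd_congruence)

lemma ric_le_ly: "psd X \<Longrightarrow> psd (ly F X - ric X)"
  using psd_congruence[OF posdef_imp_psd[OF U_posdef], of X "F - gain X"]
  by (simp add: complete_square)

text \<open>The gain optimal for the larger argument serves both:
  \<open>ric Y = ly (gain Y) Y\<close> dominates \<open>ly (gain Y) X\<close>, which dominates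
  \<open>ric X\<close>.\<close>

lemma ric_mono: "psd X \<Longrightarrow> psd Y \<Longrightarrow> psd (Y - X) \<Longrightarrow> psd (ric Y - ric X)"
  using psd_trans[OF ly_mono[of Y X "gain Y"] ric_le_ly[of X "gain Y"]] by (simp add: ly_gain)

lemma tendsto_ly: "(X \<longlongrightarrow> P) W \<Longrightarrow> ((\<lambda>k. ly F (X k)) \<longlongrightarrow> ly F P) W"
  unfolding ly_def by (intro tendsto_intros tendsto_matrix_mult)

text \<open>A supersolution \<open>B\<close> for a single feedback caps the value iteration started
  at zero. The limit is identified as a fixed point by showing that the gains converge, in place of
  continuity of the matrix inverse.\<close>

lemma ric_fixpoint_exists:
  assumes B: "psd B" "psd (B - ly F B)"
  obtains P where "psd P" "P = ric P" "psd (B - P)"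
proof -
  define Y where "Y k = (ric ^^ k) 0" for k
  have YS: "Y (Suc k) = ric (Y k)" for k by (simp add: Y_def)
  have Y0: "Y 0 = 0" by (simp add: Y_def)
  have Y: "psd (Y k)" for k by (induction k) (simp_all add: Y0 YS psd_ric)
  have inc: "psd (Y (Suc k) - Y k)" for k
  proof (induction k)
    case 0 then show ?case using Y[of 1] by (simp add: Y0)
  next
    case (Suc k)
    from ric_mono[OF Y Y this] show ?case by (simp add: YS)
  qed
  have bnd: "psd (B - Y k)" for k
  proof (induction k)
    case 0 then show ?case using B by (simp add: Y0)
  next
    case (Suc k)
    from psd_trans[OF psd_trans[OF B(2) ly_mono[OF this]] ric_le_ly[OF Y]] show ?case by (simp add: YS)
  qed
  obtain P where P: "Y \<longlonglongrightarrow> P" "psd (B - P)"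
    using psd_monotone_convergence[of Y B] inc bnd by metis
  have psdP: "psd P" by (rule psd_limit[OF P(1) Y])
  define D where "D k = gain P - gain (Y k)" for k
  \<comment> \<open>For the fixed gain of the limit, \<open>G k\<close> is affine in
    \<open>Y k\<close>, hence tends to \<open>U P ** gain P + N P = 0\<close>. Since
    \<open>U (Y k)\<close> is at least \<open>e\<close> times the identity, uniformly in
    \<open>k\<close>, the gain error \<open>D k\<close> tends to zero with it.\<close>
  define G where "G k = U (Y k) ** D k" for k
  have "G = (\<lambda>k. U (Y k) ** gain P + N (Y k))"
    by (simp add: fun_eq_iff G_def D_def matrix_sub_ldistrib U_gain[OF Y])
  moreover have "(\<lambda>k. U (Y k) ** gain P + N (Y k)) \<longlonglongrightarrow> U P ** gain P + N P"
    unfolding U_def N_def by (intro tendsto_intros tendsto_matrix_mult P)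
  ultimately have G0: "G \<longlonglongrightarrow> 0" by (simp add: U_gain[OF psdP])
  obtain e where e: "e > 0" "psd (R - e *\<^sub>R mat 1)" using posdef_bounds_identity[OF Rpos] .
  have DG: "norm (D k) \<le> norm (G k) / e" for k
  proof -
    have "psd (U (Y k) - e *\<^sub>R mat 1)"
      using psd_add[OF psd_add[OF e(2) psd_congruence[OF Y[of k], of B1]] psd_congruence[OF Y[of k], of B2]]
      by (simp add: U_def algebra_simps)
    from trace_psd_nonneg[OF psd_congruence[OF this, of "D k"]]
    have "0 \<le> trace (transpose (D k) ** (U (Y k) - e *\<^sub>R mat 1) ** D k)" .
    also have "transpose (D k) ** (U (Y k) - e *\<^sub>R mat 1) ** D k
        = transpose (D k) ** G k - e *\<^sub>R (transpose (D k) ** D k)"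
      by (simp add: G_def matrix_algebra)
    finally have "e * (D k \<bullet> D k) \<le> D k \<bullet> G k"
      by (simp add: trace_sub trace_scaleR trace_transpose_mult)
    also have "\<dots> \<le> norm (D k) * norm (G k)" by (rule norm_cauchy_schwarz)
    finally have *: "norm (D k) * (e * norm (D k)) \<le> norm (D k) * norm (G k)"
      unfolding dot_square_norm power2_eq_square by (simp only: mult_ac)
    have "e * norm (D k) \<le> norm (G k)"
    proof (cases "D k = 0")
      case False
      then show ?thesis using * mult_le_cancel_left_pos[of "norm (D k)"] by simp
    qed simp
    then show ?thesis using e(1) by (simp add: pos_le_divide_eq mult.commute)
  qed
  have D0: "D \<longlonglongrightarrow> 0"
    by (rule Lim_null_comparison[OF always_eventually, OF allI, OF DG])
      (use tendsto_divide_zero[OF tendsto_norm_zero[OF G0]] in simp)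
  \<comment> \<open>The excess of the fixed feedback \<open>gain P\<close> over the optimal one at
    \<open>Y k\<close> vanishes in the limit, and \<open>ly\<close> with a fixed feedback is
    continuous, so \<open>P\<close> is a fixed point of \<open>ly (gain P)\<close>.\<close>
  have "ly (gain P) (Y k) = Y (Suc k) + transpose (D k) ** G k" for k
    by (simp add: complete_square[OF Y] YS D_def G_def matrix_mul_assoc)
  moreover have "(\<lambda>k. Y (Suc k) + transpose (D k) ** G k) \<longlonglongrightarrow> P + 0"
    using tendsto_add[OF LIMSEQ_Suc[OF P(1)] tendsto_matrix_mult[OF tendsto_transpose[OF D0] G0]]
    by simp
  ultimately have "(\<lambda>k. ly (gain P) (Y k)) \<longlonglongrightarrow> P" by simp
  then have "ly (gain P) P = P" using tendsto_ly[OF P(1)] LIMSEQ_unique by blast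
  then have "P = ric P" using ly_gain[OF psdP] by simp
  then show thesis using that psdP P by blast
qed

end

section \<open>Block matrices\<close>

lemma sum_UNIV_sum:
  "(\<Sum>i\<in>(UNIV :: ('p::finite + 'q::finite) set). f i) = (\<Sum>a\<in>UNIV. f (Inl a)) + (\<Sum>b\<in>UNIV. f (Inr b))"
  using sum.Plus[of UNIV UNIV f] by simp

lemma vstack_nth [simp]: "vstack x y $ Inl a = x $ a" "vstack x y $ Inr b = y $ b"
  by (simp_all add: vstack_def)

lemma hstack_nth [simp]: "hstack X Y $ i $ Inl a = X $ i $ a" "hstack X Y $ i $ Inr b = Y $ i $ b"
  by (simp_all add: hstack_def)

lemma vec_eq_sum_iff:
  "x = y \<longleftrightarrow> (\<forall>a. x $ Inl a = y $ Inl a) \<and> (\<forall>b. x $ Inr b = y $ Inr b)"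
  for x y :: "'e ^ ('p::finite + 'q::finite)"
  by (metis vec_eq_iff sum.exhaust)

lemma columns_eq_sum_iff:
  fixes X Y :: "real ^ ('c::finite + 'd::finite) ^ 'p"
  shows "X = Y \<longleftrightarrow> (\<forall>i. (\<forall>a. X $ i $ Inl a = Y $ i $ Inl a) \<and> (\<forall>b. X $ i $ Inr b = Y $ i $ Inr b))"
  by (simp add: vec_eq_iff[of X Y] vec_eq_sum_iff)

lemma vec_sum_cases:
  fixes v :: "'e ^ ('p::finite + 'q::finite)"
  obtains x y where "v = vstack x y"
proof -
  have "v = vstack (\<chi> a. v $ Inl a) (\<chi> b. v $ Inr b)" by (simp add: vec_eq_sum_iff)
  then show thesis by (rule that)
qed

lemma vstack_zero [simp]: "vstack 0 0 = 0"
  by (simp add: vec_eq_sum_iff)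

lemma vstack_inner: "vstack x y \<bullet> vstack x' y' = x \<bullet> x' + y \<bullet> (y' :: real ^ 'q)"
  by (simp add: inner_vec_def sum_UNIV_sum)

lemma blk_nth [simp]:
  "blk A B C D $ Inl i $ Inl j = A $ i $ j" "blk A B C D $ Inl i $ Inr l = B $ i $ l"
  "blk A B C D $ Inr k $ Inl j = C $ k $ j" "blk A B C D $ Inr k $ Inr l = D $ k $ l"
  by (simp_all add: blk_def)

lemma blk_eqI:
  fixes X Y :: "real ^ ('c::finite + 'd::finite) ^ ('p::finite + 'q::finite)"
  assumes "\<And>i j. X $ Inl i $ Inl j = Y $ Inl i $ Inl j" "\<And>i j. X $ Inl i $ Inr j = Y $ Inl i $ Inr j"
    "\<And>i j. X $ Inr i $ Inl j = Y $ Inr i $ Inl j" "\<And>i j. X $ Inr i $ Inr j = Y $ Inr i $ Inr j"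
  shows "X = Y"
  using assms by (simp add: vec_eq_sum_iff)

lemma blk_eq_iff: "blk A B C D = blk A' B' C' D' \<longleftrightarrow> A = A' \<and> B = B' \<and> C = C' \<and> D = D'"
  by (auto simp: vec_eq_sum_iff) (simp_all add: vec_eq_iff)

lemma blk_cases:
  fixes X :: "real ^ ('c::finite + 'd::finite) ^ ('p::finite + 'q::finite)"
  obtains A B C D where "X = blk A B C D"
proof -
  have "X = blk (\<chi> i j. X $ Inl i $ Inl j) (\<chi> i j. X $ Inl i $ Inr j)
    (\<chi> i j. X $ Inr i $ Inl j) (\<chi> i j. X $ Inr i $ Inr j)" by (rule blk_eqI) simp_all
  then show thesis by (rule that)
qed

lemma blk_zero [simp]: "blk 0 0 0 0 = 0"
  by (rule blk_eqI) simp_all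

lemma blk_add: "blk A B C D + blk A' B' C' D' = blk (A + A') (B + B') (C + C') (D + D')"
  by (rule blk_eqI) simp_all

lemma blk_diff: "blk A B C D - blk A' B' C' D' = blk (A - A') (B - B') (C - C') (D - D')"
  by (rule blk_eqI) simp_all

lemma blk_scaleR: "c *\<^sub>R blk A B C D = blk (c *\<^sub>R A) (c *\<^sub>R B) (c *\<^sub>R C) (c *\<^sub>R D)"
  by (rule blk_eqI) simp_all

lemma blk_transpose: "transpose (blk A B C D) = blk (transpose A) (transpose C) (transpose B) (transpose D)"
  by (rule blk_eqI) (simp_all add: transpose_def)

lemma blk_mult:
  "blk A B C D ** blk E F G H = blk (A ** E + B ** G) (A ** F + B ** H) (C ** E + D ** G) (C ** F + D ** H)"
  by (rule blk_eqI) (simp_all add: matrix_matrix_mult_def sum_UNIV_sum)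

lemma trace_blk: "trace (blk A B C D) = trace A + trace D"
  by (simp add: trace_def sum_UNIV_sum)

lemma blk_mult_vstack: "blk A B C D *v vstack x y = vstack (A *v x + B *v y) (C *v x + D *v y)"
  by (simp add: vec_eq_sum_iff matrix_vector_mult_def sum_UNIV_sum)

lemma transpose_vstack: "transpose (vstack A B) = hstack (transpose A) (transpose B)"
  by (simp add: columns_eq_sum_iff) (simp add: transpose_def)

lemma vstack_mult: "vstack A B ** C = vstack (A ** C) (B ** (C :: real ^ 'c ^ 'b))"
  by (simp add: vec_eq_sum_iff matrix_matrix_mult_def)

lemma vstack_mult_hstack:
  "vstack A B ** hstack C D = blk (A ** C) (A ** D) (B ** C) (B ** (D :: real ^ 'c ^ 'b))"
  by (rule blk_eqI) (simp_all add: matrix_matrix_mult_def)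

lemma hstack_mult_vstack: "hstack A B ** vstack C D = A ** C + B ** (D :: real ^ 'c ^ 'b)"
  by (simp add: vec_eq_iff matrix_matrix_mult_def sum_UNIV_sum)

lemma hstack_mult_blk:
  "hstack A B ** blk C D E F = hstack (A ** C + B ** E) (A ** D + B ** F)"
  by (simp add: columns_eq_sum_iff matrix_matrix_mult_def sum_UNIV_sum)

lemma mult_hstack: "C ** hstack A B = hstack (C ** A) (C ** (B :: real ^ 'b ^ 'c))"
  by (simp add: columns_eq_sum_iff matrix_matrix_mult_def)

lemma blk_mult_vstack_mat:
  "blk A B C D ** vstack E F = vstack (A ** E + B ** F) (C ** E + D ** (F :: real ^ 'b ^ 'c))"
  by (simp add: vec_eq_sum_iff matrix_matrix_mult_def sum_UNIV_sum) (simp add: vec_eq_iff)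

lemma hstack_vstack_blk: "hstack (vstack A C) (vstack B D) = blk A B C D"
  by (rule blk_eqI) simp_all

lemma hstack_zero [simp]: "hstack 0 0 = 0"
  by (simp add: columns_eq_sum_iff)

lemmas block_simps = blk_mult blk_add blk_diff blk_scaleR blk_transpose trace_blk blk_eq_iff vstack_mult
  vstack_mult_hstack hstack_mult_vstack hstack_mult_blk transpose_vstack
  mult_hstack blk_mult_vstack_mat blk_def[symmetric] hstack_vstack_blk

lemma sym_mat_bdiag: "sym_mat (bdiag A B) \<longleftrightarrow> sym_mat A \<and> sym_mat B"
  by (simp add: sym_mat_def bdiag_def block_simps)

lemma quad_bdiag: "vstack x y \<bullet> (bdiag A B *v vstack x y) = x \<bullet> (A *v x) + y \<bullet> (B *v y)"
  by (simp add: bdiag_def blk_mult_vstack vstack_inner)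

lemma psd_bdiag: "psd A \<Longrightarrow> psd B \<Longrightarrow> psd (bdiag A B)"
proof -
  assume "psd A" "psd B"
  then have "0 \<le> v \<bullet> (bdiag A B *v v)" for v
    by (cases v rule: vec_sum_cases) (simp add: quad_bdiag psd_quad)
  with \<open>psd A\<close> \<open>psd B\<close> show ?thesis by (simp add: psd_def sym_mat_bdiag)
qed

lemma posdef_bdiag: "posdef A \<Longrightarrow> posdef B \<Longrightarrow> posdef (bdiag A B)"
proof -
  assume AB: "posdef A" "posdef B"
  have "0 < v \<bullet> (bdiag A B *v v)" if "v \<noteq> 0" for v
  proof (cases v rule: vec_sum_cases)
    case (1 x y)
    then have "x \<noteq> 0 \<or> y \<noteq> 0" using that by auto
    then show ?thesis
      unfolding 1 quad_bdiag using posdef_quad[OF AB(1), of x] posdef_quad[OF AB(2), of y]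
        psd_quad[OF posdef_imp_psd[OF AB(1)], of x] psd_quad[OF posdef_imp_psd[OF AB(2)], of y]
      by linarith
  qed
  with AB show ?thesis by (simp add: posdef_def sym_mat_bdiag)
qed

lemma psd_blkD:
  assumes "psd (blk A B C D)"
  shows "psd A" "psd D"
proof -
  have s: "sym_mat A" "sym_mat D"
    using psd_sym[OF assms] by (simp_all add: sym_mat_def block_simps)
  have "0 \<le> x \<bullet> (A *v x)" for x
    using psd_quad[OF assms, of "vstack x 0"] by (simp add: blk_mult_vstack vstack_inner)
  with s show "psd A" by (simp add: psd_def)
  have "0 \<le> x \<bullet> (D *v x)" for x
    using psd_quad[OF assms, of "vstack 0 x"] by (simp add: blk_mult_vstack vstack_inner)
  with s show "psd D" by (simp add: psd_def)
qed

section \<open>The lifted mean-field system\<close>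

text \<open>All augmented matrices factor through the gain matrix \<open>gainM\<close>, and the matrices of the closed
  loop are the same factors multiplied in the other order. This reduces both primal problems to
  Lyapunov equations on the lifted state space.\<close>

definition gainM :: "real ^ 'n ^ 'm \<Rightarrow> real ^ 'n ^ 'm \<Rightarrow> real ^ ('n + 'n) ^ (('n + 'm) + ('n + 'm))" where
  "gainM F Fb = bdiag (vstack (mat 1) (F + Fb)) (vstack (mat 1) F)"

definition openD1 :: "('n::finite, 'm::finite) mf_system \<Rightarrow> real ^ (('n + 'm) + ('n + 'm)) ^ ('n + 'n)" where
  "openD1 s = bdiag (hstack (hatA1 s) (hatB1 s)) (hstack (mfA1 s) (mfB1 s))"

definition openD2 :: "('n::finite, 'm::finite) mf_system \<Rightarrow> real ^ (('n + 'm) + ('n + 'm)) ^ ('n + 'n)" where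
  "openD2 s = bdiag 0 (hstack (mfA2 s) (mfB2 s))"

definition openD3 :: "('n::finite, 'm::finite) mf_system \<Rightarrow> real ^ (('n + 'm) + ('n + 'm)) ^ ('n + 'n)" where
  "openD3 s = blk 0 0 (hstack (hatA2 s) (hatB2 s)) 0"

text \<open>The augmented matrices apply the feedback after the dynamics, the closed loop applies it
  before. Hence \<open>augA3\<close> carries \<open>F\<close>, from the rows of the centred part,
  whereas \<open>calA3\<close> carries \<open>F + Fb\<close>, from the columns of the mean.\<close>

lemma aug_factor:
  "augA1 s F Fb = gainM F Fb ** openD1 s"
  "augA2 s F = gainM F Fb ** openD2 s"
  "augA3 s F = gainM F Fb ** openD3 s"
  by (simp_all add: augA1_def augA2_def augA3_def gainM_def openD1_def openD2_def openD3_def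
      bdiag_def block_simps)

lemma cal_factor:
  "calA1 s F Fb = openD1 s ** gainM F Fb"
  "calA2 s F = openD2 s ** gainM F Fb"
  "calA3 s F Fb = openD3 s ** gainM F Fb"
  by (simp_all add: calA1_def calA2_def calA3_def gainM_def openD1_def openD2_def openD3_def
      bdiag_def block_simps)

lemma init_term_factor:
  "init_term Z1 Z2 F Fb = gainM F Fb ** bdiag Z2 (Z1 - Z2) ** transpose (gainM F Fb)"
proof -
  define V1 where "V1 = (vstack (mat 1) 0 :: real ^ 'a ^ ('a + 'a))"
  define V2 where "V2 = (vstack 0 (mat 1) :: real ^ 'a ^ ('a + 'a))"
  have "augF1 F Fb = gainM F Fb ** V1" "augF2 F = gainM F Fb ** V2"
    by (simp_all add: augF1_def augF2_def gainM_def V1_def V2_def bdiag_def block_simps)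
  then have "init_term Z1 Z2 F Fb
      = gainM F Fb ** (V1 ** Z2 ** transpose V1 + V2 ** (Z1 - Z2) ** transpose V2) ** transpose (gainM F Fb)"
    by (simp add: init_term_def matrix_algebra)
  moreover have "V1 ** Z2 ** transpose V1 + V2 ** (Z1 - Z2) ** transpose V2 = bdiag Z2 (Z1 - Z2)"
  proof -
    have "V1 ** Z2 = vstack Z2 0" "V2 ** (Z1 - Z2) = vstack 0 (Z1 - Z2)"
      by (simp_all add: V1_def V2_def vstack_mult)
    then show ?thesis
      by (simp add: V1_def V2_def bdiag_def vstack_mult_hstack transpose_vstack blk_add)
  qed
  ultimately show ?thesis by simp
qed

definition closed_weight ::
  "('n::finite, 'm::finite) mf_system \<Rightarrow> real ^ 'n ^ 'm \<Rightarrow> real ^ 'n ^ 'm \<Rightarrow> real ^ ('n + 'n) ^ ('n + 'n)" where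
  "closed_weight s F Fb = bdiag (hatQ s + transpose (F + Fb) ** hatR s ** (F + Fb))
     (mfQ s + transpose F ** mfR s ** F)"

lemma weight_factor:
  "transpose (gainM F Fb) ** weight s ** gainM F Fb = closed_weight s F Fb"
  by (simp add: closed_weight_def weight_def Lam_def Lamb_def gainM_def bdiag_def block_simps
      hatQ_def hatR_def matrix_mul_assoc)

abbreviation mf_op where
  "mf_op s F Fb \<equiv> congr3 (calA1 s F Fb) (calA2 s F) (calA3 s F Fb)"

abbreviation mf_adj where
  "mf_adj s F Fb \<equiv> congr3_adj (calA1 s F Fb) (calA2 s F) (calA3 s F Fb)"

lemma stab_gains_iff: "(F, Fb) \<in> stab_gains s \<longleftrightarrow> decays (mf_op s F Fb)"
  unfolding stab_gains_def spectrum_in_disc_iff_decays[OF positive_congr3, symmetric]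
  unfolding congr3_def[abs_def] by simp

lemma mf_op_bdiag:
  "mf_op s F Fb (bdiag Pb P) = bdiag
    (transpose (hatA1 s + hatB1 s ** (F + Fb)) ** Pb ** (hatA1 s + hatB1 s ** (F + Fb))
      + transpose (hatA2 s + hatB2 s ** (F + Fb)) ** P ** (hatA2 s + hatB2 s ** (F + Fb)))
    (transpose (mfA1 s + mfB1 s ** F) ** P ** (mfA1 s + mfB1 s ** F)
      + transpose (mfA2 s + mfB2 s ** F) ** P ** (mfA2 s + mfB2 s ** F))"
  by (simp add: congr3_def calA1_def calA2_def calA3_def bdiag_def block_simps)

text \<open>The diagonal blocks of the image depend only on the diagonal blocks of the argument, so
  the off-diagonal blocks of an eigenvector can be discarded and need no name.\<close>

lemma mf_adj_blk:
  "\<exists>B' C'. mf_adj s F Fb (blk M B C V) = blk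
    ((hatA1 s + hatB1 s ** (F + Fb)) ** M ** transpose (hatA1 s + hatB1 s ** (F + Fb))) B' C'
    ((mfA1 s + mfB1 s ** F) ** V ** transpose (mfA1 s + mfB1 s ** F)
      + (mfA2 s + mfB2 s ** F) ** V ** transpose (mfA2 s + mfB2 s ** F)
      + (hatA2 s + hatB2 s ** (F + Fb)) ** M ** transpose (hatA2 s + hatB2 s ** (F + Fb)))"
  by (simp add: congr3_def calA1_def calA2_def calA3_def block_simps)

text \<open>This is the recursion of the closed loop with \<open>M\<close> the outer square of the
  mean and \<open>V\<close> the covariance; the last summand is the noise feeding the mean into the
  covariance.\<close>

lemma mf_adj_bdiag:
  "mf_adj s F Fb (bdiag M V) = bdiag
    ((hatA1 s + hatB1 s ** (F + Fb)) ** M ** transpose (hatA1 s + hatB1 s ** (F + Fb)))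
    ((mfA1 s + mfB1 s ** F) ** V ** transpose (mfA1 s + mfB1 s ** F)
      + (mfA2 s + mfB2 s ** F) ** V ** transpose (mfA2 s + mfB2 s ** F)
      + (hatA2 s + hatB2 s ** (F + Fb)) ** M ** transpose (hatA2 s + hatB2 s ** (F + Fb)))"
  by (simp add: congr3_def calA1_def calA2_def calA3_def bdiag_def block_simps)

lemma mf_op_blk:
  "\<exists>B' C'. mf_op s F Fb (blk Pb B C P) = blk
    (transpose (hatA1 s + hatB1 s ** (F + Fb)) ** Pb ** (hatA1 s + hatB1 s ** (F + Fb))
      + transpose (hatA2 s + hatB2 s ** (F + Fb)) ** P ** (hatA2 s + hatB2 s ** (F + Fb))) B' C'
    (transpose (mfA1 s + mfB1 s ** F) ** P ** (mfA1 s + mfB1 s ** F)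
      + transpose (mfA2 s + mfB2 s ** F) ** P ** (mfA2 s + mfB2 s ** F))"
  by (simp add: congr3_def calA1_def calA2_def calA3_def block_simps)

lemma trace_bdiag_mult: "trace (bdiag A B ** bdiag C D) = trace (A ** C) + trace (B ** D)"
  by (simp add: bdiag_def block_simps)

section \<open>Reduction of the primal problems\<close>

definition cost_mat where
  "cost_mat s F Fb = (THE X. sym_mat X \<and> X = mf_op s F Fb X + closed_weight s F Fb)"

definition state_mat where
  "state_mat s Z F Fb = (THE Y. sym_mat Y \<and> Y = mf_adj s F Fb Y + Z)"

lemma lyapunov_the:
  assumes "positive_op T" "decays T" "sym_mat H"
  shows "sym_mat (THE X. sym_mat X \<and> X = T X + H)"
    "(THE X. sym_mat X \<and> X = T X + H) = T (THE X. sym_mat X \<and> X = T X + H) + H"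
    "\<And>Y. sym_mat Y \<Longrightarrow> Y = T Y + H \<Longrightarrow> Y = (THE X. sym_mat X \<and> X = T X + H)"
proof -
  obtain X where X: "sym_mat X" "X = T X + H" by (rule lyapunov_exists[OF assms])
  have ex: "\<exists>!X. sym_mat X \<and> X = T X + H"
  proof (rule ex1I)
    show "sym_mat X \<and> X = T X + H" using X by blast
    show "Y = X" if "sym_mat Y \<and> Y = T Y + H" for Y
      by (rule lyapunov_unique[OF assms(1,2)]) (use that X in blast)+
  qed
  show "sym_mat (THE X. sym_mat X \<and> X = T X + H)"
    "(THE X. sym_mat X \<and> X = T X + H) = T (THE X. sym_mat X \<and> X = T X + H) + H"
    using theI'[OF ex] by blast+
  show "\<And>Y. sym_mat Y \<Longrightarrow> Y = T Y + H \<Longrightarrow> Y = (THE X. sym_mat X \<and> X = T X + H)"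
    using the1_equality[OF ex, symmetric] by blast
qed

context
  fixes s :: "('n::finite, 'm::finite) mf_system"
  assumes sym: "sym_mat (mfQ s)" "sym_mat (mfQb s)" "sym_mat (mfR s)" "sym_mat (mfRb s)"
begin

lemma sym_weight: "sym_mat (weight s)"
  using sym by (simp add: weight_def Lam_def Lamb_def sym_mat_bdiag sym_mat_add)

lemma sym_closed_weight: "sym_mat (closed_weight s F Fb)"
  unfolding weight_factor[symmetric] by (intro sym_mat_congruence sym_weight)

lemma cost_mat:
  assumes "(F, Fb) \<in> stab_gains s"
  shows "sym_mat (cost_mat s F Fb)"
    "cost_mat s F Fb = mf_op s F Fb (cost_mat s F Fb) + closed_weight s F Fb"
    "\<And>X. sym_mat X \<Longrightarrow> X = mf_op s F Fb X + closed_weight s F Fb \<Longrightarrow> X = cost_mat s F Fb"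
  using lyapunov_the[OF positive_congr3 assms[unfolded stab_gains_iff] sym_closed_weight]
  unfolding cost_mat_def by blast+

lemma state_mat:
  assumes "(F, Fb) \<in> stab_gains s" "sym_mat Z"
  shows "sym_mat (state_mat s Z F Fb)"
    "state_mat s Z F Fb = mf_adj s F Fb (state_mat s Z F Fb) + Z"
    "\<And>Y. sym_mat Y \<Longrightarrow> Y = mf_adj s F Fb Y + Z \<Longrightarrow> Y = state_mat s Z F Fb"
  using lyapunov_the[OF positive_congr3 decays_congr3_adj[OF assms(1)[unfolded stab_gains_iff]] assms(2)]
  unfolding state_mat_def by blast+

text \<open>The constraint determines \<open>X\<close> from its compression
  \<open>transpose G ** X ** G\<close>, and compressing the constraint itself gives the closed-loop
  Lyapunov equation for that matrix. Each stabilising pair of gains thus admits exactly one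
  \<open>X\<close>.\<close>

lemma feasible_II_iff:
  "feasible_II s (X, F, Fb) \<longleftrightarrow> (F, Fb) \<in> stab_gains s \<and>
     X = congr3 (openD1 s) (openD2 s) (openD3 s) (cost_mat s F Fb) + weight s"
proof (cases "(F, Fb) \<in> stab_gains s")
  case st: True
  define G where "G = gainM F Fb"
  have op: "transpose (augA1 s F Fb) ** X ** augA1 s F Fb
     + transpose (augA2 s F) ** X ** augA2 s F + transpose (augA3 s F) ** X ** augA3 s F
     = congr3 (openD1 s) (openD2 s) (openD3 s) (transpose G ** X ** G)" for X
    by (simp add: congr3_def aug_factor[of s F Fb] G_def matrix_algebra)
  have cl: "transpose G ** (congr3 (openD1 s) (openD2 s) (openD3 s) Y + weight s) ** G
     = mf_op s F Fb Y + closed_weight s F Fb" for Y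
    by (simp add: congr3_def cal_factor[of s F Fb] G_def matrix_algebra weight_factor[symmetric])
  show ?thesis
  proof
    assume "feasible_II s (X, F, Fb)"
    then have X: "sym_mat X"
      "congr3 (openD1 s) (openD2 s) (openD3 s) (transpose G ** X ** G) + weight s = X"
      by (simp_all add: feasible_II_def op)
    have "transpose G ** X ** G = mf_op s F Fb (transpose G ** X ** G) + closed_weight s F Fb"
      using X(2) cl by metis
    then have "transpose G ** X ** G = cost_mat s F Fb"
      by (rule cost_mat(3)[OF st sym_mat_congruence[OF X(1)]])
    with X(2) st show "(F, Fb) \<in> stab_gains s \<and>
     X = congr3 (openD1 s) (openD2 s) (openD3 s) (cost_mat s F Fb) + weight s" by simp
  next
    assume "(F, Fb) \<in> stab_gains s \<and>
     X = congr3 (openD1 s) (openD2 s) (openD3 s) (cost_mat s F Fb) + weight s"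
    then have X: "X = congr3 (openD1 s) (openD2 s) (openD3 s) (cost_mat s F Fb) + weight s" by simp
    have "transpose G ** X ** G = cost_mat s F Fb"
      unfolding X cl using cost_mat(2)[OF st] by simp
    moreover have "sym_mat X"
      unfolding X by (intro sym_mat_add congr3_sym cost_mat(1)[OF st] sym_weight)
    ultimately show "feasible_II s (X, F, Fb)" using X st by (simp add: feasible_II_def op)
  qed
qed (simp add: feasible_II_def)

lemma objective_II_feasible:
  assumes "feasible_II s (X, F, Fb)"
  shows "objective_II Z1 Z2 (X, F, Fb) = trace (bdiag Z2 (Z1 - Z2) ** cost_mat s F Fb)"
proof -
  define G where "G = gainM F Fb"
  have st: "(F, Fb) \<in> stab_gains s"
    and X: "X = congr3 (openD1 s) (openD2 s) (openD3 s) (cost_mat s F Fb) + weight s"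
    using assms by (simp_all add: feasible_II_iff)
  have "transpose G ** X ** G = mf_op s F Fb (cost_mat s F Fb) + closed_weight s F Fb"
    by (simp add: X congr3_def cal_factor[of s F Fb] G_def matrix_algebra weight_factor[symmetric])
  then have c: "transpose G ** X ** G = cost_mat s F Fb" using cost_mat(2)[OF st] by simp
  have "objective_II Z1 Z2 (X, F, Fb) = trace (bdiag Z2 (Z1 - Z2) ** transpose G ** X ** G)"
    unfolding objective_II_def prod.case init_term_factor G_def[symmetric]
    by (metis matrix_mul_assoc trace_mul_sym)
  also have "\<dots> = trace (bdiag Z2 (Z1 - Z2) ** (transpose G ** X ** G))"
    by (simp add: matrix_mul_assoc)
  finally show ?thesis by (simp add: c)
qed

context
  fixes Z1 Z2 :: "real ^ 'n ^ 'n"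
  assumes symZ: "sym_mat Z2" "sym_mat (Z1 - Z2)"
begin

private lemma symS0: "sym_mat (bdiag Z2 (Z1 - Z2))"
  using symZ by (simp add: sym_mat_bdiag)

text \<open>Dually, the constraint forces \<open>S\<close> into the form
  \<open>G ** Y ** transpose G\<close> with \<open>Y\<close> solving the moment equation, so the
  gains again determine the matrix variable.\<close>

lemma feasible_I_iff:
  "feasible_I s Z1 Z2 (S, F, Fb) \<longleftrightarrow> (F, Fb) \<in> stab_gains s \<and>
     S = gainM F Fb ** state_mat s (bdiag Z2 (Z1 - Z2)) F Fb ** transpose (gainM F Fb)"
proof (cases "(F, Fb) \<in> stab_gains s")
  case st: True
  define G where "G = gainM F Fb"
  define O' where "O' = congr3_adj (openD1 s) (openD2 s) (openD3 s)"
  have op: "augA1 s F Fb ** S ** transpose (augA1 s F Fb)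
     + augA2 s F ** S ** transpose (augA2 s F) + augA3 s F ** S ** transpose (augA3 s F)
     + init_term Z1 Z2 F Fb = G ** (O' S + bdiag Z2 (Z1 - Z2)) ** transpose G" for S
    by (simp add: congr3_def O'_def aug_factor[of s F Fb] G_def matrix_algebra init_term_factor)
  have cl: "O' (G ** Y ** transpose G) = mf_adj s F Fb Y" for Y
    by (simp add: congr3_def O'_def cal_factor[of s F Fb] G_def matrix_algebra)
  show ?thesis
  proof
    assume "feasible_I s Z1 Z2 (S, F, Fb)"
    then have S: "sym_mat S" "G ** (O' S + bdiag Z2 (Z1 - Z2)) ** transpose G = S"
      by (simp_all add: feasible_I_def op)
    \<comment> \<open>Taking \<open>O' S\<close> plus the initial data as the unknown yields the
      moment equation without cancelling \<open>G\<close>.\<close>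
    have "O' S + bdiag Z2 (Z1 - Z2) = mf_adj s F Fb (O' S + bdiag Z2 (Z1 - Z2)) + bdiag Z2 (Z1 - Z2)"
      using S(2) cl by metis
    then have "O' S + bdiag Z2 (Z1 - Z2) = state_mat s (bdiag Z2 (Z1 - Z2)) F Fb"
      by (intro state_mat(3)[OF st symS0]) (simp_all add: O'_def sym_mat_add congr3_sym S symS0)
    with S(2) st show "(F, Fb) \<in> stab_gains s \<and>
     S = gainM F Fb ** state_mat s (bdiag Z2 (Z1 - Z2)) F Fb ** transpose (gainM F Fb)"
      by (simp add: G_def)
  next
    define Y where "Y = state_mat s (bdiag Z2 (Z1 - Z2)) F Fb"
    assume "(F, Fb) \<in> stab_gains s \<and>
     S = gainM F Fb ** state_mat s (bdiag Z2 (Z1 - Z2)) F Fb ** transpose (gainM F Fb)"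
    then have S: "S = G ** Y ** transpose G" by (simp add: G_def Y_def)
    have "O' S + bdiag Z2 (Z1 - Z2) = Y"
      unfolding S cl using state_mat(2)[OF st symS0] by (simp add: Y_def)
    moreover have "sym_mat S"
      unfolding S using sym_mat_congruence[of Y "transpose G"] state_mat(1)[OF st symS0]
      by (simp add: Y_def)
    ultimately show "feasible_I s Z1 Z2 (S, F, Fb)" using S st by (simp add: feasible_I_def op)
  qed
qed (simp add: feasible_I_def)

lemma objective_I_feasible:
  assumes "feasible_I s Z1 Z2 (S, F, Fb)"
  shows "objective_I s (S, F, Fb) = trace (bdiag Z2 (Z1 - Z2) ** cost_mat s F Fb)"
proof -
  define G where "G = gainM F Fb"
  define Y where "Y = state_mat s (bdiag Z2 (Z1 - Z2)) F Fb"
  have st: "(F, Fb) \<in> stab_gains s" and S: "S = G ** Y ** transpose G"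
    using assms by (simp_all add: feasible_I_iff G_def Y_def)
  have "objective_I s (S, F, Fb) = trace (transpose G ** weight s ** G ** Y)"
    unfolding objective_I_def prod.case S by (metis matrix_mul_assoc trace_mul_sym)
  also have "\<dots> = trace (closed_weight s F Fb ** Y)"
    by (simp add: weight_factor G_def)
  also have "\<dots> = trace (bdiag Z2 (Z1 - Z2) ** cost_mat s F Fb)"
    by (rule lyapunov_duality[OF cost_mat(2)[OF st]]) (use state_mat(2)[OF st symS0] in \<open>simp add: Y_def\<close>)
  finally show ?thesis .
qed

end

end

section \<open>The Riccati equations\<close>

text \<open>Exact detectability freed from probability: \<open>bdiag M V\<close> stands for mean and
  covariance data, the vanishing traces for the mean squares of the outputs, and the limit for the
  mean square of the state.\<close>

definition detectable_mat :: "('n::finite, 'm::finite) mf_system \<Rightarrow> bool" where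
  "detectable_mat s \<longleftrightarrow> (\<forall>M V. psd M \<longrightarrow> psd V \<longrightarrow>
     (\<forall>k. trace (bdiag (hatQ s) (mfQ s) ** (mf_adj s 0 0 ^^ k) (bdiag M V)) = 0) \<longrightarrow>
     (\<lambda>k. trace ((mf_adj s 0 0 ^^ k) (bdiag M V))) \<longlonglongrightarrow> 0)"

locale mf_weights =
  fixes s :: "('n::finite, 'm::finite) mf_system"
  assumes Qpsd: "psd (mfQ s)" and hQpsd: "psd (hatQ s)"
    and Rpos: "posdef (mfR s)" and hRpos: "posdef (hatR s)"
begin

sublocale one: riccati_data "mfQ s" 0 "mfR s" "mfA1 s" "mfA2 s" "mfB1 s" "mfB2 s"
  by unfold_locales (simp_all add: Rpos psd_add Qpsd psd_congruence posdef_imp_psd)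

text \<open>For known \<open>P\<close> every term of the second equation that contains
  \<open>P\<close> counts as data: \<open>hatA2\<close> and \<open>hatB2\<close> move into the
  weights, where they create the cross term. The joint cost is the original one plus a congruence of
  \<open>P\<close>, hence positive semidefinite.\<close>

lemma riccati_data_two:
  assumes "psd P"
  shows "riccati_data (hatQ s + transpose (hatA2 s) ** P ** hatA2 s) (transpose (hatB2 s) ** P ** hatA2 s)
    (hatR s + transpose (hatB2 s) ** P ** hatB2 s)"
proof
  show "posdef (hatR s + transpose (hatB2 s) ** P ** hatB2 s)"
    by (intro posdef_add hRpos psd_congruence assms)
  fix F :: "real ^ 'n ^ 'm"
  have Pt: "transpose P = P" using psd_sym[OF assms] by (simp add: sym_mat_def)
  have "psd (hatQ s + transpose F ** hatR s ** F
      + transpose (hatA2 s + hatB2 s ** F) ** P ** (hatA2 s + hatB2 s ** F))"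
    by (intro psd_add hQpsd psd_congruence assms posdef_imp_psd hRpos)
  then show "psd (hatQ s + transpose (hatA2 s) ** P ** hatA2 s
      + transpose F ** (transpose (hatB2 s) ** P ** hatA2 s)
      + transpose (transpose (hatB2 s) ** P ** hatA2 s) ** F
      + transpose F ** (hatR s + transpose (hatB2 s) ** P ** hatB2 s) ** F)"
    by (simp add: matrix_algebra Pt add_ac)
qed

end

context mf_weights begin

definition "gain1 P = - (matrix_inv (Ups s P) ** Mgain s P)"
definition "gain2 P Pb = - (matrix_inv (Upsb s P Pb) ** Mgainb s P Pb)"
definition "ric1 P = mfQ s + transpose (mfA1 s) ** P ** mfA1 s + transpose (mfA2 s) ** P ** mfA2 s
  - transpose (Mgain s P) ** matrix_inv (Ups s P) ** Mgain s P"
definition "ric2 P Pb = hatQ s + transpose (hatA1 s) ** Pb ** hatA1 s + transpose (hatA2 s) ** P ** hatA2 s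
  - transpose (Mgainb s P Pb) ** matrix_inv (Upsb s P Pb) ** Mgainb s P Pb"
definition "lyap1 F P = mfQ s + transpose F ** mfR s ** F
  + transpose (mfA1 s + mfB1 s ** F) ** P ** (mfA1 s + mfB1 s ** F)
  + transpose (mfA2 s + mfB2 s ** F) ** P ** (mfA2 s + mfB2 s ** F)"
definition "lyap2 K P Pb = hatQ s + transpose K ** hatR s ** K
  + transpose (hatA1 s + hatB1 s ** K) ** Pb ** (hatA1 s + hatB1 s ** K)
  + transpose (hatA2 s + hatB2 s ** K) ** P ** (hatA2 s + hatB2 s ** K)"

lemma riccati_solution_iff:
  "riccati_solution s P Pb \<longleftrightarrow> psd P \<and> psd Pb \<and> P = ric1 P \<and> Pb = ric2 P Pb"
  by (simp only: riccati_solution_def ric1_def ric2_def)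

lemma one_eqs:
  "one.U P = Ups s P" "one.N P = Mgain s P" "one.gain P = gain1 P" "one.ric P = ric1 P"
  "one.ly F P = lyap1 F P"
  by (simp_all add: one.U_def one.N_def one.gain_def one.ric_def one.ly_def Ups_def Mgain_def gain1_def
      ric1_def lyap1_def)

lemma two_eqs:
  fixes P
  defines "Q2 \<equiv> hatQ s + transpose (hatA2 s) ** P ** hatA2 s"
    and "L2 \<equiv> transpose (hatB2 s) ** P ** hatA2 s"
    and "R2 \<equiv> hatR s + transpose (hatB2 s) ** P ** hatB2 s"
  assumes "psd P"
  shows "riccati_data.U R2 (hatB1 s) 0 Pb = Upsb s P Pb"
    "riccati_data.N L2 (hatA1 s) 0 (hatB1 s) 0 Pb = Mgainb s P Pb"
    "riccati_data.gain L2 R2 (hatA1 s) 0 (hatB1 s) 0 Pb = gain2 P Pb"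
    "riccati_data.ric Q2 L2 R2 (hatA1 s) 0 (hatB1 s) 0 Pb = ric2 P Pb"
    "riccati_data.ly Q2 L2 R2 (hatA1 s) 0 (hatB1 s) 0 K Pb = lyap2 K P Pb"
proof -
  interpret two: riccati_data Q2 L2 R2 "hatA1 s" 0 "hatB1 s" 0
    unfolding Q2_def L2_def R2_def by (rule riccati_data_two[OF assms(4)])
  have Pt: "transpose P = P" using psd_sym[OF assms(4)] by (simp add: sym_mat_def)
  show U: "two.U Pb = Upsb s P Pb" by (simp add: two.U_def) (simp add: Upsb_def R2_def)
  show N: "two.N Pb = Mgainb s P Pb" by (simp add: two.N_def) (simp add: Mgainb_def L2_def)
  show "two.gain Pb = gain2 P Pb" by (simp add: two.gain_def gain2_def U N)
  show "two.ric Pb = ric2 P Pb" by (simp add: two.ric_def U N) (simp add: ric2_def Q2_def)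
  show "two.ly K Pb = lyap2 K P Pb"
    by (simp add: two.ly_def) (simp add: lyap2_def Q2_def L2_def R2_def matrix_algebra Pt add_ac)
qed

lemma lyap1_complete_square:
  "psd P \<Longrightarrow> lyap1 F P = ric1 P + transpose (F - gain1 P) ** Ups s P ** (F - gain1 P)"
  using one.complete_square by (simp add: one_eqs)

lemma lyap2_complete_square:
  assumes "psd P" "psd Pb"
  shows "lyap2 K P Pb = ric2 P Pb + transpose (K - gain2 P Pb) ** Upsb s P Pb ** (K - gain2 P Pb)"
  using riccati_data.complete_square[OF riccati_data_two[OF assms(1)] assms(2), of "hatA1 s" 0 "hatB1 s" 0 K]
  by (simp only: two_eqs[OF assms(1)])

lemma Ups_posdef: "psd P \<Longrightarrow> posdef (Ups s P)"
  using one.U_posdef by (simp add: one_eqs)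

lemma Upsb_posdef: "psd P \<Longrightarrow> psd Pb \<Longrightarrow> posdef (Upsb s P Pb)"
  using riccati_data.U_posdef[OF riccati_data_two, of P Pb "hatB1 s" 0] by (simp only: two_eqs)

lemma mf_op_closed_weight:
  "mf_op s F Fb (bdiag Pb P) + closed_weight s F Fb = bdiag (lyap2 (F + Fb) P Pb) (lyap1 F P)"
  unfolding mf_op_bdiag closed_weight_def lyap1_def lyap2_def by (simp add: bdiag_def blk_add add_ac)

lemma psd_closed_weight: "psd (closed_weight s F Fb)"
  unfolding closed_weight_def
  by (intro psd_bdiag psd_add psd_congruence Qpsd hQpsd posdef_imp_psd Rpos hRpos)

lemma sym_coeffs: "sym_mat (mfQ s)" "sym_mat (mfQb s)" "sym_mat (mfR s)" "sym_mat (mfRb s)"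
proof -
  show Q: "sym_mat (mfQ s)" and R: "sym_mat (mfR s)" using Qpsd Rpos by (simp_all add: psd_sym posdef_sym)
  have "mfQb s = hatQ s - mfQ s" "mfRb s = hatR s - mfR s" by (simp_all add: hatQ_def hatR_def)
  then show "sym_mat (mfQb s)" "sym_mat (mfRb s)"
    using sym_mat_diff Q R psd_sym[OF hQpsd] posdef_sym[OF hRpos] by metis+
qed

lemmas cost_mat' = cost_mat[OF sym_coeffs]

lemma cost_mat_psd: "(F, Fb) \<in> stab_gains s \<Longrightarrow> psd (cost_mat s F Fb)"
  using lyapunov_psd(1)[OF positive_congr3 _ psd_closed_weight cost_mat'(1,2)]
  by (simp add: stab_gains_iff)

text \<open>The diagonal blocks of the cost matrix of any stabilising gains satisfy the two Lyapunov
  equations, which makes them supersolutions for the value iterations.\<close>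

lemma riccati_exists:
  assumes "(F, Fb) \<in> stab_gains s"
  obtains P Pb where "riccati_solution s P Pb"
proof -
  obtain X11 X12 X21 X22 where X: "cost_mat s F Fb = blk X11 X12 X21 X22"
    using blk_cases by blast
  have psdX: "psd X11" "psd X22" using cost_mat_psd[OF assms] psd_blkD unfolding X by blast+
  obtain B' C' where "mf_op s F Fb (blk X11 X12 X21 X22) = blk
    (transpose (hatA1 s + hatB1 s ** (F + Fb)) ** X11 ** (hatA1 s + hatB1 s ** (F + Fb))
      + transpose (hatA2 s + hatB2 s ** (F + Fb)) ** X22 ** (hatA2 s + hatB2 s ** (F + Fb))) B' C'
    (transpose (mfA1 s + mfB1 s ** F) ** X22 ** (mfA1 s + mfB1 s ** F)
      + transpose (mfA2 s + mfB2 s ** F) ** X22 ** (mfA2 s + mfB2 s ** F))"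
    using mf_op_blk by blast
  with cost_mat'(2)[OF assms] have eqs: "X11 = lyap2 (F + Fb) X22 X11" "X22 = lyap1 F X22"
    by (simp_all add: X closed_weight_def bdiag_def blk_add blk_eq_iff lyap1_def lyap2_def add_ac)
  have "psd (X22 - lyap1 F X22)" using eqs(2) by simp
  then obtain P where P: "psd P" "P = ric1 P" "psd (X22 - P)"
    using one.ric_fixpoint_exists[OF psdX(2), of F] unfolding one_eqs by metis
  interpret two: riccati_data "hatQ s + transpose (hatA2 s) ** P ** hatA2 s"
    "transpose (hatB2 s) ** P ** hatA2 s" "hatR s + transpose (hatB2 s) ** P ** hatB2 s"
    "hatA1 s" 0 "hatB1 s" 0
    by (rule riccati_data_two[OF P(1)])
  \<comment> \<open>The second equation must be solved with \<open>P\<close> in place of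
    \<open>X22\<close>. As \<open>P\<close> lies below \<open>X22\<close>, the exchange lowers
    \<open>lyap2\<close>, and \<open>X11\<close> remains a supersolution.\<close>
  have "lyap2 (F + Fb) X22 X11 - lyap2 (F + Fb) P X11
      = transpose (hatA2 s + hatB2 s ** (F + Fb)) ** (X22 - P) ** (hatA2 s + hatB2 s ** (F + Fb))"
    by (simp add: lyap2_def matrix_sub_ldistrib matrix_sub_rdistrib)
  then have "psd (lyap2 (F + Fb) X22 X11 - lyap2 (F + Fb) P X11)"
    using psd_congruence[OF P(3)] by simp
  then have "psd (X11 - two.ly (F + Fb) X11)" using eqs(1) by (simp add: two_eqs[OF P(1)])
  then obtain Pb where "psd Pb" "Pb = ric2 P Pb"
    using two.ric_fixpoint_exists[OF psdX(1), of "F + Fb"] unfolding two_eqs[OF P(1)] by metis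
  then show thesis using that P riccati_solution_iff by blast
qed

text \<open>Subtracting the Riccati equations from the equation of the cost leaves a Lyapunov
  equation with right-hand side \<open>\<Delta>\<close>, and its solution dominates
  \<open>\<Delta>\<close>. The bound holds for every Riccati solution, as the proof of uniqueness
  requires.\<close>

lemma cost_mat_lower_bound:
  assumes sol: "riccati_solution s P Pb" and st: "(F, Fb) \<in> stab_gains s"
  defines "\<Delta> \<equiv> bdiag
    (transpose (F + Fb - gain2 P Pb) ** Upsb s P Pb ** (F + Fb - gain2 P Pb))
    (transpose (F - gain1 P) ** Ups s P ** (F - gain1 P))"
  shows "psd \<Delta>" "psd (cost_mat s F Fb - bdiag Pb P - \<Delta>)"
proof -
  have P: "psd P" "psd Pb" "P = ric1 P" "Pb = ric2 P Pb" using sol riccati_solution_iff by blast+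
  show D: "psd \<Delta>"
    unfolding \<Delta>_def
    by (intro psd_bdiag psd_congruence posdef_imp_psd Ups_posdef Upsb_posdef P(1,2))
  have "mf_op s F Fb (bdiag Pb P) + closed_weight s F Fb = bdiag Pb P + \<Delta>"
    unfolding mf_op_closed_weight lyap1_complete_square[OF P(1)] lyap2_complete_square[OF P(1,2)] \<Delta>_def
      P(3,4)[symmetric] by (simp add: bdiag_def blk_add)
  then have "closed_weight s F Fb = bdiag Pb P + \<Delta> - mf_op s F Fb (bdiag Pb P)"
    by (metis add_diff_cancel_left')
  then have "cost_mat s F Fb - bdiag Pb P
      = mf_op s F Fb (cost_mat s F Fb) + (bdiag Pb P + \<Delta> - mf_op s F Fb (bdiag Pb P)) - bdiag Pb P"
    using cost_mat'(2)[OF st] by metis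
  also have "\<dots> = mf_op s F Fb (cost_mat s F Fb - bdiag Pb P) + \<Delta>"
    by (simp add: linear_diff[OF linear_congr3])
  finally have eq: "cost_mat s F Fb - bdiag Pb P
      = mf_op s F Fb (cost_mat s F Fb - bdiag Pb P) + \<Delta>" .
  have "sym_mat (cost_mat s F Fb - bdiag Pb P)"
    by (intro sym_mat_diff cost_mat'(1)[OF st] psd_sym psd_bdiag P)
  from lyapunov_psd(2)[OF positive_congr3 _ D this eq] st
  show "psd (cost_mat s F Fb - bdiag Pb P - \<Delta>)" by (simp add: stab_gains_iff)
qed

lemma mf_op_riccati:
  assumes "riccati_solution s P Pb"
  shows "bdiag Pb P = mf_op s (gain1 P) (gain2 P Pb - gain1 P) (bdiag Pb P)
    + closed_weight s (gain1 P) (gain2 P Pb - gain1 P)"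
proof -
  have P: "psd P" "psd Pb" "P = ric1 P" "Pb = ric2 P Pb" using assms riccati_solution_iff by blast+
  show ?thesis
    unfolding mf_op_closed_weight lyap1_complete_square[OF P(1)] lyap2_complete_square[OF P(1,2)]
    using P(3,4) by simp
qed

lemma cost_mat_riccati:
  assumes sol: "riccati_solution s P Pb"
    and st: "(gain1 P, gain2 P Pb - gain1 P) \<in> stab_gains s"
  shows "cost_mat s (gain1 P) (gain2 P Pb - gain1 P) = bdiag Pb P"
proof -
  have "sym_mat (bdiag Pb P)" using sol by (intro psd_sym psd_bdiag) (simp_all add: riccati_solution_def)
  from cost_mat'(3)[OF st this mf_op_riccati[OF sol]] show ?thesis by simp
qed

text \<open>With \<open>M = E ** transpose E\<close> the trace is that of \<open>U\<close> against
  the Gram matrix of \<open>K ** E\<close>, so \<open>K ** E = 0\<close>. For a moment matrix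
  \<open>M\<close> this says that a feedback without control cost does not act on it.\<close>

lemma gain_annihilates:
  fixes K :: "real ^ 'n ^ 'm" and M :: "real ^ 'n ^ 'n"
  assumes "posdef U" "psd M" "trace (transpose K ** U ** K ** M) = 0"
  shows "K ** M = 0" "M ** transpose K = 0"
proof -
  obtain E :: "real ^ 'n ^ 'n" where E: "M = E ** transpose E" by (rule psd_gram_root[OF assms(2)])
  have "trace (U ** ((K ** E) ** transpose (K ** E))) = trace (transpose K ** U ** K ** M)"
    unfolding E by (metis matrix_mul_assoc matrix_transpose_mul trace_mul_sym)
  then have "(K ** E) ** transpose (K ** E) = 0"
    using assms(3) psd_congruence'[OF psd_one, of "K ** E"]
    by (intro trace_mult_posdef_zero[OF assms(1)]) simp_all
  then have "K ** E = 0" by (intro gram_zero) simp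
  then show KM: "K ** M = 0" by (simp add: E matrix_mul_assoc)
  have "transpose (K ** M) = M ** transpose K"
    using psd_sym[OF assms(2)] by (simp add: sym_mat_def matrix_transpose_mul)
  with KM show "M ** transpose K = 0" by simp
qed

text \<open>The Perron alternative is applied to the adjoint operator because detectability concerns
  moments; decay is transferred back at the end.\<close>

lemma riccati_gain_stabilizing:
  assumes sol: "riccati_solution s P Pb" and det: "detectable_mat s"
  shows "(gain1 P, gain2 P Pb - gain1 P) \<in> stab_gains s"
proof -
  define F where "F = gain1 P"
  define K where "K = gain2 P Pb"
  define Fb where "Fb = K - F"
  have FK: "F + Fb = K" by (simp add: Fb_def)
  define A where "A = mf_adj s F Fb"
  have P: "psd P" "psd Pb" using sol by (simp_all add: riccati_solution_def)
  have no: False if tY: "0 < t" "t \<le> 1" "psd Y" "Y \<noteq> 0" "Y = t *\<^sub>R A Y" for t Y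
  proof -
    obtain M N N' V where Y: "Y = blk M N N' V" using blk_cases by blast
    have MV: "psd M" "psd V" using tY(3) psd_blkD unfolding Y by blast+
    have "trace M + trace V \<noteq> 0"
      using psd_trace_zero[OF tY(3)] tY(4) by (auto simp: Y trace_blk)
    then have trMV: "trace M + trace V > 0"
      using trace_psd_nonneg[OF MV(1)] trace_psd_nonneg[OF MV(2)] by linarith
    \<comment> \<open>The block-diagonal part is again an eigenvector, and it has the form tested in
      \<open>detectable_mat\<close>. It is nonzero because it has the same trace as
      \<open>Y\<close>, and a positive semidefinite matrix of trace zero vanishes.\<close>
    define Z where "Z = bdiag M V"
    have psdZ: "psd Z" unfolding Z_def by (intro psd_bdiag MV)
    obtain B' C' where "A (blk M N N' V) = blk
      ((hatA1 s + hatB1 s ** (F + Fb)) ** M ** transpose (hatA1 s + hatB1 s ** (F + Fb))) B' C'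
      ((mfA1 s + mfB1 s ** F) ** V ** transpose (mfA1 s + mfB1 s ** F)
        + (mfA2 s + mfB2 s ** F) ** V ** transpose (mfA2 s + mfB2 s ** F)
        + (hatA2 s + hatB2 s ** (F + Fb)) ** M ** transpose (hatA2 s + hatB2 s ** (F + Fb)))"
      unfolding A_def using mf_adj_blk by blast
    then have Z: "Z = t *\<^sub>R A Z"
      using tY(5) unfolding Y Z_def A_def mf_adj_bdiag
      by (simp add: bdiag_def blk_scaleR blk_eq_iff)
    define PP where "PP = bdiag Pb P"
    define H where "H = closed_weight s F Fb"
    have psdPi: "psd PP" unfolding PP_def by (intro psd_bdiag P)
    have Pi: "PP = mf_op s F Fb PP + H"
      using mf_op_riccati[OF sol] by (simp add: PP_def H_def F_def Fb_def K_def)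
    have "trace (Z ** PP) = t * trace (A Z ** PP)"
      using Z by (metis matrix_scaleR_left trace_scaleR)
    moreover have "trace (A Z ** PP) = trace (Z ** mf_op s F Fb PP)"
      unfolding A_def trace_congr3 ..
    moreover have "trace (Z ** PP) = trace (Z ** mf_op s F Fb PP) + trace (Z ** H)"
      using Pi by (metis matrix_add_ldistrib trace_add)
    ultimately have "trace (Z ** PP) = t * trace (Z ** mf_op s F Fb PP)"
      and "t * trace (Z ** PP) = t * trace (Z ** mf_op s F Fb PP) + t * trace (Z ** H)"
      by (metis, metis distrib_left)
    \<comment> \<open>Pairing the eigenvector with the Riccati solution gives two summands that are
      nonnegative for \<open>0 < t \<le> 1\<close>, so the stage cost at \<open>Z\<close> is
      zero.\<close>
    then have "(1 - t) * trace (Z ** PP) + t * trace (Z ** H) = 0"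
      unfolding left_diff_distrib by linarith
    moreover have "0 \<le> (1 - t) * trace (Z ** PP)" "0 \<le> t * trace (Z ** H)"
      unfolding H_def using tY(1,2)
      by (intro mult_nonneg_nonneg trace_mult_psd_nonneg psdZ psdPi psd_closed_weight; simp)+
    ultimately have "t * trace (Z ** H) = 0" by linarith
    then have "trace (Z ** H) = 0" using tY(1) by simp
    then have "trace (H ** Z) = 0" by (metis trace_mul_sym)
    then have sum0: "trace (hatQ s ** M) + trace (transpose K ** hatR s ** K ** M)
        + (trace (mfQ s ** V) + trace (transpose F ** mfR s ** F ** V)) = 0"
      unfolding H_def closed_weight_def Z_def trace_bdiag_mult FK
      by (simp add: matrix_add_rdistrib trace_add)
    have nn: "0 \<le> trace (hatQ s ** M)" "0 \<le> trace (transpose K ** hatR s ** K ** M)"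
      "0 \<le> trace (mfQ s ** V)" "0 \<le> trace (transpose F ** mfR s ** F ** V)"
      by (intro trace_mult_psd_nonneg psd_congruence MV Qpsd hQpsd posdef_imp_psd Rpos hRpos)+
    have KM: "K ** M = 0" "M ** transpose K = 0"
      using gain_annihilates[OF hRpos MV(1), of K] sum0 nn by auto
    have FV: "F ** V = 0" "V ** transpose F = 0"
      using gain_annihilates[OF Rpos MV(2), of F] sum0 nn by auto
    have z: "(C + D ** K) ** M ** transpose (C + D ** K) = C ** M ** transpose C"
      for C :: "real ^ 'n ^ 'n" and D
    proof -
      have "(C + D ** K) ** M = C ** M" "M ** transpose (C + D ** K) = M ** transpose C"
        using KM by (simp_all add: matrix_add_rdistrib matrix_add_ldistrib transpose_add
            matrix_transpose_mul matrix_mul_assoc[symmetric])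
           (simp_all add: matrix_mul_assoc)
      then show ?thesis by (metis matrix_mul_assoc)
    qed
    have z': "(C + D ** F) ** V ** transpose (C + D ** F) = C ** V ** transpose C"
      for C :: "real ^ 'n ^ 'n" and D
    proof -
      have "(C + D ** F) ** V = C ** V" "V ** transpose (C + D ** F) = V ** transpose C"
        using FV by (simp_all add: matrix_add_rdistrib matrix_add_ldistrib transpose_add
            matrix_transpose_mul matrix_mul_assoc[symmetric])
           (simp_all add: matrix_mul_assoc)
      then show ?thesis by (metis matrix_mul_assoc)
    qed
    define A0 where "A0 = mf_adj s 0 0"
    \<comment> \<open>Both feedbacks vanish on \<open>Z\<close>, so \<open>Z\<close> is also an
      eigenvector of the uncontrolled recursion, with eigenvalue
      \<open>1 / t \<ge> 1\<close>.\<close>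
    have "A Z = A0 Z"
      unfolding A_def A0_def Z_def mf_adj_bdiag FK z z' by simp
    with Z have Z0: "A0 Z = (1 / t) *\<^sub>R Z" using tY(1)
      by (metis (no_types, lifting) divide_self_if less_irrefl scaleR_one scaleR_scaleR times_divide_eq_left mult_1)
    have pow: "(A0 ^^ k) Z = (1 / t) ^ k *\<^sub>R Z" for k
    proof (induction k)
      case (Suc k)
      have "(A0 ^^ Suc k) Z = A0 ((1 / t) ^ k *\<^sub>R Z)" using Suc by simp
      also have "\<dots> = (1 / t) ^ k *\<^sub>R A0 Z" unfolding A0_def by (rule linear_scale[OF linear_congr3])
      finally show ?case by (simp add: Z0)
    qed simp
    have "trace (bdiag (hatQ s) (mfQ s) ** Z) = 0"
      unfolding Z_def trace_bdiag_mult using sum0 nn by linarith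
    then have "trace (bdiag (hatQ s) (mfQ s) ** (A0 ^^ k) Z) = 0" for k
      by (simp add: pow matrix_scaleR_right trace_scaleR)
    then have lim: "(\<lambda>k. trace ((A0 ^^ k) Z)) \<longlonglongrightarrow> 0"
      using det MV unfolding detectable_mat_def A0_def Z_def by blast
    have "trace Z \<le> trace ((A0 ^^ k) Z)" for k
    proof -
      have "1 \<le> (1 / t) ^ k" using tY by (intro one_le_power) simp
      then show ?thesis
        using trace_psd_nonneg[OF psdZ] mult_right_mono[of 1 "(1/t)^k" "trace Z"]
        by (simp add: pow trace_scaleR)
    qed
    then have "trace Z \<le> 0" by (intro LIMSEQ_le_const[OF lim]) blast
    then show False using trMV by (simp add: Z_def bdiag_def trace_blk)
  qed
  have "decays A"
    using perron_alternative[of A] decays_if_solution[of A] no positive_congr3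
    unfolding A_def by blast
  then have "decays (mf_op s F Fb)"
    using decays_congr3_adj[of "transpose (calA1 s F Fb)" "transpose (calA2 s F)" "transpose (calA3 s F Fb)"]
    by (simp add: A_def)
  then show ?thesis by (simp add: stab_gains_iff F_def Fb_def K_def)
qed

text \<open>The stabilising gains of one solution have that solution as their cost matrix, and by
  the lower bound any other solution lies below it; exchanging the roles gives equality.\<close>

lemma riccati_unique:
  assumes det: "detectable_mat s" and sol: "riccati_solution s P Pb" "riccati_solution s P' Pb'"
  shows "P = P' \<and> Pb = Pb'"
proof -
  have le: "psd (bdiag Pb P - bdiag Pb' P')"
    if sol: "riccati_solution s P Pb" "riccati_solution s P' Pb'" for P Pb P' Pb'
  proof -
    note st = riccati_gain_stabilizing[OF sol(1) det]
    from psd_add[OF cost_mat_lower_bound(2,1)[OF sol(2) st]]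
    show ?thesis by (simp add: cost_mat_riccati[OF sol(1) st])
  qed
  have "bdiag Pb P = bdiag Pb' P'"
    by (rule psd_antisym) (intro le sol)+
  then show ?thesis by (simp add: bdiag_def blk_eq_iff)
qed

lemma riccati_pair_eq:
  assumes "detectable_mat s" "riccati_solution s P Pb"
  shows "riccati_pair s = (P, Pb)" "F_star s = gain1 P" "Fb_star s = gain2 P Pb - gain1 P"
proof -
  show "riccati_pair s = (P, Pb)"
    unfolding riccati_pair_def using assms riccati_unique[OF assms(1)] by (intro the_equality) auto
  then show "F_star s = gain1 P" "Fb_star s = gain2 P Pb - gain1 P"
    by (simp_all add: F_star_def Fb_star_def gain1_def gain2_def)
qed

lemma optimal_gains:
  assumes det: "detectable_mat s" and ne: "stab_gains s \<noteq> {}" and Z: "posdef Z"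
  shows "(F_star s, Fb_star s) \<in> stab_gains s"
    "\<And>F Fb. (F, Fb) \<in> stab_gains s \<Longrightarrow>
      trace (Z ** cost_mat s (F_star s) (Fb_star s)) \<le> trace (Z ** cost_mat s F Fb)"
    "\<And>F Fb. (F, Fb) \<in> stab_gains s \<Longrightarrow>
      trace (Z ** cost_mat s F Fb) \<le> trace (Z ** cost_mat s (F_star s) (Fb_star s)) \<Longrightarrow>
      F = F_star s \<and> Fb = Fb_star s"
proof -
  obtain F0 Fb0 where "(F0, Fb0) \<in> stab_gains s" using ne by auto
  then obtain P Pb where sol: "riccati_solution s P Pb" by (rule riccati_exists)
  have P: "psd P" "psd Pb" using sol by (simp_all add: riccati_solution_def)
  note eqs = riccati_pair_eq[OF det sol]
  note st = riccati_gain_stabilizing[OF sol det]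
  show "(F_star s, Fb_star s) \<in> stab_gains s" using st by (simp add: eqs)
  fix F Fb assume FF: "(F, Fb) \<in> stab_gains s"
  define \<Delta> where "\<Delta> = bdiag
    (transpose (F + Fb - gain2 P Pb) ** Upsb s P Pb ** (F + Fb - gain2 P Pb))
    (transpose (F - gain1 P) ** Ups s P ** (F - gain1 P))"
  have D: "psd \<Delta>" "psd (cost_mat s F Fb - bdiag Pb P - \<Delta>)"
    using cost_mat_lower_bound[OF sol FF] by (simp_all add: \<Delta>_def)
  have star: "cost_mat s (F_star s) (Fb_star s) = bdiag Pb P"
    using cost_mat_riccati[OF sol st] by (simp add: eqs)
  have le: "trace (Z ** bdiag Pb P) + trace (Z ** \<Delta>) \<le> trace (Z ** cost_mat s F Fb)"
    using trace_mult_psd_nonneg[OF posdef_imp_psd[OF Z] D(2)]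
    by (simp add: matrix_sub_ldistrib trace_sub)
  have D0: "0 \<le> trace (Z ** \<Delta>)" by (rule trace_mult_psd_nonneg[OF posdef_imp_psd[OF Z] D(1)])
  show "trace (Z ** cost_mat s (F_star s) (Fb_star s)) \<le> trace (Z ** cost_mat s F Fb)"
    using le D0 by (simp add: star)
  assume "trace (Z ** cost_mat s F Fb) \<le> trace (Z ** cost_mat s (F_star s) (Fb_star s))"
  then have "trace (Z ** \<Delta>) = 0" using le D0 by (simp add: star)
  then have "\<Delta> = 0" by (rule trace_mult_posdef_zero[OF Z D(1)])
  then have zero: "transpose (F + Fb - gain2 P Pb) ** Upsb s P Pb ** (F + Fb - gain2 P Pb) = 0"
    "transpose (F - gain1 P) ** Ups s P ** (F - gain1 P) = 0"
    unfolding \<Delta>_def bdiag_def using blk_eq_iff blk_zero by metis+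
  \<comment> \<open>With the identity as moment matrix, a vanishing square with positive definite
    weight forces the gain difference to vanish.\<close>
  have "F + Fb - gain2 P Pb = 0"
    using gain_annihilates(1)[OF Upsb_posdef[OF P] psd_one, of "F + Fb - gain2 P Pb"] zero(1) by simp
  moreover have "F - gain1 P = 0"
    using gain_annihilates(1)[OF Ups_posdef[OF P(1)] psd_one, of "F - gain1 P"] zero(2) by simp
  ultimately show "F = F_star s \<and> Fb = Fb_star s"
    by (simp add: eqs algebra_simps)
qed

end

section \<open>Second moments of random vectors\<close>

lemma bounded_bilinear_outer: "bounded_bilinear (outer :: real ^ 'p \<Rightarrow> real ^ 'q \<Rightarrow> _)"
  unfolding bilinear_conv_bounded_bilinear[symmetric] bilinear_def
  by (auto intro!: linearI simp: outer_def vec_eq_iff algebra_simps)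

interpretation outer: bounded_bilinear "outer :: real ^ 'p \<Rightarrow> real ^ 'q \<Rightarrow> _"
  by (rule bounded_bilinear_outer)

lemma measurable_outer [measurable]:
  assumes "f \<in> borel_measurable M" "g \<in> borel_measurable M"
  shows "(\<lambda>\<omega>. outer (f \<omega> :: real ^ 'p) (g \<omega> :: real ^ 'q)) \<in> borel_measurable M"
  by (rule borel_measurable_continuous_Pair[OF assms])
    (intro outer.continuous_on continuous_intros)

lemma measurable_mult_vec [measurable]:
  assumes "f \<in> borel_measurable M"
  shows "(\<lambda>\<omega>. A *v (f \<omega> :: real ^ 'q)) \<in> borel_measurable M"
  by (rule borel_measurable_continuous_on[OF _ assms])
    (intro linear_continuous_on linear_conv_bounded_linear[THEN iffD1] matrix_vector_mul_linear)

lemma integral_mult_vec: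
  assumes "integrable M (f :: 'a \<Rightarrow> real ^ 'q)"
  shows "integrable M (\<lambda>\<omega>. A *v f \<omega>)" "integral\<^sup>L M (\<lambda>\<omega>. A *v f \<omega>) = A *v integral\<^sup>L M f"
proof -
  have "bounded_linear ((*v) A)"
    by (intro linear_conv_bounded_linear[THEN iffD1] matrix_vector_mul_linear)
  then show "integrable M (\<lambda>\<omega>. A *v f \<omega>)" "integral\<^sup>L M (\<lambda>\<omega>. A *v f \<omega>) = A *v integral\<^sup>L M f"
    using assms by (auto intro: integrable_bounded_linear integral_bounded_linear)
qed

lemma integral_linear_matrix:
  fixes L :: "real ^ 'q ^ 'p \<Rightarrow> 'b::{second_countable_topology, banach, euclidean_space}"
  assumes "integrable M f" "linear L"
  shows "integrable M (\<lambda>\<omega>. L (f \<omega>))" "integral\<^sup>L M (\<lambda>\<omega>. L (f \<omega>)) = L (integral\<^sup>L M f)"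
  using assms linear_conv_bounded_linear[of L]
  by (auto intro: integrable_bounded_linear integral_bounded_linear)

context prob_space
begin

definition sqint :: "('a \<Rightarrow> real ^ 'n) \<Rightarrow> bool" where
  "sqint x \<longleftrightarrow> x \<in> borel_measurable M \<and> integrable M (\<lambda>\<omega>. (norm (x \<omega>))\<^sup>2)"

definition cov :: "('a \<Rightarrow> real ^ 'n) \<Rightarrow> real ^ 'n ^ 'n" where
  "cov x = expectation (\<lambda>\<omega>. outer (x \<omega> - expectation x) (x \<omega> - expectation x))"

text \<open>The second moment matrix of the stacked vector of mean and centred part; its
  off-diagonal blocks are zero because the centred part has mean zero.\<close>

definition moments :: "('a \<Rightarrow> real ^ 'n) \<Rightarrow> real ^ ('n + 'n) ^ ('n + 'n)" where
  "moments x = bdiag (outer (expectation x) (expectation x)) (cov x)"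

lemma sqint_measurable [measurable_dest]: "sqint x \<Longrightarrow> x \<in> borel_measurable M"
  by (simp add: sqint_def)

lemma sqint_const [simp]: "sqint (\<lambda>_. c)"
  by (simp add: sqint_def)

lemma sqint_dominated:
  assumes "x \<in> borel_measurable M" "integrable M g" "\<And>\<omega>. (norm (x \<omega>))\<^sup>2 \<le> g \<omega>"
  shows "sqint x"
  unfolding sqint_def using assms(1)
  by (auto intro!: Bochner_Integration.integrable_bound[OF assms(2)] AE_I2 order_trans[OF assms(3)])

lemma sqint_add:
  assumes "sqint x" "sqint y"
  shows "sqint (\<lambda>\<omega>. x \<omega> + y \<omega>)"
proof (rule sqint_dominated)
  show "integrable M (\<lambda>\<omega>. 2 * (norm (x \<omega>))\<^sup>2 + 2 * (norm (y \<omega>))\<^sup>2)"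
    using assms by (simp add: sqint_def)
  fix \<omega>
  have "(norm (x \<omega> + y \<omega>))\<^sup>2 \<le> (norm (x \<omega>) + norm (y \<omega>))\<^sup>2"
    by (intro power_mono norm_triangle_ineq) simp
  also have "\<dots> \<le> 2 * (norm (x \<omega>))\<^sup>2 + 2 * (norm (y \<omega>))\<^sup>2"
    using sum_squares_ge_zero[of "norm (x \<omega>) - norm (y \<omega>)" 0]
    by (simp add: power2_eq_square algebra_simps)
  finally show "(norm (x \<omega> + y \<omega>))\<^sup>2 \<le> 2 * (norm (x \<omega>))\<^sup>2 + 2 * (norm (y \<omega>))\<^sup>2" .
qed (use assms in measurable)

lemma sqint_mult_vec:
  assumes "sqint x"
  shows "sqint (\<lambda>\<omega>. A *v x \<omega>)"
proof -
  obtain B where B: "\<And>v. norm (A *v v) \<le> B * norm v"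
    using linear_bounded[of "(*v) A"] by auto
  show ?thesis
  proof (rule sqint_dominated)
    show "integrable M (\<lambda>\<omega>. B\<^sup>2 * (norm (x \<omega>))\<^sup>2)" using assms by (simp add: sqint_def)
    show "(norm (A *v x \<omega>))\<^sup>2 \<le> B\<^sup>2 * (norm (x \<omega>))\<^sup>2" for \<omega>
      using power_mono[OF B[of "x \<omega>"], of 2] by (simp add: power_mult_distrib)
  qed (use assms in measurable)
qed

lemma sqint_diff_const: "sqint x \<Longrightarrow> sqint (\<lambda>\<omega>. x \<omega> - c)"
  using sqint_add[of x "\<lambda>_. - c"] by simp

lemma sqint_integrable:
  assumes "sqint x"
  shows "integrable M x"
proof (rule Bochner_Integration.integrable_bound)
  show "integrable M (\<lambda>\<omega>. 1 + (norm (x \<omega>))\<^sup>2)" using assms by (simp add: sqint_def)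
  have "norm (x \<omega>) \<le> 1 + (norm (x \<omega>))\<^sup>2" for \<omega>
  proof -
    have "2 * norm (x \<omega>) \<le> 1 + (norm (x \<omega>))\<^sup>2"
      using sum_squares_ge_zero[of "norm (x \<omega>) - 1" 0] by (simp add: power2_eq_square algebra_simps)
    then show ?thesis using norm_ge_zero[of "x \<omega>"] by linarith
  qed
  then show "AE \<omega> in M. norm (x \<omega>) \<le> norm (1 + (norm (x \<omega>))\<^sup>2)" by (simp add: add_nonneg_nonneg)
qed (use assms in measurable)

lemma sqint_outer:
  fixes x :: "'a \<Rightarrow> real ^ 'p" and y :: "'a \<Rightarrow> real ^ 'q"
  assumes "sqint x" "sqint y"
  shows "integrable M (\<lambda>\<omega>. outer (x \<omega>) (y \<omega>))"
proof -
  obtain K where K: "0 \<le> K" "\<And>a b. norm (outer (a :: real ^ 'p) (b :: real ^ 'q)) \<le> norm a * norm b * K"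
    using outer.nonneg_bounded by blast
  show ?thesis
  proof (rule Bochner_Integration.integrable_bound)
    show "integrable M (\<lambda>\<omega>. ((norm (x \<omega>))\<^sup>2 + (norm (y \<omega>))\<^sup>2) * K)" using assms by (simp add: sqint_def)
    have "norm (outer (x \<omega>) (y \<omega>)) \<le> ((norm (x \<omega>))\<^sup>2 + (norm (y \<omega>))\<^sup>2) * K" for \<omega>
    proof -
      have "0 \<le> norm (x \<omega>) * norm (y \<omega>)" by simp
      moreover have "2 * (norm (x \<omega>) * norm (y \<omega>)) \<le> (norm (x \<omega>))\<^sup>2 + (norm (y \<omega>))\<^sup>2"
        using sum_squares_ge_zero[of "norm (x \<omega>) - norm (y \<omega>)" 0]
        by (simp add: power2_eq_square algebra_simps)
      ultimately have "norm (x \<omega>) * norm (y \<omega>) \<le> (norm (x \<omega>))\<^sup>2 + (norm (y \<omega>))\<^sup>2" by linarith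
      from order_trans[OF K(2) mult_right_mono[OF this K(1)]] show ?thesis .
    qed
    then show "AE \<omega> in M. norm (outer (x \<omega>) (y \<omega>)) \<le> norm (((norm (x \<omega>))\<^sup>2 + (norm (y \<omega>))\<^sup>2) * K)"
      by (intro AE_I2) (metis abs_ge_self order_trans real_norm_def)
  qed (use assms in measurable)
qed

lemma expectation_affine:
  assumes "sqint x"
  shows "expectation (\<lambda>\<omega>. A *v x \<omega> + c) = A *v expectation x + c"
  using integral_mult_vec[OF sqint_integrable[OF assms], of A] by (simp add: prob_space)

lemma expectation_centered: "sqint x \<Longrightarrow> expectation (\<lambda>\<omega>. x \<omega> - expectation x) = 0"
  using sqint_integrable[of x] by (simp add: prob_space)

lemma linear_congruence: "linear (\<lambda>X. A ** X ** transpose (A :: real ^ 'q ^ 'p))"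
  by (rule linearI) (simp_all add: matrix_algebra)

lemma cov_affine:
  assumes "sqint x"
  shows "cov (\<lambda>\<omega>. A *v x \<omega> + c) = A ** cov x ** transpose A"
proof -
  have "cov (\<lambda>\<omega>. A *v x \<omega> + c)
      = expectation (\<lambda>\<omega>. A ** outer (x \<omega> - expectation x) (x \<omega> - expectation x) ** transpose A)"
    unfolding cov_def expectation_affine[OF assms] congruence_outer
    by (simp add: matrix_vector_mult_diff_distrib)
  also have "\<dots> = A ** cov x ** transpose A"
    unfolding cov_def
    by (rule integral_linear_matrix(2)[OF _ linear_congruence])
      (intro sqint_outer sqint_diff_const assms)
  finally show ?thesis .
qed

lemma expectation_outer:
  assumes "sqint x"
  shows "expectation (\<lambda>\<omega>. outer (x \<omega>) (x \<omega>)) = cov x + outer (expectation x) (expectation x)"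
proof -
  define m where "m = expectation x"
  define \<xi> where "\<xi> = (\<lambda>\<omega>. x \<omega> - m)"
  have \<xi>: "sqint \<xi>" unfolding \<xi>_def by (rule sqint_diff_const[OF assms])
  have E\<xi>: "expectation \<xi> = 0" unfolding \<xi>_def m_def by (rule expectation_centered[OF assms])
  have i: "integrable M \<xi>" by (rule sqint_integrable[OF \<xi>])
  have "outer (x \<omega>) (x \<omega>) = outer (\<xi> \<omega>) (\<xi> \<omega>) + (outer (\<xi> \<omega>) m + (outer m (\<xi> \<omega>) + outer m m))" for \<omega>
    by (simp add: \<xi>_def outer.diff_left outer.diff_right)
  then have "expectation (\<lambda>\<omega>. outer (x \<omega>) (x \<omega>))
      = expectation (\<lambda>\<omega>. outer (\<xi> \<omega>) (\<xi> \<omega>) + (outer (\<xi> \<omega>) m + (outer m (\<xi> \<omega>) + outer m m)))"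
    by (simp only:)
  also have "\<dots> = expectation (\<lambda>\<omega>. outer (\<xi> \<omega>) (\<xi> \<omega>))
      + expectation (\<lambda>\<omega>. outer (\<xi> \<omega>) m + (outer m (\<xi> \<omega>) + outer m m))"
    by (intro Bochner_Integration.integral_add Bochner_Integration.integrable_add integrable_const
        sqint_outer \<xi> sqint_const)
  also have "expectation (\<lambda>\<omega>. outer (\<xi> \<omega>) m + (outer m (\<xi> \<omega>) + outer m m))
      = expectation (\<lambda>\<omega>. outer (\<xi> \<omega>) m) + expectation (\<lambda>\<omega>. outer m (\<xi> \<omega>) + outer m m)"
    by (intro Bochner_Integration.integral_add Bochner_Integration.integrable_add integrable_const
        sqint_outer \<xi> sqint_const)
  also have "expectation (\<lambda>\<omega>. outer m (\<xi> \<omega>) + outer m m)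
      = expectation (\<lambda>\<omega>. outer m (\<xi> \<omega>)) + expectation (\<lambda>\<omega>. outer m m)"
    by (intro Bochner_Integration.integral_add integrable_const sqint_outer \<xi> sqint_const)
  also have "expectation (\<lambda>\<omega>. outer (\<xi> \<omega>) m) = 0"
    using integral_bounded_linear[OF outer.bounded_linear_left i, of m] E\<xi> by (simp add: outer.zero_left)
  also have "expectation (\<lambda>\<omega>. outer m (\<xi> \<omega>)) = 0"
    using integral_bounded_linear[OF outer.bounded_linear_right i, of m] E\<xi> by (simp add: outer.zero_right)
  finally show ?thesis by (simp add: cov_def \<xi>_def m_def prob_space)
qed

lemma linear_trace_mult: "linear (\<lambda>X. trace ((N :: real ^ 'k ^ 'k) ** X))"
  by (rule linearI) (simp_all add: matrix_add_ldistrib trace_add matrix_scaleR_right trace_scaleR)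

lemma expectation_quad:
  assumes "sqint x"
  shows "integrable M (\<lambda>\<omega>. x \<omega> \<bullet> (N *v x \<omega>))"
    "expectation (\<lambda>\<omega>. x \<omega> \<bullet> (N *v x \<omega>)) = trace (N ** cov x) + expectation x \<bullet> (N *v expectation x)"
proof -
  note L = integral_linear_matrix[OF sqint_outer[OF assms assms] linear_trace_mult[of N]]
  show "integrable M (\<lambda>\<omega>. x \<omega> \<bullet> (N *v x \<omega>))" using L(1) by (simp add: trace_outer_mult)
  show "expectation (\<lambda>\<omega>. x \<omega> \<bullet> (N *v x \<omega>)) = trace (N ** cov x) + expectation x \<bullet> (N *v expectation x)"
    using L(2) by (simp add: trace_outer_mult expectation_outer[OF assms] matrix_add_ldistrib trace_add)
qed

lemma expectation_norm_square:
  assumes "sqint x"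
  shows "expectation (\<lambda>\<omega>. (norm (x \<omega>))\<^sup>2) = trace (moments x)"
  using expectation_quad(2)[OF assms, of "mat 1"]
  by (simp add: moments_def bdiag_def trace_blk trace_outer power2_norm_eq_inner)

lemma psd_cov:
  assumes "sqint x"
  shows "psd (cov x)"
proof -
  have c: "cov (\<lambda>\<omega>. x \<omega> - expectation x) = cov x"
    using cov_affine[OF assms, of "mat 1" "- expectation x"] by simp
  have i: "integrable M (\<lambda>\<omega>. outer (x \<omega> - expectation x) (x \<omega> - expectation x))"
    by (intro sqint_outer sqint_diff_const assms)
  have "transpose (cov x) = cov x"
    unfolding cov_def
    by (subst integral_linear_matrix(2)[OF i, symmetric])
      (auto intro!: linearI simp: transpose_add transpose_scalar transpose_outer)
  moreover have "v \<bullet> (cov x *v v) = expectation (\<lambda>\<omega>. (v \<bullet> (x \<omega> - expectation x))\<^sup>2)" for v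
  proof -
    have "linear (\<lambda>X. v \<bullet> (X *v v))"
      by (rule linearI) (simp_all add: matrix_vector_mult_add_rdistrib inner_add_right
          scaleR_matrix_vector_assoc[symmetric])
    from integral_linear_matrix(2)[OF i this] show ?thesis
      by (simp add: cov_def outer_mult_vec power2_eq_square inner_commute)
  qed
  ultimately show ?thesis by (simp add: psd_def sym_mat_def)
qed

lemma psd_moments: "sqint x \<Longrightarrow> psd (moments x)"
  unfolding moments_def by (intro psd_bdiag psd_outer psd_cov)

subsection \<open>One step of the dynamics\<close>

text \<open>Real Borel images on both sides let the product rule for real random variables apply to
  norms and to every coordinate of a vector- or matrix-valued function of \<open>x\<close>.\<close>

definition indep_of :: "('a \<Rightarrow> real ^ 'n) \<Rightarrow> ('a \<Rightarrow> real) \<Rightarrow> bool" where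
  "indep_of x v \<longleftrightarrow> (\<forall>G\<in>borel_measurable borel. \<forall>h\<in>borel_measurable borel.
     indep_var borel (\<lambda>\<omega>. G (x \<omega>) :: real) borel (\<lambda>\<omega>. h (v \<omega>)))"

lemma integral_indep_scaleR:
  fixes G :: "real ^ 'n \<Rightarrow> 'b::{second_countable_topology, banach, euclidean_space}"
    and h :: "real \<Rightarrow> real"
  assumes ind: "indep_of x v" and [measurable]: "G \<in> borel_measurable borel" "h \<in> borel_measurable borel"
    and f: "integrable M (\<lambda>\<omega>. G (x \<omega>))" and v: "integrable M (\<lambda>\<omega>. h (v \<omega>))"
  shows "integrable M (\<lambda>\<omega>. h (v \<omega>) *\<^sub>R G (x \<omega>))"
    "expectation (\<lambda>\<omega>. h (v \<omega>) *\<^sub>R G (x \<omega>)) = expectation (\<lambda>\<omega>. h (v \<omega>)) *\<^sub>R expectation (\<lambda>\<omega>. G (x \<omega>))"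
proof -
  have ib: "indep_var borel (\<lambda>\<omega>. g (G (x \<omega>))) borel (\<lambda>\<omega>. k (h (v \<omega>)))"
    if [measurable]: "g \<in> borel_measurable borel" "k \<in> borel_measurable borel" for g k :: "_ \<Rightarrow> real"
    using ind unfolding indep_of_def
    by (elim ballE[where x="\<lambda>y. g (G y)"] ballE[where x="\<lambda>y. k (h y)"]) auto
  have "integrable M (\<lambda>\<omega>. norm (G (x \<omega>)) * \<bar>h (v \<omega>)\<bar>)"
    by (rule indep_var_integrable[OF ib]) (use f v in auto)
  then show int: "integrable M (\<lambda>\<omega>. h (v \<omega>) *\<^sub>R G (x \<omega>))"
    by (rule Bochner_Integration.integrable_bound) (use f v in \<open>auto simp: mult.commute\<close>)
  show "expectation (\<lambda>\<omega>. h (v \<omega>) *\<^sub>R G (x \<omega>)) = expectation (\<lambda>\<omega>. h (v \<omega>)) *\<^sub>R expectation (\<lambda>\<omega>. G (x \<omega>))"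
  proof (rule euclidean_eqI)
    fix b :: 'b assume "b \<in> Basis"
    have "expectation (\<lambda>\<omega>. h (v \<omega>) *\<^sub>R G (x \<omega>)) \<bullet> b = expectation (\<lambda>\<omega>. (G (x \<omega>) \<bullet> b) * h (v \<omega>))"
      using integral_inner_left[of b M "\<lambda>\<omega>. h (v \<omega>) *\<^sub>R G (x \<omega>)"] int by (simp add: mult.commute)
    also have "\<dots> = expectation (\<lambda>\<omega>. G (x \<omega>) \<bullet> b) * expectation (\<lambda>\<omega>. h (v \<omega>))"
      by (rule indep_var_lebesgue_integral[OF ib[of "\<lambda>y. y \<bullet> b" "\<lambda>y. y"]]) (use f v in auto)
    also have "\<dots> = (expectation (\<lambda>\<omega>. h (v \<omega>)) *\<^sub>R expectation (\<lambda>\<omega>. G (x \<omega>))) \<bullet> b"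
      using f by (simp add: mult.commute)
    finally show "expectation (\<lambda>\<omega>. h (v \<omega>) *\<^sub>R G (x \<omega>)) \<bullet> b
      = (expectation (\<lambda>\<omega>. h (v \<omega>)) *\<^sub>R expectation (\<lambda>\<omega>. G (x \<omega>))) \<bullet> b" .
  qed
qed

text \<open>By independence, terms linear in \<open>v\<close> have mean zero and the quadratic one
  keeps weight one. The noise multiplies an uncentred vector, whose full second moment, mean
  included, therefore enters the covariance.\<close>

lemma moments_noisy_step:
  fixes x :: "'a \<Rightarrow> real ^ 'n" and A C :: "real ^ 'n ^ 'p" and a c :: "real ^ 'p"
  assumes x: "sqint x" and ind: "indep_of x v"
    and v: "integrable M v" "integrable M (\<lambda>\<omega>. (v \<omega>)\<^sup>2)" "expectation v = 0"
      "expectation (\<lambda>\<omega>. (v \<omega>)\<^sup>2) = 1"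
  defines "y \<equiv> \<lambda>\<omega>. (A *v x \<omega> + a) + v \<omega> *\<^sub>R (C *v x \<omega> + c)"
  shows "sqint y" "expectation y = A *v expectation x + a"
    "cov y = A ** cov x ** transpose A + C ** cov x ** transpose C
      + outer (C *v expectation x + c) (C *v expectation x + c)"
proof -
  define f where "f = (\<lambda>\<omega>. A *v x \<omega> + a)"
  define g where "g = (\<lambda>\<omega>. C *v x \<omega> + c)"
  have f: "sqint f" and g: "sqint g"
    unfolding f_def g_def by (intro sqint_add sqint_mult_vec x sqint_const)+
  have [measurable]: "x \<in> borel_measurable M" "v \<in> borel_measurable M"
    using x v by (auto simp: sqint_def)
  have vg: "integrable M (\<lambda>\<omega>. v \<omega> *\<^sub>R g \<omega>)" "expectation (\<lambda>\<omega>. v \<omega> *\<^sub>R g \<omega>) = 0"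
    using integral_indep_scaleR[OF ind, of "\<lambda>x. C *v x + c" "\<lambda>v. v"] sqint_integrable[OF g, unfolded g_def] v
    by (simp_all add: g_def)
  \<comment> \<open>The factor \<open>v\<close> may be unbounded; the product is square-integrable
    because \<open>v\<^sup>2\<close> and the squared norm of \<open>g\<close> are
    independent.\<close>
  have "integrable M (\<lambda>\<omega>. (v \<omega>)\<^sup>2 *\<^sub>R (norm (g \<omega>))\<^sup>2)"
    unfolding g_def
    by (rule integral_indep_scaleR(1)[OF ind, of "\<lambda>x. (norm (C *v x + c))\<^sup>2" "\<lambda>v. v\<^sup>2"])
      (use g v in \<open>simp_all add: sqint_def g_def\<close>)
  then have vg_sq: "sqint (\<lambda>\<omega>. v \<omega> *\<^sub>R g \<omega>)"
    by (simp add: sqint_def power_mult_distrib g_def)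
  have yfg: "y = (\<lambda>\<omega>. f \<omega> + v \<omega> *\<^sub>R g \<omega>)" by (simp add: y_def f_def g_def)
  show "sqint y" unfolding yfg by (rule sqint_add[OF f vg_sq])
  have Ey: "expectation y = expectation f"
  proof -
    have "expectation y = expectation f + expectation (\<lambda>\<omega>. v \<omega> *\<^sub>R g \<omega>)"
      unfolding yfg by (rule Bochner_Integration.integral_add[OF sqint_integrable[OF f] vg(1)])
    then show ?thesis by (simp only: vg(2) add_0_right)
  qed
  then show "expectation y = A *v expectation x + a"
    by (simp add: f_def expectation_affine[OF x])
  define f0 where "f0 = (\<lambda>\<omega>. f \<omega> - expectation f)"
  have f0: "sqint f0" unfolding f0_def by (rule sqint_diff_const[OF f])
  define N1 where "N1 = (\<lambda>\<omega>. outer (f0 \<omega>) (g \<omega>) + outer (g \<omega>) (f0 \<omega>))"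
  define N2 where "N2 = (\<lambda>\<omega>. outer (g \<omega>) (g \<omega>))"
  have N: "integrable M N1" "integrable M N2"
    unfolding N1_def N2_def by (intro Bochner_Integration.integrable_add sqint_outer f0 g)+
  have i1: "integrable M (\<lambda>\<omega>. v \<omega> *\<^sub>R N1 \<omega>)" "expectation (\<lambda>\<omega>. v \<omega> *\<^sub>R N1 \<omega>) = 0"
    using integral_indep_scaleR[OF ind, of "\<lambda>x. outer (A *v x + a - expectation f) (C *v x + c)
        + outer (C *v x + c) (A *v x + a - expectation f)" "\<lambda>v. v"] N(1) v
    by (simp_all add: N1_def f0_def f_def g_def)
  have i2: "integrable M (\<lambda>\<omega>. (v \<omega>)\<^sup>2 *\<^sub>R N2 \<omega>)" "expectation (\<lambda>\<omega>. (v \<omega>)\<^sup>2 *\<^sub>R N2 \<omega>) = expectation N2"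
    using integral_indep_scaleR[OF ind, of "\<lambda>x. outer (C *v x + c) (C *v x + c)" "\<lambda>v. v\<^sup>2"] N(2) v
    by (simp_all add: N2_def g_def)
  have "outer (y \<omega> - expectation y) (y \<omega> - expectation y)
      = outer (f0 \<omega>) (f0 \<omega>) + (v \<omega> *\<^sub>R N1 \<omega> + (v \<omega>)\<^sup>2 *\<^sub>R N2 \<omega>)" for \<omega>
  proof -
    have "y \<omega> - expectation y = f0 \<omega> + v \<omega> *\<^sub>R g \<omega>" by (simp only: Ey f0_def) (simp add: yfg)
    then show ?thesis
      by (simp add: N1_def N2_def outer.add_left outer.add_right outer.scaleR_left outer.scaleR_right
          scaleR_add_right power2_eq_square)
  qed
  then have "cov y = cov f + (0 + expectation N2)"
    unfolding cov_def using sqint_outer[OF f0 f0] i1 i2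
    by (simp add: f0_def Bochner_Integration.integral_add)
  also have "cov f = A ** cov x ** transpose A" unfolding f_def by (rule cov_affine[OF x])
  also have "expectation N2 = C ** cov x ** transpose C + outer (C *v expectation x + c) (C *v expectation x + c)"
    unfolding N2_def expectation_outer[OF g] by (simp add: g_def cov_affine[OF x] expectation_affine[OF x])
  finally show "cov y = A ** cov x ** transpose A + C ** cov x ** transpose C
      + outer (C *v expectation x + c) (C *v expectation x + c)" by (simp add: add_ac)
qed

lemma moments_closed_loop_step:
  fixes s :: "('n::finite, 'm::finite) mf_system"
  assumes x: "sqint x" and ind: "indep_of x v"
    and v: "integrable M v" "integrable M (\<lambda>\<omega>. (v \<omega>)\<^sup>2)" "expectation v = 0"
      "expectation (\<lambda>\<omega>. (v \<omega>)\<^sup>2) = 1"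
  shows "sqint (mf_step M s v x (feedback M F Fb x))"
    "moments (mf_step M s v x (feedback M F Fb x)) = mf_adj s F Fb (moments x)"
proof -
  define m where "m = expectation x"
  \<comment> \<open>The vectors \<open>a\<close> and \<open>c\<close> collect the deterministic
    contributions of \<open>Ex\<close> and \<open>Eu\<close>. Added to the part acting on the mean
    state, they turn the plain coefficients into the hatted ones.\<close>
  define a where "a = (mfA1b s + mfB1 s ** Fb + mfB1b s ** (F + Fb)) *v m"
  define c where "c = (mfA2b s + mfB2 s ** Fb + mfB2b s ** (F + Fb)) *v m"
  have Eu: "expectation (feedback M F Fb x) = (F + Fb) *v m"
    by (simp add: feedback_def expectation_affine[OF x] m_def matrix_vector_mult_add_rdistrib)
  have step: "mf_step M s v x (feedback M F Fb x)
      = (\<lambda>\<omega>. ((mfA1 s + mfB1 s ** F) *v x \<omega> + a) + v \<omega> *\<^sub>R ((mfA2 s + mfB2 s ** F) *v x \<omega> + c))"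
    unfolding mf_step_def Eu
    by (simp add: feedback_def m_def[symmetric] a_def c_def Let_def fun_eq_iff
        matrix_vector_mult_add_rdistrib matrix_vector_right_distrib matrix_vector_mul_assoc add_ac
        matrix_add_ldistrib)
  note S = moments_noisy_step[OF x ind v, of "mfA1 s + mfB1 s ** F" a "mfA2 s + mfB2 s ** F" c,
      folded step]
  show "sqint (mf_step M s v x (feedback M F Fb x))" by (rule S(1))
  have am: "(mfA1 s + mfB1 s ** F) *v m + a = (hatA1 s + hatB1 s ** (F + Fb)) *v m"
    "(mfA2 s + mfB2 s ** F) *v m + c = (hatA2 s + hatB2 s ** (F + Fb)) *v m"
    by (simp_all add: a_def c_def hatA1_def hatA2_def hatB1_def hatB2_def matrix_add_ldistrib
        matrix_add_rdistrib matrix_vector_mult_add_rdistrib add_ac)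
  show "moments (mf_step M s v x (feedback M F Fb x)) = mf_adj s F Fb (moments x)"
    unfolding moments_def S(2,3) mf_adj_bdiag congruence_outer m_def[symmetric] am
    by simp
qed

end

section \<open>The closed loop\<close>

text \<open>The expectations are constants whatever their values, so this form is available for
  measurability before any integrability is known.\<close>

lemma mf_step_affine:
  "\<exists>A a C c. mf_step M s v x (feedback M F Fb x) = (\<lambda>\<omega>. (A *v x \<omega> + a) + v \<omega> *\<^sub>R (C *v x \<omega> + c))"
proof -
  define m where "m = prob_space.expectation M x"
  define u where "u = prob_space.expectation M (feedback M F Fb x)"
  have "mf_step M s v x (feedback M F Fb x) = (\<lambda>\<omega>.
      ((mfA1 s + mfB1 s ** F) *v x \<omega> + (mfA1b s *v m + mfB1 s *v (Fb *v m) + mfB1b s *v u))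
      + v \<omega> *\<^sub>R ((mfA2 s + mfB2 s ** F) *v x \<omega> + (mfA2b s *v m + mfB2 s *v (Fb *v m) + mfB2b s *v u)))"
    unfolding mf_step_def u_def[symmetric] m_def[symmetric] Let_def
    by (simp add: feedback_def m_def[symmetric] matrix_vector_mult_add_rdistrib
        matrix_vector_right_distrib matrix_vector_mul_assoc[symmetric] add_ac)
  then show ?thesis by blast
qed

text \<open>Only noise with index strictly below \<open>k\<close> enters the state at time
  \<open>k\<close>, which is what makes it independent of \<open>w k\<close>.\<close>

lemma closed_loop_as_function:
  "\<exists>H. case_prod H \<in> borel_measurable (borel \<Otimes>\<^sub>M (\<Pi>\<^sub>M i\<in>{..<k}. borel)) \<and>
    (\<forall>\<omega>. closed_loop M s w F Fb z k \<omega> = H (z \<omega>) (\<lambda>i\<in>{..<k}. w i \<omega>))"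
proof (induction k)
  case 0
  show ?case by (intro exI[of _ "\<lambda>x f. x"]) auto
next
  case (Suc k)
  then obtain H where [measurable]: "case_prod H \<in> borel_measurable (borel \<Otimes>\<^sub>M (\<Pi>\<^sub>M i\<in>{..<k}. borel))"
    and H: "\<And>\<omega>. closed_loop M s w F Fb z k \<omega> = H (z \<omega>) (\<lambda>i\<in>{..<k}. w i \<omega>)" by blast
  obtain A a C c where st: "closed_loop M s w F Fb z (Suc k)
      = (\<lambda>\<omega>. (A *v closed_loop M s w F Fb z k \<omega> + a) + w k \<omega> *\<^sub>R (C *v closed_loop M s w F Fb z k \<omega> + c))"
    unfolding closed_loop.simps using mf_step_affine by blast
  define G where "G x f = (A *v H x (restrict f {..<k}) + a) + f k *\<^sub>R (C *v H x (restrict f {..<k}) + c)"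
    for x and f :: "nat \<Rightarrow> real"
  have "(\<lambda>p. (fst p, restrict (snd p) {..<k}))
      \<in> borel \<Otimes>\<^sub>M (\<Pi>\<^sub>M i\<in>{..<Suc k}. borel) \<rightarrow>\<^sub>M (borel :: (real ^ 'a) measure) \<Otimes>\<^sub>M (\<Pi>\<^sub>M i\<in>{..<k}. (borel :: real measure))"
    by (intro measurable_Pair measurable_fst measurable_compose[OF measurable_snd]
        measurable_restrict_subset) auto
  from measurable_compose[OF this, of "case_prod H" borel]
  have [measurable]: "(\<lambda>p. H (fst p) (restrict (snd p) {..<k})) \<in> borel_measurable (borel \<Otimes>\<^sub>M (\<Pi>\<^sub>M i\<in>{..<Suc k}. borel))"
    by simp
  have [measurable]: "(\<lambda>p. snd p k) \<in> borel_measurable (borel \<Otimes>\<^sub>M (\<Pi>\<^sub>M i\<in>{..<Suc k}. (borel :: real measure)))"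
    by (intro measurable_compose[OF measurable_snd] measurable_component_singleton) simp
  have "case_prod G \<in> borel_measurable (borel \<Otimes>\<^sub>M (\<Pi>\<^sub>M i\<in>{..<Suc k}. borel))"
    unfolding G_def split_beta' by measurable
  moreover have "closed_loop M s w F Fb z (Suc k) \<omega> = G (z \<omega>) (\<lambda>i\<in>{..<Suc k}. w i \<omega>)" for \<omega>
  proof -
    have "restrict (\<lambda>i\<in>{..<Suc k}. w i \<omega>) {..<k} = (\<lambda>i\<in>{..<k}. w i \<omega>)"
      by (auto simp: restrict_def fun_eq_iff)
    then show ?thesis by (simp only: st G_def H) simp
  qed
  ultimately show ?case by blast
qed

lemma uncontrolled_eq_closed_loop: "uncontrolled M s w z k = closed_loop M s w 0 0 z k"
  by (induction k) (simp_all add: feedback_def)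

context prob_space
begin

text \<open>Independence of \<open>z\<close> from the whole noise sequence and of the past noise
  from \<open>w k\<close> combine on rectangles: \<open>prob (a1 \<inter> (a2 \<inter> b)) = prob a1
  * prob (a2 \<inter> b) = prob a1 * (prob a2 * prob b)\<close>. Rectangles are stable under
  intersection and generate the product sigma-algebra.\<close>

lemma indep_past_noise:
  assumes noise: "noise M w" and z: "z \<in> initial_states M w"
    and H [measurable]: "case_prod H \<in> borel_measurable (borel \<Otimes>\<^sub>M (\<Pi>\<^sub>M i\<in>{..<k}. borel))"
  shows "indep_of (\<lambda>\<omega>. H (z \<omega>) (\<lambda>i\<in>{..<k}. w i \<omega>) :: real ^ 'n) (w k)"
proof -
  let ?P = "\<Pi>\<^sub>M i\<in>{..<k}. (borel :: real measure)"
  define Z where "Z = (\<lambda>\<omega>. (z \<omega>, \<lambda>i\<in>{..<k}. w i \<omega>))"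
  have zm [measurable]: "z \<in> borel_measurable M" using z by (simp add: initial_states_def)
  have wi: "indep_vars (\<lambda>_. borel) w UNIV" using noise by (simp add: noise_def)
  have wm [measurable]: "w i \<in> borel_measurable M" for i
    using wi by (auto simp: indep_vars_def)
  have Zm [measurable]: "Z \<in> M \<rightarrow>\<^sub>M borel \<Otimes>\<^sub>M ?P" unfolding Z_def by measurable
  define \<G> where "\<G> = {Z -` A \<inter> space M |A. A \<in> {a \<times> b |a b. a \<in> sets borel \<and> b \<in> sets ?P}}"
  define \<H> where "\<H> = {w k -` C \<inter> space M |C. C \<in> sets borel}"
  have zind: "indep_set {z -` S \<inter> space M |S. S \<in> sets borel}
      {(\<lambda>\<omega> i. w i \<omega>) -` S \<inter> space M |S. S \<in> sets (Pi\<^sub>M UNIV (\<lambda>_. borel))}"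
    using z by (simp add: initial_states_def)
  have "prob (a \<inter> b) = prob a * prob b" if mem: "a \<in> \<G>" "b \<in> \<H>" for a b
  proof -
    obtain S T where a: "a = Z -` (S \<times> T) \<inter> space M" and S [measurable]: "S \<in> sets borel" and T [measurable]: "T \<in> sets ?P"
      using mem(1) unfolding \<G>_def by blast
    obtain C where b: "b = w k -` C \<inter> space M" and [measurable]: "C \<in> sets borel"
      using mem(2) unfolding \<H>_def by blast
    define a1 where "a1 = z -` S \<inter> space M"
    define a2 where "a2 = (\<lambda>\<omega>. \<lambda>i\<in>{..<k}. w i \<omega>) -` T \<inter> space M"
    let ?W = "\<lambda>\<omega> i. w i \<omega>" and ?PU = "Pi\<^sub>M UNIV (\<lambda>_. borel :: real measure)"
    define T' where "T' = (\<lambda>f. restrict f {..<k}) -` T \<inter> space ?PU"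
    define C' where "C' = (\<lambda>f :: nat \<Rightarrow> real. f k) -` C \<inter> space ?PU"
    have rT: "T' \<in> sets ?PU"
      unfolding T'_def by (rule measurable_sets[OF _ T]) (intro measurable_restrict_subset, simp)
    have rC: "C' \<in> sets ?PU"
      unfolding C'_def by (rule measurable_sets[OF measurable_component_singleton]) auto
    have a2': "a2 = ?W -` T' \<inter> space M"
      by (auto simp: a2_def T'_def space_PiM)
    have b': "a2 \<inter> b = ?W -` (T' \<inter> C') \<inter> space M"
      by (auto simp: a2_def b T'_def C'_def space_PiM)
    have in1: "a1 \<in> {z -` S \<inter> space M |S. S \<in> sets borel}" 
      by (rule CollectI, rule exI, rule conjI[OF a1_def S])
    have in2: "a2 \<in> {?W -` S \<inter> space M |S. S \<in> sets ?PU}"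
      by (rule CollectI, rule exI, rule conjI[OF a2' rT])
    \<comment> \<open>The past event and the event of \<open>w k\<close> together are one event of
      the noise sequence, so independence of \<open>z\<close> from that sequence covers their
      intersection.\<close>
    have in3: "a2 \<inter> b \<in> {?W -` S \<inter> space M |S. S \<in> sets ?PU}"
      by (rule CollectI, rule exI, rule conjI[OF b' sets.Int[OF rT rC]])
    have ab: "a = a1 \<inter> a2" by (auto simp: a a1_def a2_def Z_def)
    have U: "indep_var ?P (\<lambda>\<omega>. \<lambda>i\<in>{..<k}. w i \<omega>) (\<Pi>\<^sub>M i\<in>{k}. borel) (\<lambda>\<omega>. \<lambda>i\<in>{k}. w i \<omega>)"
      by (rule indep_var_restrict[OF wi]) auto
    define D where "D = (\<lambda>f. f k) -` C \<inter> space (\<Pi>\<^sub>M i\<in>{k}. (borel :: real measure))"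
    have "D \<in> sets (\<Pi>\<^sub>M i\<in>{k}. borel)"
      unfolding D_def by (rule measurable_sets[OF measurable_component_singleton]) auto
    from indep_varD[OF U T this]
    have "prob ((\<lambda>\<omega>. (\<lambda>i\<in>{..<k}. w i \<omega>, \<lambda>i\<in>{k}. w i \<omega>)) -` (T \<times> D) \<inter> space M)
      = prob a2 * prob ((\<lambda>\<omega>. \<lambda>i\<in>{k}. w i \<omega>) -` D \<inter> space M)" unfolding a2_def .
    moreover have "(\<lambda>\<omega>. \<lambda>i\<in>{k}. w i \<omega>) -` D \<inter> space M = b"
      by (auto simp: D_def b space_PiM)
    moreover have "(\<lambda>\<omega>. (\<lambda>i\<in>{..<k}. w i \<omega>, \<lambda>i\<in>{k}. w i \<omega>)) -` (T \<times> D) \<inter> space M = a2 \<inter> b"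
      by (auto simp: D_def b a2_def space_PiM)
    ultimately have "prob (a2 \<inter> b) = prob a2 * prob b" by simp
    moreover have "prob (a1 \<inter> (a2 \<inter> b)) = prob a1 * prob (a2 \<inter> b)" by (rule indep_setD[OF zind in1 in3])
    moreover have "prob (a1 \<inter> a2) = prob a1 * prob a2" by (rule indep_setD[OF zind in1 in2])
    ultimately show ?thesis by (simp add: ab Int_assoc)
  qed
  then have "indep_set \<G> \<H>"
    by (intro indep_setI) (auto simp: \<G>_def \<H>_def)
  moreover have "Int_stable \<G>"
  proof (rule Int_stableI)
    fix a b assume "a \<in> \<G>" "b \<in> \<G>"
    then obtain S T S' T' where "a = Z -` (S \<times> T) \<inter> space M" "S \<in> sets borel" "T \<in> sets ?P"
      "b = Z -` (S' \<times> T') \<inter> space M" "S' \<in> sets borel" "T' \<in> sets ?P"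
      unfolding \<G>_def by blast
    then have "a \<inter> b = Z -` ((S \<inter> S') \<times> (T \<inter> T')) \<inter> space M" "S \<inter> S' \<in> sets borel" "T \<inter> T' \<in> sets ?P"
      by auto
    then show "a \<inter> b \<in> \<G>" unfolding \<G>_def by blast
  qed
  moreover have "Int_stable \<H>"
  proof (rule Int_stableI)
    fix a b assume "a \<in> \<H>" "b \<in> \<H>"
    then obtain C C' where "a = w k -` C \<inter> space M" "b = w k -` C' \<inter> space M" "C \<in> sets borel" "C' \<in> sets borel"
      unfolding \<H>_def by blast
    then have "a \<inter> b = w k -` (C \<inter> C') \<inter> space M" "C \<inter> C' \<in> sets borel" by auto
    then show "a \<inter> b \<in> \<H>" unfolding \<H>_def by blast
  qed
  ultimately have ind: "indep_set (sigma_sets (space M) \<G>) (sigma_sets (space M) \<H>)"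
    by (rule indep_set_sigma_sets)
  have \<G>: "{Z -` A \<inter> space M |A. A \<in> sets (borel \<Otimes>\<^sub>M ?P)} = sigma_sets (space M) \<G>"
    unfolding \<G>_def sets_pair_measure
    by (rule sigma_sets_vimage_commute) (use measurable_space[OF Zm] in \<open>auto simp: space_pair_measure\<close>)
  show ?thesis
    unfolding indep_of_def
  proof (intro ballI)
    fix G :: "real ^ 'n \<Rightarrow> real" and h :: "real \<Rightarrow> real"
    assume [measurable]: "G \<in> borel_measurable borel" "h \<in> borel_measurable borel"
    define X where "X = (\<lambda>\<omega>. G (H (z \<omega>) (\<lambda>i\<in>{..<k}. w i \<omega>)))"
    have XZ: "X = (\<lambda>p. G (case_prod H p)) \<circ> Z" by (simp add: X_def Z_def fun_eq_iff)
    have [measurable]: "X \<in> borel_measurable M"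
      unfolding XZ by (rule measurable_comp[OF Zm]) measurable
    have "{X -` A \<inter> space M |A. A \<in> sets borel} \<subseteq> sigma_sets (space M) \<G>"
    proof
      fix a assume "a \<in> {X -` A \<inter> space M |A. A \<in> sets borel}"
      then obtain A where A: "a = X -` A \<inter> space M" "A \<in> sets borel" by blast
      have m: "(\<lambda>p. G (case_prod H p)) \<in> borel_measurable (borel \<Otimes>\<^sub>M ?P)" by measurable
      have "a = Z -` ((\<lambda>p. G (case_prod H p)) -` A \<inter> space (borel \<Otimes>\<^sub>M ?P)) \<inter> space M"
        using measurable_space[OF Zm] by (auto simp: A(1) XZ)
      then show "a \<in> sigma_sets (space M) \<G>"
        unfolding \<G>[symmetric] using measurable_sets[OF m A(2)] by blast
    qed
    then have 1: "sigma_sets (space M) {X -` A \<inter> space M |A. A \<in> sets borel} \<subseteq> sigma_sets (space M) \<G>"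
      by (rule sigma_sets_mono)
    have "{(\<lambda>\<omega>. h (w k \<omega>)) -` A \<inter> space M |A. A \<in> sets borel} \<subseteq> sigma_sets (space M) \<H>"
    proof
      fix a assume "a \<in> {(\<lambda>\<omega>. h (w k \<omega>)) -` A \<inter> space M |A. A \<in> sets borel}"
      then obtain A where A: "a = (\<lambda>\<omega>. h (w k \<omega>)) -` A \<inter> space M" "A \<in> sets borel" by blast
      have "h -` A \<in> sets borel" using measurable_sets[of h borel borel A] A by simp
      moreover have "a = w k -` (h -` A) \<inter> space M" by (auto simp: A(1))
      ultimately show "a \<in> sigma_sets (space M) \<H>" unfolding \<H>_def by blast
    qed
    then have 2: "sigma_sets (space M) {(\<lambda>\<omega>. h (w k \<omega>)) -` A \<inter> space M |A. A \<in> sets borel} \<subseteq> sigma_sets (space M) \<H>"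
      by (rule sigma_sets_mono)
    have "indep_var borel X borel (\<lambda>\<omega>. h (w k \<omega>))"
      unfolding indep_var_eq
    proof (intro conjI)
      show "indep_set (sigma_sets (space M) {X -` A \<inter> space M |A. A \<in> sets borel})
         (sigma_sets (space M) {(\<lambda>\<omega>. h (w k \<omega>)) -` A \<inter> space M |A. A \<in> sets borel})"
        using ind 1 2 unfolding indep_sets2_eq by (meson subset_eq)
    qed measurable
    then show "indep_var borel (\<lambda>\<omega>. G (H (z \<omega>) (\<lambda>i\<in>{..<k}. w i \<omega>))) borel (\<lambda>\<omega>. h (w k \<omega>))"
      by (simp only: X_def)
  qed
qed

lemma closed_loop_moments:
  assumes noise: "noise M w" and z: "z \<in> initial_states M w"
  shows "sqint (closed_loop M s w F Fb z k)"
    "moments (closed_loop M s w F Fb z k) = (mf_adj s F Fb ^^ k) (moments z)"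
proof -
  have "sqint (closed_loop M s w F Fb z k) \<and>
    moments (closed_loop M s w F Fb z k) = (mf_adj s F Fb ^^ k) (moments z)"
  proof (induction k)
    case 0
    show ?case using z by (simp add: initial_states_def sqint_def)
  next
    case (Suc k)
    define x where "x = closed_loop M s w F Fb z k"
    obtain H where H: "case_prod H \<in> borel_measurable (borel \<Otimes>\<^sub>M (\<Pi>\<^sub>M i\<in>{..<k}. borel))"
      "\<And>\<omega>. x \<omega> = H (z \<omega>) (\<lambda>i\<in>{..<k}. w i \<omega>)"
      using closed_loop_as_function unfolding x_def by blast
    have "x = (\<lambda>\<omega>. H (z \<omega>) (\<lambda>i\<in>{..<k}. w i \<omega>))" using H(2) by blast
    then have ind: "indep_of x (w k)" using indep_past_noise[OF noise z H(1)] by simp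
    have w0: "integrable M (w k)" "integrable M (\<lambda>\<omega>. (w k \<omega>)\<^sup>2)" "expectation (w k) = 0"
      "variance (w k) = 1"
      using noise unfolding noise_def by blast+
    have w: "integrable M (w k)" "integrable M (\<lambda>\<omega>. (w k \<omega>)\<^sup>2)" "expectation (w k) = 0"
      "expectation (\<lambda>\<omega>. (w k \<omega>)\<^sup>2) = 1"
      using w0(1,2,3) w0(4)[unfolded w0(3)] by simp_all
    show ?case
      using moments_closed_loop_step[OF _ ind w, of s F Fb] Suc by (simp add: x_def)
  qed
  then show "sqint (closed_loop M s w F Fb z k)"
    "moments (closed_loop M s w F Fb z k) = (mf_adj s F Fb ^^ k) (moments z)" by blast+
qed

lemma ms_vanishing_iff:
  assumes "noise M w" "z \<in> initial_states M w"
  shows "ms_vanishing M (closed_loop M s w F Fb z) \<longleftrightarrow>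
    (\<lambda>k. trace ((mf_adj s F Fb ^^ k) (moments z))) \<longlonglongrightarrow> 0"
  unfolding ms_vanishing_def expectation_norm_square[OF closed_loop_moments(1)[OF assms]]
    closed_loop_moments(2)[OF assms] ..

section \<open>Stage cost and infinite-horizon cost as traces\<close>

lemma stage_cost_eq:
  assumes x: "sqint x"
  shows "stage_cost M s x (feedback M F Fb x) = trace (closed_weight s F Fb ** moments x)"
proof -
  define m where "m = expectation x"
  define u where "u = feedback M F Fb x"
  have u: "u = (\<lambda>\<omega>. F *v x \<omega> + Fb *v m)" by (simp add: u_def feedback_def m_def)
  have squ: "sqint u" unfolding u by (intro sqint_add sqint_mult_vec x sqint_const)
  have Eu: "expectation u = (F + Fb) *v m"
    by (simp add: u expectation_affine[OF x] m_def matrix_vector_mult_add_rdistrib)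
  have cu: "cov u = F ** cov x ** transpose F" unfolding u by (rule cov_affine[OF x])
  have q: "vstack y t \<bullet> (Lam s *v vstack y t) = y \<bullet> (mfQ s *v y) + t \<bullet> (mfR s *v t)"
    "vstack y t \<bullet> (Lamb s *v vstack y t) = y \<bullet> (mfQb s *v y) + t \<bullet> (mfRb s *v t)" for y t
    by (simp_all add: Lam_def Lamb_def quad_bdiag)
  have "stage_cost M s x u = expectation (\<lambda>\<omega>. (x \<omega> \<bullet> (mfQ s *v x \<omega>) + u \<omega> \<bullet> (mfR s *v u \<omega>))
      + (m \<bullet> (mfQb s *v m) + expectation u \<bullet> (mfRb s *v expectation u)))"
    unfolding stage_cost_def Let_def q m_def ..
  also have "\<dots> = (expectation (\<lambda>\<omega>. x \<omega> \<bullet> (mfQ s *v x \<omega>)) + expectation (\<lambda>\<omega>. u \<omega> \<bullet> (mfR s *v u \<omega>)))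
      + (m \<bullet> (mfQb s *v m) + expectation u \<bullet> (mfRb s *v expectation u))"
    using expectation_quad(1)[OF x] expectation_quad(1)[OF squ] by (simp add: prob_space)
  also have "\<dots> = trace (mfQ s ** cov x) + trace (mfR s ** cov u) + m \<bullet> (hatQ s *v m)
      + expectation u \<bullet> (hatR s *v expectation u)"
    by (simp add: expectation_quad(2)[OF x] expectation_quad(2)[OF squ] hatQ_def hatR_def m_def
        matrix_vector_mult_add_rdistrib inner_add_right)
  also have "\<dots> = trace (closed_weight s F Fb ** moments x)"
  proof -
    have "trace (mfR s ** cov u) = trace (transpose F ** mfR s ** F ** cov x)"
      unfolding cu by (metis matrix_mul_assoc trace_mul_sym)
    moreover have "expectation u \<bullet> (hatR s *v expectation u)
        = trace (transpose (F + Fb) ** hatR s ** (F + Fb) ** outer m m)"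
      unfolding Eu trace_outer_mult inner_congruence ..
    ultimately show ?thesis
      by (simp add: closed_weight_def moments_def trace_bdiag_mult m_def[symmetric]
          matrix_add_rdistrib trace_add trace_outer_mult)
  qed
  finally show ?thesis by (simp add: u_def)
qed

lemma cost_J_eq:
  assumes noise: "noise M w" and z: "z \<in> initial_states M w" and st: "(F, Fb) \<in> stab_gains s"
    and sym: "sym_mat (mfQ s)" "sym_mat (mfQb s)" "sym_mat (mfR s)" "sym_mat (mfRb s)"
  shows "cost_J M s w z F Fb = ereal (trace (cost_mat s F Fb ** moments z))"
proof -
  define Y where "Y k = (mf_adj s F Fb ^^ k) (moments z)" for k
  define a where "a k = trace (cost_mat s F Fb ** Y k)" for k
  have sqz: "sqint z" using z by (simp add: initial_states_def sqint_def)
  have "Y \<longlonglongrightarrow> 0"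
    using decays_congr3_adj[OF st[unfolded stab_gains_iff]] psd_sym[OF psd_moments[OF sqz]]
    unfolding decays_def Y_def by blast
  then have a0: "a \<longlonglongrightarrow> 0"
    unfolding a_def using tendsto_trace[OF tendsto_matrix_mult[OF tendsto_const], of Y 0 sequentially "cost_mat s F Fb"]
    by simp
  \<comment> \<open>The sequence \<open>a\<close> is a potential: by the Lyapunov equation and
    adjointness its decrease in one step is the stage cost.\<close>
  have "stage_cost M s (closed_loop M s w F Fb z k) (feedback M F Fb (closed_loop M s w F Fb z k))
      = a k - a (Suc k)" for k
  proof -
    have "a k = trace (mf_op s F Fb (cost_mat s F Fb) ** Y k) + trace (closed_weight s F Fb ** Y k)"
      unfolding a_def using cost_mat(2)[OF sym st] by (metis matrix_add_rdistrib trace_add)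
    moreover have "trace (mf_op s F Fb (cost_mat s F Fb) ** Y k) = a (Suc k)"
    proof -
      have "Y (Suc k) = mf_adj s F Fb (Y k)" by (simp add: Y_def)
      then show ?thesis
        unfolding a_def trace_mul_sym[of "mf_op s F Fb (cost_mat s F Fb)"]
          trace_mul_sym[of "cost_mat s F Fb" "Y (Suc k)"] by (simp only: trace_congr3)
    qed
    ultimately show ?thesis
      unfolding stage_cost_eq[OF closed_loop_moments(1)[OF noise z]] closed_loop_moments(2)[OF noise z]
      by (simp add: Y_def)
  qed
  then have "(\<lambda>k. stage_cost M s (closed_loop M s w F Fb z k) (feedback M F Fb (closed_loop M s w F Fb z k)))
      sums (a 0 - 0)"
    using telescope_sums'[OF a0] by simp
  then have "(\<lambda>k. ereal (stage_cost M s (closed_loop M s w F Fb z k) (feedback M F Fb (closed_loop M s w F Fb z k))))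
      sums ereal (a 0)"
    by (simp add: sums_ereal)
  then show ?thesis
    unfolding cost_J_def by (simp add: sums_iff a_def Y_def)
qed

lemma initial_states_affine:
  assumes "z \<in> initial_states M w"
  shows "(\<lambda>\<omega>. A *v z \<omega> + c) \<in> initial_states M w"
proof -
  let ?y = "\<lambda>\<omega>. A *v z \<omega> + c"
  have sq: "sqint z" using assms by (simp add: initial_states_def sqint_def)
  then have "sqint ?y" by (intro sqint_add sqint_mult_vec sqint_const)
  moreover have "indep_set {?y -` S \<inter> space M |S. S \<in> sets borel}
      {(\<lambda>\<omega> k. w k \<omega>) -` S \<inter> space M |S. S \<in> sets (Pi\<^sub>M UNIV (\<lambda>_. borel))}"
  proof -
    have "{?y -` S \<inter> space M |S. S \<in> sets borel} \<subseteq> {z -` S \<inter> space M |S. S \<in> sets borel}"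
    proof
      fix a assume "a \<in> {?y -` S \<inter> space M |S. S \<in> sets borel}"
      then obtain S where S: "a = ?y -` S \<inter> space M" "S \<in> sets borel" by blast
      have "(\<lambda>x. A *v x + c) \<in> borel_measurable borel" by measurable
      from measurable_sets[OF this S(2)] have "(\<lambda>x. A *v x + c) -` S \<in> sets borel" by simp
      moreover have "a = z -` ((\<lambda>x. A *v x + c) -` S) \<inter> space M" by (auto simp: S(1))
      ultimately show "a \<in> {z -` S \<inter> space M |S. S \<in> sets borel}" by blast
    qed
    moreover have "indep_set {z -` S \<inter> space M |S. S \<in> sets borel}
      {(\<lambda>\<omega> k. w k \<omega>) -` S \<inter> space M |S. S \<in> sets (Pi\<^sub>M UNIV (\<lambda>_. borel))}"
      using assms by (simp add: initial_states_def)
    ultimately show ?thesis unfolding indep_sets2_eq by (meson subset_eq)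
  qed
  ultimately show ?thesis by (simp add: initial_states_def sqint_def)
qed

end

section \<open>Stabilizability and detectability in matrix form\<close>

lemma gram_eq_sum_outer: "R ** transpose R = (\<Sum>i\<in>UNIV. outer (column i R) (column i R))"
  by (rule matrix_eq_entries)
    (simp add: matrix_matrix_mult_def transpose_def outer_def column_def sum_component)

lemma outer_sandwich: "outer v e ** X ** outer e v = (e \<bullet> (X *v e)) *\<^sub>R outer v v"
  for v :: "real ^ 'p" and e :: "real ^ 'q"
proof (rule matrix_eq[THEN iffD2], rule allI)
  fix u
  have "(outer v e ** X ** outer e v) *v u = outer v e *v (X *v (outer e v *v u))"
    by (simp only: matrix_vector_mul_assoc matrix_mul_assoc)
  then show "(outer v e ** X ** outer e v) *v u = ((e \<bullet> (X *v e)) *\<^sub>R outer v v) *v u"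
    by (simp add: outer_mult_vec scaleR_matrix_vector_assoc[symmetric] matrix_vector_mult_scaleR)
qed

lemma bdiag_add: "bdiag (A + A') (B + B') = bdiag A B + bdiag A' B'"
  by (simp add: bdiag_def blk_add)

lemma bdiag_sum: "bdiag (\<Sum>i\<in>I. f i) (\<Sum>i\<in>I. g i) = (\<Sum>i\<in>I. bdiag (f i) (g i))"
  by (induction I rule: infinite_finite_induct) (simp_all add: bdiag_add, simp_all add: bdiag_def)

lemma trace_sum: "trace (\<Sum>i\<in>I. f i) = (\<Sum>i\<in>I. trace (f i :: real ^ 'k ^ 'k))"
  by (induction I rule: infinite_finite_induct) (simp_all add: trace_add)

lemma mult_sum_matrix: "X ** (\<Sum>i\<in>I. f i) = (\<Sum>i\<in>I. X ** (f i :: real ^ 'k ^ 'l))"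
  by (induction I rule: infinite_finite_induct) (simp_all add: matrix_add_ldistrib)

text \<open>A positive definite \<open>S\<close> dominates a multiple of the identity, so its orbit
  under the adjoint controls the orbit of the identity, whose trace is the same for both
  operators.\<close>

lemma decays_if_trace_vanishes:
  fixes A B C :: "real ^ 'k ^ 'k"
  assumes S: "posdef S" and lim: "(\<lambda>k. trace ((congr3_adj A B C ^^ k) S)) \<longlonglongrightarrow> 0"
  shows "decays (congr3 A B C)"
proof (rule decaysI[OF positive_congr3])
  obtain e where e: "e > 0" "psd (S - e *\<^sub>R mat 1)" using posdef_bounds_identity[OF S] .
  let ?T = "congr3_adj A B C"
  have eq: "trace ((congr3 A B C ^^ k) (mat 1)) = trace ((?T ^^ k) (mat 1))" for k
    using trace_congr3_funpow[of "mat 1" k A B C "mat 1"] by simp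
  show "(\<lambda>k. trace ((congr3 A B C ^^ k) (mat 1))) \<longlonglongrightarrow> 0"
  proof (rule tendsto_sandwich[OF always_eventually always_eventually tendsto_const])
    show "\<forall>k. 0 \<le> trace ((congr3 A B C ^^ k) (mat 1))"
      by (intro allI trace_psd_nonneg psd_funpow positive_congr3 psd_one)
    show "\<forall>k. trace ((congr3 A B C ^^ k) (mat 1)) \<le> trace ((?T ^^ k) S) / e"
    proof
      fix k
      have "0 \<le> trace ((?T ^^ k) (S - e *\<^sub>R mat 1))"
        by (intro trace_psd_nonneg psd_funpow positive_congr3 e)
      then have "e * trace ((?T ^^ k) (mat 1)) \<le> trace ((?T ^^ k) S)"
        by (simp add: linear_diff[OF linear_funpow[OF positive_congr3]]
            linear_scale[OF linear_funpow[OF positive_congr3]] trace_sub trace_scaleR)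
      then show "trace ((congr3 A B C ^^ k) (mat 1)) \<le> trace ((?T ^^ k) S) / e"
        using e(1) by (simp add: eq pos_le_divide_eq mult.commute)
    qed
    show "(\<lambda>k. trace ((?T ^^ k) S) / e) \<longlonglongrightarrow> 0"
      using tendsto_divide_zero[OF lim] by simp
  qed
qed

context prob_space
begin

lemma moments_sum:
  fixes z :: "nat \<Rightarrow> 'a \<Rightarrow> real ^ 'n"
  assumes init: "\<And>l. l \<in> {1..r::nat} \<Longrightarrow> z l \<in> initial_states M w"
    and Z2: "(\<Sum>l=1..r. outer (expectation (z l)) (expectation (z l))) = Z2"
    and Z1: "(\<Sum>l=1..r. expectation (\<lambda>\<omega>. outer (z l \<omega>) (z l \<omega>))) = Z1"
  shows "(\<Sum>l=1..r. moments (z l)) = bdiag Z2 (Z1 - Z2)" "(\<Sum>l=1..r. cov (z l)) = Z1 - Z2"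
proof -
  have "expectation (\<lambda>\<omega>. outer (z l \<omega>) (z l \<omega>)) = cov (z l) + outer (expectation (z l)) (expectation (z l))"
    if "l \<in> {1..r}" for l
    using init[OF that] by (intro expectation_outer) (simp add: initial_states_def sqint_def)
  then have "Z1 = (\<Sum>l=1..r. cov (z l)) + Z2"
    unfolding Z1[symmetric] Z2[symmetric] by (simp add: sum.distrib)
  then show c: "(\<Sum>l=1..r. cov (z l)) = Z1 - Z2" by simp
  show "(\<Sum>l=1..r. moments (z l)) = bdiag Z2 (Z1 - Z2)"
    unfolding moments_def bdiag_sum[symmetric] Z2 c ..
qed

text \<open>Mean-square stability is applied to the given \<open>z l\<close> alone: their moments
  add up to a positive definite matrix, whose orbit decides decay.\<close>

lemma stab_gains_nonempty:
  fixes s :: "('n::finite, 'm::finite) mf_system" and z :: "nat \<Rightarrow> 'a \<Rightarrow> real ^ 'n"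
  assumes noise: "noise M w" and init: "\<And>l. l \<in> {1..r::nat} \<Longrightarrow> z l \<in> initial_states M w"
    and sum: "(\<Sum>l=1..r. moments (z l)) = S" and pos: "posdef S" and stab: "stabilizable M s w"
  shows "stab_gains s \<noteq> {}"
proof -
  obtain F Fb where F: "\<And>z. z \<in> initial_states M w \<Longrightarrow> ms_vanishing M (closed_loop M s w F Fb z)"
    using stab unfolding stabilizable_def by blast
  have "(\<lambda>k. trace ((mf_adj s F Fb ^^ k) S)) \<longlonglongrightarrow> 0"
  proof -
    have "trace ((mf_adj s F Fb ^^ k) S) = (\<Sum>l=1..r. trace ((mf_adj s F Fb ^^ k) (moments (z l))))" for k
      unfolding sum[symmetric] by (simp add: linear_sum[OF linear_funpow[OF positive_congr3]] trace_sum)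
    moreover have "(\<lambda>k. \<Sum>l=1..r. trace ((mf_adj s F Fb ^^ k) (moments (z l)))) \<longlonglongrightarrow> (\<Sum>l=1..r. 0)"
      using ms_vanishing_iff[OF noise init] F[OF init] by (intro tendsto_sum) blast
    ultimately show ?thesis by simp
  qed
  from decays_if_trace_vanishes[OF pos this] have "(F, Fb) \<in> stab_gains s"
    by (simp add: stab_gains_iff)
  then show ?thesis by blast
qed

text \<open>Every pair of a mean \<open>c\<close> and a rank one covariance \<open>v v'\<close> is realised by an initial state, as
  an affine image of some \<open>z l\<close> that is not almost surely constant.\<close>

lemma initial_state_exists:
  assumes init: "\<And>l. l \<in> {1..r::nat} \<Longrightarrow> z l \<in> initial_states M w"
    and pos: "posdef (\<Sum>l=1..r. cov (z l :: 'a \<Rightarrow> real ^ 'n))"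
  obtains y where "y \<in> initial_states M w" "moments y = bdiag (outer c c) (outer v (v :: real ^ 'n))"
proof -
  \<comment> \<open>Any nonzero direction serves; it selects a \<open>z l\<close> with positive
    variance along it.\<close>
  define e where "e = (axis undefined 1 :: real ^ 'n)"
  have e0: "e \<noteq> 0" by (simp add: e_def axis_eq_0_iff)
  have "0 < e \<bullet> ((\<Sum>l=1..r. cov (z l)) *v e)" by (rule posdef_quad[OF pos e0])
  also have "\<dots> = (\<Sum>l=1..r. e \<bullet> (cov (z l) *v e))" by (simp add: matrix_sum_vec inner_sum_right)
  finally obtain l where l: "l \<in> {1..r}" "0 < e \<bullet> (cov (z l) *v e)"
    using sum_nonpos[of "{1..r}" "\<lambda>l. e \<bullet> (cov (z l) *v e)"] by (metis not_less)
  define q where "q = e \<bullet> (cov (z l) *v e)"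
  \<comment> \<open>The map takes the component along \<open>e\<close>, scales it to unit variance
    and places it in direction \<open>v\<close>.\<close>
  define A where "A = (1 / sqrt q) *\<^sub>R outer v e"
  define y where "y = (\<lambda>\<omega>. A *v z l \<omega> + (c - A *v expectation (z l)))"
  have sq: "sqint (z l)" using init[OF l(1)] by (simp add: initial_states_def sqint_def)
  have "y \<in> initial_states M w" unfolding y_def by (rule initial_states_affine[OF init[OF l(1)]])
  moreover have "expectation y = c" unfolding y_def expectation_affine[OF sq] by simp
  moreover have "cov y = outer v v"
  proof -
    have "cov y = (1 / sqrt q) *\<^sub>R (1 / sqrt q) *\<^sub>R (outer v e ** cov (z l) ** outer e v)"
      unfolding y_def cov_affine[OF sq]
      by (simp add: A_def matrix_scaleR_left matrix_scaleR_right transpose_scalar transpose_outer)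
    then show ?thesis using l(2) by (simp add: outer_sandwich q_def)
  qed
  ultimately show thesis by (intro that[of y]) (simp_all add: moments_def)
qed

text \<open>The mean square of the output is the quantity tested in \<open>detectable_mat\<close>;
  integrability allows passing from a zero mean square to an almost surely zero output.\<close>

lemma expectation_output:
  assumes noise: "noise M w" and z: "z \<in> initial_states M w"
    and Q: "psd (mfQ s)" "psd (hatQ s)"
  shows "integrable M (\<lambda>\<omega>. (norm (mf_output M s w z k \<omega>))\<^sup>2)"
    "expectation (\<lambda>\<omega>. (norm (mf_output M s w z k \<omega>))\<^sup>2)
      = trace (bdiag (hatQ s) (mfQ s) ** (mf_adj s 0 0 ^^ k) (moments z))"
proof -
  define x where "x = closed_loop M s w 0 0 z k"
  define m where "m = expectation x"
  have x: "sqint x" "moments x = (mf_adj s 0 0 ^^ k) (moments z)"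
    unfolding x_def by (rule closed_loop_moments[OF noise z])+
  have x0: "sqint (\<lambda>\<omega>. x \<omega> - m)" by (rule sqint_diff_const[OF x(1)])
  have c: "cov (\<lambda>\<omega>. x \<omega> - m) = cov x"
    using cov_affine[OF x(1), of "mat 1" "- m"] by simp
  have E: "expectation (\<lambda>\<omega>. x \<omega> - m) = 0" unfolding m_def by (rule expectation_centered[OF x(1)])
  have y: "(norm (mf_output M s w z k \<omega>))\<^sup>2 = m \<bullet> (hatQ s *v m) + (x \<omega> - m) \<bullet> (mfQ s *v (x \<omega> - m))" for \<omega>
    unfolding mf_output_def uncontrolled_eq_closed_loop x_def[symmetric] Let_def m_def[symmetric]
      norm_psd_sqrt[OF psd_bdiag[OF Q(2,1)]] quad_bdiag ..
  note q = expectation_quad[OF x0, of "mfQ s"]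
  show "integrable M (\<lambda>\<omega>. (norm (mf_output M s w z k \<omega>))\<^sup>2)"
    unfolding y using q(1) by simp
  have "expectation (\<lambda>\<omega>. (norm (mf_output M s w z k \<omega>))\<^sup>2) = m \<bullet> (hatQ s *v m) + trace (mfQ s ** cov x)"
    unfolding y using q by (simp add: prob_space c E)
  then show "expectation (\<lambda>\<omega>. (norm (mf_output M s w z k \<omega>))\<^sup>2)
      = trace (bdiag (hatQ s) (mfQ s) ** (mf_adj s 0 0 ^^ k) (moments z))"
    unfolding x(2)[symmetric] by (simp add: moments_def trace_bdiag_mult trace_outer_mult m_def)
qed

text \<open>A zero output forces an almost surely zero initial state, hence zero moments, which the
  linear recursion preserves.\<close>

lemma observable_imp_detectable:
  assumes noise: "noise M w" and obs: "exactly_observable M s w"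
  shows "exactly_detectable M s w"
  unfolding exactly_detectable_def
proof (intro ballI impI)
  fix z :: "'a \<Rightarrow> real ^ 'b" assume z: "z \<in> initial_states M w"
    and out: "\<forall>k. AE \<omega> in M. mf_output M s w z k \<omega> = 0"
  obtain T where "\<And>z. z \<in> initial_states M w \<Longrightarrow>
    (\<forall>k\<le>T. AE \<omega> in M. mf_output M s w z k \<omega> = 0) \<Longrightarrow> AE \<omega> in M. z \<omega> = 0"
    using obs unfolding exactly_observable_def by blast
  then have z0: "AE \<omega> in M. z \<omega> = 0" using z out by blast
  have sq: "sqint z" using z by (simp add: initial_states_def sqint_def)
  have "expectation (\<lambda>\<omega>. (norm (z \<omega>))\<^sup>2) = expectation (\<lambda>\<omega>. 0)"
    by (rule integral_cong_AE) (use z0 sq in \<open>auto simp: sqint_def\<close>)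
  then have "moments z = 0"
    unfolding expectation_norm_square[OF sq] by (intro psd_trace_zero psd_moments[OF sq]) simp
  then have "trace ((mf_adj s 0 0 ^^ k) (moments z)) = 0" for k
    by (simp add: linear_0[OF linear_funpow[OF positive_congr3]])
  then show "ms_vanishing M (uncontrolled M s w z)"
    using ms_vanishing_iff[OF noise z, of s 0 0]
    by (simp add: uncontrolled_eq_closed_loop[abs_def])
qed

text \<open>Two positive semidefinite matrices split into rank-one pairs, each realised as the
  moments of an initial state. The output traces are nonnegative, so their vanishing for the sum
  passes to every summand.\<close>

lemma detectable_mat_if_detectable:
  fixes s :: "('n::finite, 'm::finite) mf_system" and z :: "nat \<Rightarrow> 'a \<Rightarrow> real ^ 'n"
  assumes noise: "noise M w" and init: "\<And>l. l \<in> {1..r::nat} \<Longrightarrow> z l \<in> initial_states M w"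
    and pos: "posdef (\<Sum>l=1..r. cov (z l))"
    and Q: "psd (mfQ s)" "psd (hatQ s)" and det: "exactly_detectable M s w"
  shows "detectable_mat s"
  unfolding detectable_mat_def
proof (intro allI impI)
  fix E V :: "real ^ 'n ^ 'n"
  let ?Q = "bdiag (hatQ s) (mfQ s)" and ?T = "mf_adj s 0 0"
  assume EV: "psd E" "psd V" and zero: "\<forall>k. trace (?Q ** (?T ^^ k) (bdiag E V)) = 0"
  obtain R :: "real ^ 'n ^ 'n" where R: "E = R ** transpose R" by (rule psd_gram_root[OF EV(1)])
  obtain W :: "real ^ 'n ^ 'n" where W: "V = W ** transpose W" by (rule psd_gram_root[OF EV(2)])
  \<comment> \<open>Both Gram roots are square of the same size, so the \<open>i\<close>-th columns
    can be paired, one as a mean and the other as a covariance direction.\<close>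
  define B where "B i = bdiag (outer (column i R) (column i R)) (outer (column i W) (column i W))" for i
  have psdB: "psd (B i)" for i unfolding B_def by (intro psd_bdiag psd_outer)
  have sumB: "bdiag E V = (\<Sum>i\<in>UNIV. B i)"
    unfolding R W gram_eq_sum_outer bdiag_sum B_def ..
  have pow: "(?T ^^ k) (bdiag E V) = (\<Sum>i\<in>UNIV. (?T ^^ k) (B i))" for k
    unfolding sumB by (rule linear_sum[OF linear_funpow[OF positive_congr3]])
  have "trace (?Q ** (?T ^^ k) (B i)) = 0" for k i
  proof -
    have "(\<Sum>i\<in>UNIV. trace (?Q ** (?T ^^ k) (B i))) = 0"
      using zero[rule_format, of k] unfolding pow mult_sum_matrix trace_sum .
    moreover have "0 \<le> trace (?Q ** (?T ^^ k) (B i))" for i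
      by (intro trace_mult_psd_nonneg psd_bdiag Q psd_funpow positive_congr3 psdB)
    ultimately show ?thesis by (simp add: sum_nonneg_eq_0_iff)
  qed
  note zeroB = this
  have limB: "(\<lambda>k. trace ((?T ^^ k) (B i))) \<longlonglongrightarrow> 0" for i
  proof -
    obtain y where y: "y \<in> initial_states M w" "moments y = B i"
      using initial_state_exists[OF init pos] unfolding B_def by blast
    have "AE \<omega> in M. mf_output M s w y k \<omega> = 0" for k
    proof -
      note out = expectation_output[OF noise y(1) Q, of k]
      have "expectation (\<lambda>\<omega>. (norm (mf_output M s w y k \<omega>))\<^sup>2) = 0"
        unfolding out(2) y(2) by (rule zeroB)
      then show ?thesis
        using integral_nonneg_eq_0_iff_AE[OF out(1)] by simp
    qed
    then have "ms_vanishing M (uncontrolled M s w y)"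
      using det y(1) unfolding exactly_detectable_def by blast
    then show ?thesis
      using ms_vanishing_iff[OF noise y(1), of s 0 0] y(2)
      by (simp add: uncontrolled_eq_closed_loop[abs_def])
  qed
  have "(\<lambda>k. \<Sum>i\<in>UNIV. trace ((?T ^^ k) (B i))) \<longlonglongrightarrow> (\<Sum>i\<in>(UNIV::'n set). 0)"
    by (intro tendsto_sum limB)
  then show "(\<lambda>k. trace ((?T ^^ k) (bdiag E V))) \<longlonglongrightarrow> 0"
    unfolding pow trace_sum by simp
qed

lemma total_cost_eq:
  fixes s :: "('n::finite, 'm::finite) mf_system"
  assumes noise: "noise M w" and init: "\<And>l. l \<in> {1..r} \<Longrightarrow> z l \<in> initial_states M w"
    and sum: "(\<Sum>l=1..r. moments (z l)) = S" and st: "(F, Fb) \<in> stab_gains s"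
    and sym: "sym_mat (mfQ s)" "sym_mat (mfQb s)" "sym_mat (mfR s)" "sym_mat (mfRb s)"
  shows "total_cost M s w r z F Fb = ereal (trace (S ** cost_mat s F Fb))"
proof -
  have "total_cost M s w r z F Fb = (\<Sum>l=1..r. ereal (trace (cost_mat s F Fb ** moments (z l))))"
    unfolding total_cost_def using cost_J_eq[OF noise init st sym] by (intro sum.cong) auto
  also have "\<dots> = ereal (trace (cost_mat s F Fb ** S))"
    unfolding sum[symmetric] mult_sum_matrix trace_sum by simp
  also have "trace (cost_mat s F Fb ** S) = trace (S ** cost_mat s F Fb)" by (rule trace_mul_sym)
  finally show ?thesis .
qed

end

section \<open>Unique minimisers and equality of the optimal values\<close>

lemma arg_min_unique:
  fixes f :: "'b \<Rightarrow> 'c::linorder"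
  assumes "P x" "\<And>y. P y \<Longrightarrow> f x \<le> f y" "\<And>y. P y \<Longrightarrow> f y \<le> f x \<Longrightarrow> y = x"
  shows "{p. is_arg_min f P p} = {x}"
  using assms by (auto simp: is_arg_min_linorder)

theorem proposition3p2:
  fixes M :: "'a measure"
    and s :: "('n::finite, 'm::finite) mf_system"
    and w :: "nat \<Rightarrow> 'a \<Rightarrow> real"
    and r :: nat
    and z :: "nat \<Rightarrow> 'a \<Rightarrow> real ^ 'n"
    and Z1 Z2 :: "real ^ 'n ^ 'n"
  assumes prob: "prob_space M"
    and sym: "sym_mat (mfQ s)" "sym_mat (mfQb s)" "sym_mat (mfR s)" "sym_mat (mfRb s)"
    and noise: "noise M w"
    and init: "\<And>l. l \<in> {1..r} \<Longrightarrow> z l \<in> initial_states M w"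
    and Z2: "(\<Sum>l=1..r. outer (prob_space.expectation M (z l)) (prob_space.expectation M (z l))) = Z2"
    and Z1: "(\<Sum>l=1..r. prob_space.expectation M (\<lambda>\<omega>. outer (z l \<omega>) (z l \<omega>))) = Z1"
    and pos: "posdef Z2" "posdef (Z1 - Z2)"
    and standing: "standing_assumption M s w"
  shows "\<exists>S F\<^sub>I Fb\<^sub>I X F\<^sub>I\<^sub>I Fb\<^sub>I\<^sub>I.
      {p. is_arg_min (objective_I s) (feasible_I s Z1 Z2) p} = {(S, F\<^sub>I, Fb\<^sub>I)} \<and>
      {p. is_arg_min (objective_II Z1 Z2) (feasible_II s) p} = {(X, F\<^sub>I\<^sub>I, Fb\<^sub>I\<^sub>I)} \<and>
      {g. is_arg_min (\<lambda>(F, Fb). total_cost M s w r z F Fb) (\<lambda>g. g \<in> stab_gains s) g}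
        = {(F_star s, Fb_star s)} \<and>
      J_I s Z1 Z2 = J_II s Z1 Z2 \<and>
      J_II s Z1 Z2 = total_cost M s w r z (F_star s) (Fb_star s) \<and>
      F\<^sub>I = F\<^sub>I\<^sub>I \<and> F\<^sub>I\<^sub>I = F_star s \<and>
      Fb\<^sub>I = Fb\<^sub>I\<^sub>I \<and> Fb\<^sub>I\<^sub>I = Fb_star s"
proof -
  interpret prob_space M by (rule prob)
  interpret mf_weights s
    by unfold_locales (use standing in \<open>simp_all add: standing_assumption_def hatQ_def hatR_def\<close>)
  define S0 where "S0 = bdiag Z2 (Z1 - Z2)"
  define g where "g F Fb = trace (S0 ** cost_mat s F Fb)" for F Fb
  have S0: "posdef S0" unfolding S0_def by (rule posdef_bdiag[OF pos])
  have symZ: "sym_mat Z2" "sym_mat (Z1 - Z2)" using pos posdef_sym by blast+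
  note sums = moments_sum[OF init Z2 Z1]
  have msum: "(\<Sum>l=1..r. moments (z l)) = S0" unfolding S0_def by (rule sums(1))
  have cpos: "posdef (\<Sum>l=1..r. cov (z l))" using sums(2) pos(2) by simp
  have "exactly_detectable M s w"
    using standing observable_imp_detectable[OF noise] unfolding standing_assumption_def by blast
  then have det: "detectable_mat s"
    by (intro detectable_mat_if_detectable[OF noise _ cpos Qpsd hQpsd] init)
  have "stabilizable M s w" using standing by (simp add: standing_assumption_def)
  then have ne: "stab_gains s \<noteq> {}"
    by (intro stab_gains_nonempty[OF noise _ msum S0] init)
  note opt = optimal_gains[OF det ne S0, folded g_def]
  let ?F = "F_star s" and ?Fb = "Fb_star s"
  define S where "S = gainM ?F ?Fb ** state_mat s S0 ?F ?Fb ** transpose (gainM ?F ?Fb)"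
  define X where "X = congr3 (openD1 s) (openD2 s) (openD3 s) (cost_mat s ?F ?Fb) + weight s"
  \<comment> \<open>Gains determine the matrix variable in both problems, and both objectives as
    well as the total cost are the same function \<open>g\<close> of stabilising gains. Unique
    optimal gains therefore give unique optimal triples.\<close>
  note I = feasible_I_iff[OF sym symZ, folded S0_def] and II = feasible_II_iff[OF sym]
  have oI: "objective_I s (S, F, Fb) = g F Fb" if "feasible_I s Z1 Z2 (S, F, Fb)" for S F Fb
    using objective_I_feasible[OF sym symZ that] by (simp add: g_def S0_def)
  have oII: "objective_II Z1 Z2 (X, F, Fb) = g F Fb" if "feasible_II s (X, F, Fb)" for X F Fb
    using objective_II_feasible[OF sym that] by (simp add: g_def S0_def)
  have tc: "total_cost M s w r z F Fb = ereal (g F Fb)" if "(F, Fb) \<in> stab_gains s" for F Fb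
    unfolding g_def by (rule total_cost_eq[OF noise init msum that sym])
  have fI: "feasible_I s Z1 Z2 (S, ?F, ?Fb)" using opt(1) by (simp add: I S_def)
  have fII: "feasible_II s (X, ?F, ?Fb)" using opt(1) by (simp add: II X_def)
  have minI: "objective_I s (S, ?F, ?Fb) \<le> objective_I s p" if "feasible_I s Z1 Z2 p" for p
    using that opt(2) I oI oI[OF fI] by (cases p) auto
  have minII: "objective_II Z1 Z2 (X, ?F, ?Fb) \<le> objective_II Z1 Z2 p" if "feasible_II s p" for p
    using that opt(2) II oII oII[OF fII] by (cases p) auto
  have "{p. is_arg_min (objective_I s) (feasible_I s Z1 Z2) p} = {(S, ?F, ?Fb)}"
  proof (rule arg_min_unique)
    show "feasible_I s Z1 Z2 (S, ?F, ?Fb)" by (rule fI)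
    show "objective_I s (S, ?F, ?Fb) \<le> objective_I s p" if "feasible_I s Z1 Z2 p" for p
      by (rule minI[OF that])
    fix p assume p: "feasible_I s Z1 Z2 p" "objective_I s p \<le> objective_I s (S, ?F, ?Fb)"
    obtain S' F Fb where [simp]: "p = (S', F, Fb)" by (cases p) auto
    have st: "(F, Fb) \<in> stab_gains s" using p(1) I by simp
    have "F = ?F \<and> Fb = ?Fb" by (rule opt(3)[OF st]) (use p oI oI[OF fI] in simp)
    with p(1) show "p = (S, ?F, ?Fb)" by (simp add: I S_def)
  qed
  moreover have "{p. is_arg_min (objective_II Z1 Z2) (feasible_II s) p} = {(X, ?F, ?Fb)}"
  proof (rule arg_min_unique)
    show "feasible_II s (X, ?F, ?Fb)" by (rule fII)
    show "objective_II Z1 Z2 (X, ?F, ?Fb) \<le> objective_II Z1 Z2 p" if "feasible_II s p" for p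
      by (rule minII[OF that])
    fix p assume p: "feasible_II s p" "objective_II Z1 Z2 p \<le> objective_II Z1 Z2 (X, ?F, ?Fb)"
    obtain X' F Fb where [simp]: "p = (X', F, Fb)" by (cases p) auto
    have st: "(F, Fb) \<in> stab_gains s" using p(1) II by simp
    have "F = ?F \<and> Fb = ?Fb" by (rule opt(3)[OF st]) (use p oII oII[OF fII] in simp)
    with p(1) show "p = (X, ?F, ?Fb)" by (simp add: II X_def)
  qed
  moreover have "{g. is_arg_min (\<lambda>(F, Fb). total_cost M s w r z F Fb) (\<lambda>g. g \<in> stab_gains s) g}
      = {(?F, ?Fb)}"
    by (rule arg_min_unique) (use opt tc in auto)
  \<comment> \<open>The infimum is attained: the minimiser bounds it above, and minimality bounds it
    below.\<close>
  moreover have "J_I s Z1 Z2 = ereal (g ?F ?Fb)"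
    unfolding J_I_def using fI minI oI[OF fI]
    by (intro antisym INF_greatest INF_lower2[of "(S, ?F, ?Fb)"]) auto
  moreover have "J_II s Z1 Z2 = ereal (g ?F ?Fb)"
    unfolding J_II_def using fII minII oII[OF fII]
    by (intro antisym INF_greatest INF_lower2[of "(X, ?F, ?Fb)"]) auto
  ultimately show ?thesis using tc[OF opt(1)] by auto
qed

end
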